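(* (1) The satisfiability problem of the bimodal logic $\mathrm{K4\times S5}$ can be decided by a deterministic (multi-tape) Turing machine in space $O(n\cdot 2^{3n})$, where $n$ is the length of the input formula. (2) The satisfiability problems of the bimodal logics $\mathrm{S4\times S5}$ and $\mathrm{SSL}$ can each be decided by a deterministic (multi-tape) Turing machine in space $O(n\cdot 2^{2n})$, where $n$ is the length of the input formula.
   Context: Bimodal formulas are strings over the alphabet $\{(,),\neg,\wedge,\Box,K,x,0,1\}$ generated by $\varphi ::= \neg\varphi \mid (\varphi\wedge\varphi)\mid K\varphi\mid \Box\varphi \mid A$, where the propositional variables $A\in AT$ are the strings $x0$, $x1$, $x1w$ with $w\in\{0,1\}^+$. The length of a formula is its length as such a string. Abbreviations: $\Diamond\varphi=\neg\Box\neg\varphi$, $L\varphi=\neg K\neg\varphi$. A model is a quadruple $M=(W,\stackrel{\Diamond}{\to},\stackrel{L}{\to},\sigma)$ with $W\neq\emptyset$, two binary relations on $W$ and $\sigma:AT\to\mathcal{P}(W)$; satisfaction is defined by $w\models A$ iff $w\in\sigma(A)$, Boolean clauses as usual, $w\models\Box\varphi$ iff $v\models\varphi$ for all $v$ with $w\stackrel{\Diamond}{\to}v$, and $w\models K\varphi$ iff $v\models\varphi$ for all $v$ with $w\stackrel{L}{\to}v$. For $Y\in\{\mathrm{K4},\mathrm{S4}\}$: a $Y$-frame is $(W_1,R)$ with $R$ transitive (for K4) or reflexive and transitive (for S4); an S5-frame is $(W_2,E)$ with $E$ an equivalence relation. A $Y\times\mathrm{S5}$-product model has $W=W_1\times W_2$,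 $(v_1,v_2)\stackrel{\Diamond}{\to}(w_1,w_2)$ iff $v_1Rw_1$ and $v_2=w_2$, $(v_1,v_2)\stackrel{L}{\to}(w_1,w_2)$ iff $v_2Ew_2$ and $v_1=w_1$, and arbitrary $\sigma$. A formula is $Y\times\mathrm{S5}$-satisfiable iff it holds at some point of some $Y\times\mathrm{S5}$-product model. A cross axiom model is a model in which $\stackrel{\Diamond}{\to}$ is a preorder, $\stackrel{L}{\to}$ is an equivalence relation, left commutativity holds ($\forall w,u,u'$: if $w\stackrel{\Diamond}{\to}u$ and $u\stackrel{L}{\to}u'$ then there is $w'$ with $w\stackrel{L}{\to}w'$ and $w'\stackrel{\Diamond}{\to}u'$), and $w\stackrel{\Diamond}{\to}v$ implies ($w\in\sigma(A)\iff v\in\sigma(A)$) for all $A\in AT$. A formula is $\mathrm{SSL}$-satisfiable iff it holds at some point of some cross axiom model. The satisfiability problem of a logic is the set of (strings of) formulas satisfiable in that logic. *)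

theory Defs
  imports "HOL-Library.Landau_Symbols" "HOL-Library.Countable_Set" "HOL-Library.Infinite_Typeclass"
begin

section \<open>Bimodal formulas as strings\<close>

datatype letter = LPar | RPar | NegL | AndL | BoxL | KL | XL | ZeroL | OneL

text \<open>\<open>X0\<close> is the variable \<open>x0\<close>, and \<open>X1 w\<close> is \<open>x1w\<close> with a possibly empty bit string \<open>w\<close>.\<close>

datatype atom = X0 | X1 "bool list"

datatype form = Atom atom | Neg form | Conj form form | K form | Box form

primrec atom_string :: "atom \<Rightarrow> letter list" where
  "atom_string X0 = [XL, ZeroL]"
| "atom_string (X1 w) = XL # OneL # map (\<lambda>b. if b then OneL else ZeroL) w"

primrec form_string :: "form \<Rightarrow> letter list" where
  "form_string (Atom A) = atom_string A"
| "form_string (Neg \<phi>) = NegL # form_string \<phi>"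
| "form_string (Conj \<phi> \<psi>) = LPar # form_string \<phi> @ AndL # form_string \<psi> @ [RPar]"
| "form_string (K \<phi>) = KL # form_string \<phi>"
| "form_string (Box \<phi>) = BoxL # form_string \<phi>"

section \<open>Models\<close>

record 'w model =
  worlds :: "'w set"
  dia :: "'w rel"
  lrel :: "'w rel"
  val :: "atom \<Rightarrow> 'w set"

definition is_model :: "'w model \<Rightarrow> bool" where
  "is_model M \<longleftrightarrow> worlds M \<noteq> {} \<and> dia M \<subseteq> worlds M \<times> worlds M \<and> lrel M \<subseteq> worlds M \<times> worlds M \<and>
     (\<forall>A. val M A \<subseteq> worlds M)"

primrec sat :: "'w model \<Rightarrow> 'w \<Rightarrow> form \<Rightarrow> bool" where
  "sat M w (Atom A) \<longleftrightarrow> w \<in> val M A"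
| "sat M w (Neg \<phi>) \<longleftrightarrow> \<not> sat M w \<phi>"
| "sat M w (Conj \<phi> \<psi>) \<longleftrightarrow> sat M w \<phi> \<and> sat M w \<psi>"
| "sat M w (K \<phi>) \<longleftrightarrow> (\<forall>v. (w, v) \<in> lrel M \<longrightarrow> sat M v \<phi>)"
| "sat M w (Box \<phi>) \<longleftrightarrow> (\<forall>v. (w, v) \<in> dia M \<longrightarrow> sat M v \<phi>)"

definition K4_frame :: "'a set \<Rightarrow> 'a rel \<Rightarrow> bool" where
  "K4_frame W R \<longleftrightarrow> R \<subseteq> W \<times> W \<and> trans R"

definition S4_frame :: "'a set \<Rightarrow> 'a rel \<Rightarrow> bool" where
  "S4_frame W R \<longleftrightarrow> preorder_on W R"

definition S5_frame :: "'a set \<Rightarrow> 'a rel \<Rightarrow> bool" where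
  "S5_frame W E \<longleftrightarrow> equiv W E"

definition product_model ::
  "'a set \<Rightarrow> 'a rel \<Rightarrow> 'b set \<Rightarrow> 'b rel \<Rightarrow> (atom \<Rightarrow> ('a \<times> 'b) set) \<Rightarrow> ('a \<times> 'b) model" where
  "product_model W1 R W2 E \<sigma> =
     \<lparr>worlds = W1 \<times> W2,
      dia = {((v1, v2), (w1, w2)). (v1, w1) \<in> R \<and> v2 = w2 \<and> v2 \<in> W2},
      lrel = {((v1, v2), (w1, w2)). (v2, w2) \<in> E \<and> v1 = w1 \<and> v1 \<in> W1},
      val = \<sigma>\<rparr>"

definition product_satisfiable ::
  "('a set \<Rightarrow> 'a rel \<Rightarrow> bool) \<Rightarrow> 'b itself \<Rightarrow> form \<Rightarrow> bool" where
  "product_satisfiable Y_frame (_ :: 'b itself) \<phi> \<longleftrightarrow>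
     (\<exists>W1 R (W2 :: 'b set) E \<sigma>. Y_frame W1 R \<and> S5_frame W2 E \<and>
        is_model (product_model W1 R W2 E \<sigma>) \<and>
        (\<exists>w \<in> worlds (product_model W1 R W2 E \<sigma>). sat (product_model W1 R W2 E \<sigma>) w \<phi>))"

definition cross_axiom_model :: "'w model \<Rightarrow> bool" where
  "cross_axiom_model M \<longleftrightarrow> is_model M \<and>
     preorder_on (worlds M) (dia M) \<and>
     equiv (worlds M) (lrel M) \<and>
     (\<forall>w u u'. (w, u) \<in> dia M \<and> (u, u') \<in> lrel M \<longrightarrow> (\<exists>w'. (w, w') \<in> lrel M \<and> (w', u') \<in> dia M)) \<and>
     (\<forall>w v A. (w, v) \<in> dia M \<longrightarrow> (w \<in> val M A \<longleftrightarrow> v \<in> val M A))"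

definition SSL_satisfiable :: "'w itself \<Rightarrow> form \<Rightarrow> bool" where
  "SSL_satisfiable (_ :: 'w itself) \<phi> \<longleftrightarrow>
     (\<exists>M :: 'w model. cross_axiom_model M \<and> (\<exists>w \<in> worlds M. sat M w \<phi>))"

text \<open>
  HOL cannot quantify over all types inside a definition, so the satisfiability problems carry the
  types from which the worlds are drawn; the carriers are arbitrary nonempty sets over these types.
  For infinite types the problems do not depend on the choice and contain every formula that is
  satisfiable over any types whatsoever: see \<open>K4_S5_SAT_universal\<close>, \<open>S4_S5_SAT_universal\<close> and
  \<open>SSL_SAT_universal\<close> below.
\<close>

definition K4_S5_SAT :: "'a itself \<Rightarrow> 'b itself \<Rightarrow> letter list set" where
  "K4_S5_SAT (_ :: 'a itself) TB =
     {form_string \<phi> |\<phi>. product_satisfiable (K4_frame :: 'a set \<Rightarrow> 'a rel \<Rightarrow> bool) TB \<phi>}"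

definition S4_S5_SAT :: "'a itself \<Rightarrow> 'b itself \<Rightarrow> letter list set" where
  "S4_S5_SAT (_ :: 'a itself) TB =
     {form_string \<phi> |\<phi>. product_satisfiable (S4_frame :: 'a set \<Rightarrow> 'a rel \<Rightarrow> bool) TB \<phi>}"

definition SSL_SAT :: "'w itself \<Rightarrow> letter list set" where
  "SSL_SAT TW = {form_string \<phi> |\<phi>. SSL_satisfiable TW \<phi>}"

section \<open>Independence of the universe types\<close>

instance atom :: countable by countable_datatype
instance form :: countable by countable_datatype

lemma countable_closure:
  fixes G :: "'x \<Rightarrow> 'x \<Rightarrow> 'x \<Rightarrow> 'i::countable \<Rightarrow> 'x"
  assumes x0: "x0 \<in> W"
    and G: "\<And>x y z i. x \<in> W \<Longrightarrow> y \<in> W \<Longrightarrow> z \<in> W \<Longrightarrow> G x y z i \<in> W"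
  obtains C where "countable C" "x0 \<in> C" "C \<subseteq> W"
    "\<And>x y z i. x \<in> C \<Longrightarrow> y \<in> C \<Longrightarrow> z \<in> C \<Longrightarrow> G x y z i \<in> C"
proof -
  define S where "S = rec_nat {x0}
    (\<lambda>_ X. X \<union> (\<lambda>(x, y, z, i). G x y z i) ` (X \<times> X \<times> X \<times> (UNIV :: 'i set)))"
  have S0: "S 0 = {x0}"
    and SS: "S (Suc n) = S n \<union> (\<lambda>(x, y, z, i). G x y z i) ` (S n \<times> S n \<times> S n \<times> UNIV)" for n
    by (simp_all add: S_def)
  have c: "countable (S n)" for n
    by (induction n) (auto simp: S0 SS)
  have sub: "S n \<subseteq> W" for n
    by (induction n) (auto simp: S0 SS x0 intro!: G)
  have mono: "m \<le> n \<Longrightarrow> S m \<subseteq> S n" for m n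
    by (rule lift_Suc_mono_le) (auto simp: SS)
  have cl: "G x y z i \<in> (\<Union>n. S n)" if xyz: "x \<in> (\<Union>n. S n)" "y \<in> (\<Union>n. S n)" "z \<in> (\<Union>n. S n)" for x y z i
  proof -
    from xyz obtain a b c where abc: "x \<in> S a" "y \<in> S b" "z \<in> S c" by auto
    define m where "m = max a (max b c)"
    have "x \<in> S m" "y \<in> S m" "z \<in> S m"
      using abc mono[of a m] mono[of b m] mono[of c m] unfolding m_def by (meson max.cobounded1 max.cobounded2 max.coboundedI2 subsetD)+
    then have "(x, y, z, i) \<in> S m \<times> S m \<times> S m \<times> UNIV" by simp
    from imageI[OF this, of "\<lambda>(x, y, z, i). G x y z i"] have "G x y z i \<in> S (Suc m)"
      unfolding SS by simp
    then show ?thesis by blast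
  qed
  show ?thesis
  proof (rule that)
    show "countable (\<Union>n. S n)" using c by simp
    show "x0 \<in> (\<Union>n. S n)" using S0 by blast
    show "(\<Union>n. S n) \<subseteq> W" using sub by blast
  qed (rule cl)
qed

lemma countable_copy:
  assumes "countable C"
  obtains V :: "'a::infinite set" and g :: "'a \<Rightarrow> 'c" where "bij_betw g V C"
proof -
  obtain h :: "nat \<Rightarrow> 'a" where h: "inj h"
    using infinite_countable_subset[OF infinite_UNIV] by blast
  have "inj_on (h \<circ> to_nat_on C) C"
    by (intro comp_inj_on inj_on_to_nat_on assms inj_on_subset[OF h]) auto
  then have "bij_betw (h \<circ> to_nat_on C) C ((h \<circ> to_nat_on C) ` C)"
    by (rule inj_on_imp_bij_betw)
  then show ?thesis using that bij_betw_inv_into by blast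
qed

lemma sat_reflect:
  assumes W: "dia N \<subseteq> worlds N \<times> worlds N" "lrel N \<subseteq> worlds N \<times> worlds N"
    and val: "\<And>w A. w \<in> worlds N \<Longrightarrow> w \<in> val N A \<longleftrightarrow> g w \<in> val M A"
    and dia: "\<And>w v. (w, v) \<in> dia N \<Longrightarrow> (g w, g v) \<in> dia M"
    and lrel: "\<And>w v. (w, v) \<in> lrel N \<Longrightarrow> (g w, g v) \<in> lrel M"
    and dia': "\<And>w \<phi>. w \<in> worlds N \<Longrightarrow> \<not> sat M (g w) (Box \<phi>) \<Longrightarrow> \<exists>v. (w, v) \<in> dia N \<and> \<not> sat M (g v) \<phi>"
    and lrel': "\<And>w \<phi>. w \<in> worlds N \<Longrightarrow> \<not> sat M (g w) (K \<phi>) \<Longrightarrow> \<exists>v. (w, v) \<in> lrel N \<and> \<not> sat M (g v) \<phi>"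
  shows "w \<in> worlds N \<Longrightarrow> sat N w \<phi> \<longleftrightarrow> sat M (g w) \<phi>"
proof (induction \<phi> arbitrary: w)
  case (K \<phi>)
  have IH: "(w, v) \<in> lrel N \<Longrightarrow> sat N v \<phi> \<longleftrightarrow> sat M (g v) \<phi>" for v
    using K.IH W by blast
  show ?case
  proof
    assume "sat N w (K \<phi>)"
    then show "sat M (g w) (K \<phi>)" using lrel'[OF K.prems, of \<phi>] IH by auto
  next
    assume "sat M (g w) (K \<phi>)"
    then show "sat N w (K \<phi>)" using lrel IH by auto
  qed
next
  case (Box \<phi>)
  have IH: "(w, v) \<in> dia N \<Longrightarrow> sat N v \<phi> \<longleftrightarrow> sat M (g v) \<phi>" for v
    using Box.IH W by blast
  show ?case
  proof
    assume "sat N w (Box \<phi>)"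
    then show "sat M (g w) (Box \<phi>)" using dia'[OF Box.prems, of \<phi>] IH by auto
  next
    assume "sat M (g w) (Box \<phi>)"
    then show "sat N w (Box \<phi>)" using dia IH by auto
  qed
qed (use val in auto)

text \<open>A choice of worlds refuting \<open>\<phi>\<close> whenever \<open>Box \<phi>\<close> or \<open>K \<phi>\<close> fails.\<close>

definition box_witness :: "'w model \<Rightarrow> 'w \<Rightarrow> form \<Rightarrow> 'w" where
  "box_witness M w \<phi> = (if sat M w (Box \<phi>) then w else SOME v. (w, v) \<in> dia M \<and> \<not> sat M v \<phi>)"

definition K_witness :: "'w model \<Rightarrow> 'w \<Rightarrow> form \<Rightarrow> 'w" where
  "K_witness M w \<phi> = (if sat M w (K \<phi>) then w else SOME v. (w, v) \<in> lrel M \<and> \<not> sat M v \<phi>)"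

lemma box_witness:
  assumes "\<not> sat M w (Box \<phi>)"
  shows "(w, box_witness M w \<phi>) \<in> dia M \<and> \<not> sat M (box_witness M w \<phi>) \<phi>"
  using assms someI_ex[of "\<lambda>v. (w, v) \<in> dia M \<and> \<not> sat M v \<phi>"] by (auto simp: box_witness_def)

lemma K_witness:
  assumes "\<not> sat M w (K \<phi>)"
  shows "(w, K_witness M w \<phi>) \<in> lrel M \<and> \<not> sat M (K_witness M w \<phi>) \<phi>"
  using assms someI_ex[of "\<lambda>v. (w, v) \<in> lrel M \<and> \<not> sat M v \<phi>"] by (auto simp: K_witness_def)

lemma box_witness_in: "is_model M \<Longrightarrow> w \<in> worlds M \<Longrightarrow> box_witness M w \<phi> \<in> worlds M"
  using box_witness[of M w \<phi>] unfolding is_model_def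
  by (cases "sat M w (Box \<phi>)") (simp add: box_witness_def, blast)

lemma K_witness_in: "is_model M \<Longrightarrow> w \<in> worlds M \<Longrightarrow> K_witness M w \<phi> \<in> worlds M"
  using K_witness[of M w \<phi>] unfolding is_model_def
  by (cases "sat M w (K \<phi>)") (simp add: K_witness_def, blast)

definition pullback :: "('a \<Rightarrow> 'c) \<Rightarrow> 'a set \<Rightarrow> 'c rel \<Rightarrow> 'a rel" where
  "pullback g V R = {(x, y). x \<in> V \<and> y \<in> V \<and> (g x, g y) \<in> R}"

lemma pullback_equiv: "equiv W E \<Longrightarrow> g ` V \<subseteq> W \<Longrightarrow> equiv V (pullback g V E)"
  unfolding equiv_def pullback_def refl_on_def sym_on_def trans_on_def by blast

lemma pullback_K4: "K4_frame W R \<Longrightarrow> K4_frame V (pullback g V R)"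
  unfolding K4_frame_def pullback_def trans_on_def by blast

lemma pullback_S4: "S4_frame W R \<Longrightarrow> g ` V \<subseteq> W \<Longrightarrow> S4_frame V (pullback g V R)"
  unfolding S4_frame_def preorder_on_def pullback_def refl_on_def trans_on_def by blast

lemma product_universal:
  fixes Y :: "'c set \<Rightarrow> 'c rel \<Rightarrow> bool" and Y' :: "'a::infinite set \<Rightarrow> 'a rel \<Rightarrow> bool"
  assumes Y: "\<And>W R V g. Y W R \<Longrightarrow> g ` V \<subseteq> W \<Longrightarrow> Y' V (pullback g V R)"
    and sat: "product_satisfiable Y TYPE('d) \<phi>"
  shows "product_satisfiable Y' TYPE('b::infinite) \<phi>"
proof -
  from sat obtain W1 R and W2 :: "'d set" and E \<sigma> w0 where
    fr: "Y W1 R" "S5_frame W2 E" and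
    mod: "is_model (product_model W1 R W2 E \<sigma>)" (is "is_model ?M") and
    w0: "w0 \<in> worlds (product_model W1 R W2 E \<sigma>)" and s: "sat (product_model W1 R W2 E \<sigma>) w0 \<phi>"
    unfolding product_satisfiable_def by blast
  define G where "G x (y :: 'c \<times> 'd) (z :: 'c \<times> 'd) (i :: form \<times> nat) =
    (if snd i = 0 then box_witness ?M x (fst i) else if snd i = 1 then K_witness ?M x (fst i)
     else (fst x, snd y))" for x y z i
  have WM: "worlds ?M = W1 \<times> W2" by (simp add: product_model_def)
  obtain C where C: "countable C" "w0 \<in> C" "C \<subseteq> worlds ?M"
    and cl: "\<And>x y z i. x \<in> C \<Longrightarrow> y \<in> C \<Longrightarrow> z \<in> C \<Longrightarrow> G x y z i \<in> C"
  proof (rule countable_closure[of w0 "worlds ?M" G])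
    show "G x y z i \<in> worlds ?M" if "x \<in> worlds ?M" "y \<in> worlds ?M" "z \<in> worlds ?M" for x y z i
      using that box_witness_in[OF mod] K_witness_in[OF mod] unfolding G_def WM by auto
  qed (use w0 in auto)
  have Cprod: "(a, b) \<in> C" if "a \<in> fst ` C" "b \<in> snd ` C" for a b
  proof -
    from that obtain x y where "x \<in> C" "y \<in> C" "a = fst x" "b = snd y" by auto
    then show ?thesis using cl[of x y x "(undefined, 2)"] by (simp add: G_def)
  qed
  have Cbox: "x \<in> C \<Longrightarrow> box_witness ?M x \<psi> \<in> C" for x \<psi>
    using cl[of x x x "(\<psi>, 0)"] by (simp add: G_def)
  have CK: "x \<in> C \<Longrightarrow> K_witness ?M x \<psi> \<in> C" for x \<psi>
    using cl[of x x x "(\<psi>, 1)"] by (simp add: G_def)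
  obtain V1 :: "'a set" and g1 where g1: "bij_betw g1 V1 (fst ` C)"
    by (rule countable_copy[of "fst ` C"]) (use C in auto)
  obtain V2 :: "'b set" and g2 where g2: "bij_betw g2 V2 (snd ` C)"
    by (rule countable_copy[of "snd ` C"]) (use C in auto)
  define g where "g = map_prod g1 g2"
  have im: "g1 ` V1 = fst ` C" "g2 ` V2 = snd ` C"
    using g1 g2 by (auto simp: bij_betw_def)
  have sub: "g1 ` V1 \<subseteq> W1" "g2 ` V2 \<subseteq> W2" using C(3) unfolding im WM by auto
  have gC: "g x \<in> C" if "x \<in> V1 \<times> V2" for x
  proof -
    have "g1 (fst x) \<in> fst ` C" "g2 (snd x) \<in> snd ` C" using that unfolding im[symmetric] by auto
    from Cprod[OF this] show ?thesis by (simp add: g_def map_prod_def case_prod_beta)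
  qed
  have surj: "\<exists>x \<in> V1 \<times> V2. g x = c" if "c \<in> C" for c
  proof -
    have "fst c \<in> g1 ` V1" "snd c \<in> g2 ` V2" using that im by auto
    then obtain a b where "a \<in> V1" "b \<in> V2" "g1 a = fst c" "g2 b = snd c" by auto
    then show ?thesis by (intro bexI[of _ "(a, b)"]) (auto simp: g_def)
  qed
  define \<tau> where "\<tau> A = {x \<in> V1 \<times> V2. g x \<in> \<sigma> A}" for A
  define N where "N = product_model V1 (pullback g1 V1 R) V2 (pullback g2 V2 E) \<tau>"
  have WN: "worlds N = V1 \<times> V2" and valN: "val N = \<tau>" by (simp_all add: N_def product_model_def)
  have inj: "inj_on g1 V1" "inj_on g2 V2" using g1 g2 by (auto simp: bij_betw_def)
  have dN: "(x, y) \<in> dia N \<longleftrightarrow> x \<in> V1 \<times> V2 \<and> y \<in> V1 \<times> V2 \<and> (g x, g y) \<in> dia ?M" for x y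
    using inj sub by (cases x; cases y) (auto simp: N_def product_model_def g_def pullback_def inj_on_eq_iff)
  have lN: "(x, y) \<in> lrel N \<longleftrightarrow> x \<in> V1 \<times> V2 \<and> y \<in> V1 \<times> V2 \<and> (g x, g y) \<in> lrel ?M" for x y
    using inj sub by (cases x; cases y) (auto simp: N_def product_model_def g_def pullback_def inj_on_eq_iff)
  have refl: "w \<in> worlds N \<Longrightarrow> sat N w \<psi> \<longleftrightarrow> sat ?M (g w) \<psi>" for w \<psi>
  proof (rule sat_reflect)
    fix w A assume "w \<in> worlds N"
    then show "w \<in> val N A \<longleftrightarrow> g w \<in> val ?M A"
      unfolding valN WN \<tau>_def by (simp add: product_model_def)
  next
    fix w \<psi> assume w: "w \<in> worlds N" and n: "\<not> sat ?M (g w) (Box \<psi>)"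
    obtain x where x: "x \<in> V1 \<times> V2" "g x = box_witness ?M (g w) \<psi>"
      using surj[OF Cbox[OF gC]] w unfolding WN by blast
    show "\<exists>v. (w, v) \<in> dia N \<and> \<not> sat ?M (g v) \<psi>"
      using x w box_witness[OF n] dN unfolding WN by metis
  next
    fix w \<psi> assume w: "w \<in> worlds N" and n: "\<not> sat ?M (g w) (K \<psi>)"
    obtain x where x: "x \<in> V1 \<times> V2" "g x = K_witness ?M (g w) \<psi>"
      using surj[OF CK[OF gC]] w unfolding WN by blast
    show "\<exists>v. (w, v) \<in> lrel N \<and> \<not> sat ?M (g v) \<psi>"
      using x w K_witness[OF n] lN unfolding WN by metis
  qed (auto simp: dN lN WN)
  obtain x where x: "x \<in> V1 \<times> V2" "g x = w0" using surj[OF C(2)] by blast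
  have "is_model N" using x(1) dN lN unfolding is_model_def WN valN \<tau>_def by auto
  moreover have "sat N x \<phi>" using refl[of x \<phi>] x s unfolding WN by simp
  moreover have "Y' V1 (pullback g1 V1 R)" using Y fr(1) sub(1) by blast
  moreover have "S5_frame V2 (pullback g2 V2 E)"
    using pullback_equiv fr(2) sub(2) unfolding S5_frame_def by blast
  moreover have "x \<in> worlds N" using x WN by simp
  ultimately show ?thesis unfolding product_satisfiable_def N_def by blast
qed

lemma SSL_universal:
  assumes "SSL_satisfiable TYPE('v) \<phi>"
  shows "SSL_satisfiable TYPE('w::infinite) \<phi>"
proof -
  from assms obtain M :: "'v model" and w0 where
    cam: "cross_axiom_model M" and w0: "w0 \<in> worlds M" and s: "sat M w0 \<phi>"
    unfolding SSL_satisfiable_def by blast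
  have mod: "is_model M" using cam by (simp add: cross_axiom_model_def)
  define P where "P w (u :: 'v) u' w' \<longleftrightarrow> (w, w') \<in> lrel M \<and> (w', u') \<in> dia M" for w u u' w'
  define lc where "lc w u u' = (if (w, u) \<in> dia M \<and> (u, u') \<in> lrel M then SOME w'. P w u u' w' else w)" for w u u'
  have lc: "P w u u' (lc w u u')" if "(w, u) \<in> dia M" "(u, u') \<in> lrel M" for w u u'
  proof -
    have "\<exists>w'. P w u u' w'" using cam that unfolding cross_axiom_model_def P_def by blast
    then show ?thesis using that someI_ex[of "P w u u'"] by (simp add: lc_def)
  qed
  have lc_in: "lc w u u' \<in> worlds M" if "w \<in> worlds M" for w u u'
    using lc[of w u u'] that mod unfolding lc_def P_def is_model_def
    by (cases "(w, u) \<in> dia M \<and> (u, u') \<in> lrel M") auto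
  define G where "G x y z (i :: form \<times> nat) =
    (if snd i = 0 then box_witness M x (fst i) else if snd i = 1 then K_witness M x (fst i)
     else lc x y z)" for x y z i
  obtain C where C: "countable C" "w0 \<in> C" "C \<subseteq> worlds M"
    and cl: "\<And>x y z i. x \<in> C \<Longrightarrow> y \<in> C \<Longrightarrow> z \<in> C \<Longrightarrow> G x y z i \<in> C"
  proof (rule countable_closure[of w0 "worlds M" G])
    show "G x y z i \<in> worlds M" if "x \<in> worlds M" "y \<in> worlds M" "z \<in> worlds M" for x y z i
      using that box_witness_in[OF mod] K_witness_in[OF mod] lc_in unfolding G_def by auto
  qed (use w0 in auto)
  have Cbox: "x \<in> C \<Longrightarrow> box_witness M x \<psi> \<in> C" for x \<psi>
    using cl[of x x x "(\<psi>, 0)"] by (simp add: G_def)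
  have CK: "x \<in> C \<Longrightarrow> K_witness M x \<psi> \<in> C" for x \<psi>
    using cl[of x x x "(\<psi>, 1)"] by (simp add: G_def)
  have Clc: "x \<in> C \<Longrightarrow> y \<in> C \<Longrightarrow> z \<in> C \<Longrightarrow> lc x y z \<in> C" for x y z
    using cl[of x y z "(undefined, 2)"] by (simp add: G_def)
  obtain V :: "'w set" and g where g: "bij_betw g V C"
    by (rule countable_copy[OF C(1)])
  have im: "g ` V = C" using g by (auto simp: bij_betw_def)
  have gC: "x \<in> V \<Longrightarrow> g x \<in> C" for x using im by blast
  have surj: "\<exists>x \<in> V. g x = c" if "c \<in> C" for c using im that by blast
  define N where "N = \<lparr>worlds = V, dia = pullback g V (dia M), lrel = pullback g V (lrel M),
    val = (\<lambda>A. {x \<in> V. g x \<in> val M A})\<rparr>"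
  have WN: "worlds N = V" and valN: "val N A = {x \<in> V. g x \<in> val M A}" for A
    by (simp_all add: N_def)
  have dN: "(x, y) \<in> dia N \<longleftrightarrow> x \<in> V \<and> y \<in> V \<and> (g x, g y) \<in> dia M" for x y
    by (simp add: N_def pullback_def)
  have lN: "(x, y) \<in> lrel N \<longleftrightarrow> x \<in> V \<and> y \<in> V \<and> (g x, g y) \<in> lrel M" for x y
    by (simp add: N_def pullback_def)
  have refl: "w \<in> worlds N \<Longrightarrow> sat N w \<psi> \<longleftrightarrow> sat M (g w) \<psi>" for w \<psi>
  proof (rule sat_reflect)
    fix w \<psi> assume w: "w \<in> worlds N" and n: "\<not> sat M (g w) (Box \<psi>)"
    obtain x where x: "x \<in> V" "g x = box_witness M (g w) \<psi>"
      using surj[OF Cbox[OF gC]] w unfolding WN by blast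
    show "\<exists>v. (w, v) \<in> dia N \<and> \<not> sat M (g v) \<psi>"
      using x w box_witness[OF n] dN unfolding WN by metis
  next
    fix w \<psi> assume w: "w \<in> worlds N" and n: "\<not> sat M (g w) (K \<psi>)"
    obtain x where x: "x \<in> V" "g x = K_witness M (g w) \<psi>"
      using surj[OF CK[OF gC]] w unfolding WN by blast
    show "\<exists>v. (w, v) \<in> lrel N \<and> \<not> sat M (g v) \<psi>"
      using x w K_witness[OF n] lN unfolding WN by metis
  qed (auto simp: dN lN WN valN)
  obtain x where x: "x \<in> V" "g x = w0" using surj[OF C(2)] by blast
  have isN: "is_model N" using x(1) dN lN unfolding is_model_def WN valN by auto
  have "cross_axiom_model N"
    unfolding cross_axiom_model_def
  proof (intro conjI allI impI)
    have "S4_frame (worlds M) (dia M)"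
      using cam by (simp add: S4_frame_def cross_axiom_model_def)
    then show "preorder_on (worlds N) (dia N)"
      using pullback_S4[of "worlds M" "dia M" g V] im C(3) by (simp add: S4_frame_def N_def)
    show "equiv (worlds N) (lrel N)"
      using cam C(3) pullback_equiv[of "worlds M" "lrel M" g V] im
      by (auto simp: cross_axiom_model_def N_def)
  next
    fix w u u' assume h: "(w, u) \<in> dia N \<and> (u, u') \<in> lrel N"
    then have *: "(g w, g u) \<in> dia M" "(g u, g u') \<in> lrel M" "w \<in> V" "u \<in> V" "u' \<in> V"
      unfolding dN lN by auto
    obtain w' where "w' \<in> V" "g w' = lc (g w) (g u) (g u')"
      using surj[OF Clc[OF gC gC gC]] * by blast
    then show "\<exists>w'. (w, w') \<in> lrel N \<and> (w', u') \<in> dia N"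
      using lc[OF *(1,2)] * unfolding P_def dN lN by metis
  next
    fix w v A assume "(w, v) \<in> dia N"
    then show "w \<in> val N A \<longleftrightarrow> v \<in> val N A"
      using cam unfolding cross_axiom_model_def dN valN by blast
  qed (rule isN)
  moreover have "sat N x \<phi>" using refl[of x \<phi>] x s unfolding WN by simp
  ultimately show ?thesis using x WN unfolding SSL_satisfiable_def by blast
qed

theorem K4_S5_SAT_universal:
  "K4_S5_SAT TYPE('c) TYPE('d) \<subseteq> K4_S5_SAT TYPE('a::infinite) TYPE('b::infinite)"
proof -
  have "product_satisfiable (K4_frame :: 'c set \<Rightarrow> _) TYPE('d) \<phi> \<Longrightarrow>
      product_satisfiable (K4_frame :: 'a set \<Rightarrow> _) TYPE('b) \<phi>" for \<phi>
    by (erule product_universal[rotated]) (rule pullback_K4)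
  then show ?thesis unfolding K4_S5_SAT_def by blast
qed

theorem S4_S5_SAT_universal:
  "S4_S5_SAT TYPE('c) TYPE('d) \<subseteq> S4_S5_SAT TYPE('a::infinite) TYPE('b::infinite)"
proof -
  have "product_satisfiable (S4_frame :: 'c set \<Rightarrow> _) TYPE('d) \<phi> \<Longrightarrow>
      product_satisfiable (S4_frame :: 'a set \<Rightarrow> _) TYPE('b) \<phi>" for \<phi>
    by (erule product_universal[rotated]) (rule pullback_S4)
  then show ?thesis unfolding S4_S5_SAT_def by blast
qed

theorem SSL_SAT_universal: "SSL_SAT TYPE('v) \<subseteq> SSL_SAT TYPE('w::infinite)"
proof -
  have "SSL_satisfiable TYPE('v) \<phi> \<Longrightarrow> SSL_satisfiable TYPE('w) \<phi>" for \<phi>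
    by (rule SSL_universal)
  then show ?thesis unfolding SSL_SAT_def by blast
qed

section \<open>Deterministic multi-tape Turing machines\<close>

datatype 'i tape_symbol = Blank | Input 'i | Aux nat

datatype move = MoveL | Stay | MoveR

fun offset :: "move \<Rightarrow> int" where
  "offset MoveL = - 1"
| "offset Stay = 0"
| "offset MoveR = 1"

text \<open>
  The transition function maps a state and the list of scanned symbols (one per tape) to the new
  state and, for every tape, the symbol to be written and the head movement.
\<close>

record 'i tm =
  tm_tapes :: nat
  tm_states :: "nat set"
  tm_alphabet :: "'i tape_symbol set"
  tm_start :: nat
  tm_accept :: nat
  tm_reject :: nat
  tm_delta :: "nat \<Rightarrow> 'i tape_symbol list \<Rightarrow> nat \<times> ('i tape_symbol \<times> move) list"

definition turing_machine :: "'i tm \<Rightarrow> bool" where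
  "turing_machine M \<longleftrightarrow>
     tm_tapes M \<ge> 1 \<and>
     finite (tm_states M) \<and> {tm_start M, tm_accept M, tm_reject M} \<subseteq> tm_states M \<and>
     tm_accept M \<noteq> tm_reject M \<and>
     finite (tm_alphabet M) \<and> insert Blank (range Input) \<subseteq> tm_alphabet M \<and>
     (\<forall>q \<in> tm_states M. \<forall>ss \<in> lists (tm_alphabet M). length ss = tm_tapes M \<longrightarrow>
        (case tm_delta M q ss of (q', acts) \<Rightarrow>
           q' \<in> tm_states M \<and> length acts = tm_tapes M \<and> fst ` set acts \<subseteq> tm_alphabet M))"

text \<open>A tape is two-way infinite and comes with the position of its head.\<close>

type_synonym 'i tape = "(int \<Rightarrow> 'i tape_symbol) \<times> int"
type_synonym 'i config = "nat \<times> 'i tape list"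

definition tm_halted :: "'i tm \<Rightarrow> 'i config \<Rightarrow> bool" where
  "tm_halted M c \<longleftrightarrow> fst c = tm_accept M \<or> fst c = tm_reject M"

definition tm_step :: "'i tm \<Rightarrow> 'i config \<Rightarrow> 'i config" where
  "tm_step M c =
     (if tm_halted M c then c
      else case tm_delta M (fst c) (map (\<lambda>(t, h). t h) (snd c)) of (q', acts) \<Rightarrow>
        (q', map2 (\<lambda>(t, h) (s, m). (t(h := s), h + offset m)) (snd c) acts))"

definition input_tape :: "'i list \<Rightarrow> 'i tape" where
  "input_tape w = (\<lambda>p. if 0 \<le> p \<and> p < int (length w) then Input (w ! nat p) else Blank, 0)"

definition tm_init :: "'i tm \<Rightarrow> 'i list \<Rightarrow> 'i config" where
  "tm_init M w = (tm_start M, input_tape w # replicate (tm_tapes M - 1) (\<lambda>_. Blank, 0))"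

definition tm_run :: "'i tm \<Rightarrow> 'i list \<Rightarrow> nat \<Rightarrow> 'i config" where
  "tm_run M w t = (tm_step M ^^ t) (tm_init M w)"

text \<open>
  The space is the number of cells scanned during the computation, summed over all tapes, the input
  tape included. It is meaningful for halting computations only.
\<close>

definition tm_space :: "'i tm \<Rightarrow> 'i list \<Rightarrow> nat" where
  "tm_space M w = (\<Sum>i < tm_tapes M. card (range (\<lambda>t. snd (snd (tm_run M w t) ! i))))"

definition tm_decides :: "'i tm \<Rightarrow> 'i list set \<Rightarrow> bool" where
  "tm_decides M L \<longleftrightarrow>
     (\<forall>w. \<exists>t. fst (tm_run M w t) = (if w \<in> L then tm_accept M else tm_reject M))"

definition DSPACE :: "(nat \<Rightarrow> real) \<Rightarrow> 'i list set set" where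
  "DSPACE f = {L. \<exists>M s. turing_machine M \<and> tm_decides M L \<and>
     (\<forall>w. tm_space M w \<le> s (length w)) \<and> (\<lambda>n. real (s n)) \<in> O(f)}"

end

theory Submission
  imports Defs
begin

text \<open>
  Time does not matter for a space bound, so the machine may search by brute force: registers that hold
  numbers \<open>N\<close> occupy \<open>O(log N)\<close> cells, and it suffices to decide satisfiability by bounded
  recursion on numbers polynomial in \<open>2 ^ (n * 4 ^ n)\<close>.

  A formula of length \<open>n\<close> has at most \<open>2 ^ n\<close> types, and an \<open>L\<close>-class of a model is described by its
  cloud, the set of the types it realises. A formula is satisfiable iff it belongs to a type of a good
  cloud, where the good clouds form the largest set of coherent clouds in which every failing box of a
  type has a witness in a good successor cloud. The successors of a cloud only depend on its up-closure
  and its down-closure with respect to the order of types induced by boxes. The former shrinks and the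
  latter grows along successors, so at most about \<open>2 * 2 ^ n\<close> different pairs of closures occur on a
  path. A recursion along these pairs that computes, for each pair, the \<open>n * 2 ^ n\<close> bits saying which
  failing boxes can be witnessed, therefore needs a stack of \<open>O(n * 4 ^ n)\<close> bits, for all three
  logics.
\<close>

section \<open>Bijective base-9 numerals\<close>

fun digit_val :: "letter \<Rightarrow> nat" where
  "digit_val LPar = 1" | "digit_val RPar = 2" | "digit_val NegL = 3" | "digit_val AndL = 4"
| "digit_val BoxL = 5" | "digit_val KL = 6" | "digit_val XL = 7" | "digit_val ZeroL = 8"
| "digit_val OneL = 9"

definition digit_of :: "nat \<Rightarrow> letter" where
  "digit_of k = [LPar, RPar, NegL, AndL, BoxL, KL, XL, ZeroL, OneL] ! (k - 1)"

abbreviation num_val :: "letter list \<Rightarrow> nat" where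
  "num_val \<equiv> horner_sum digit_val 9"

fun num_inc :: "letter list \<Rightarrow> letter list" where
  "num_inc [] = [LPar]"
| "num_inc (d # ds) =
     (if d = OneL then LPar # num_inc ds else digit_of (digit_val d + 1) # ds)"

fun num_dec :: "letter list \<Rightarrow> letter list" where
  "num_dec [] = []"
| "num_dec (d # ds) =
     (if d = LPar then (if ds = [] then [] else OneL # num_dec ds)
      else digit_of (digit_val d - 1) # ds)"

lemma digit_val_bounds: "1 \<le> digit_val d" "digit_val d \<le> 9"
  by (cases d; simp)+

lemma digit_val_pos [simp]: "0 < digit_val d"
  using digit_val_bounds(1)[of d] by simp

lemma digit_of_digit_val [simp]: "digit_of (digit_val d) = d"
  by (cases d) (simp_all add: digit_of_def)

lemma digit_val_inject: "digit_val d = digit_val d' \<longleftrightarrow> d = d'"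
  by (metis digit_of_digit_val)

lemma digit_val_succ: "d \<noteq> OneL \<Longrightarrow> digit_val (digit_of (digit_val d + 1)) = digit_val d + 1"
  by (cases d) (simp_all add: digit_of_def)

lemma digit_val_pred: "d \<noteq> LPar \<Longrightarrow> digit_val (digit_of (digit_val d - 1)) = digit_val d - 1"
  by (cases d) (simp_all add: digit_of_def)

lemma num_val_eq_0_iff [simp]: "num_val ds = 0 \<longleftrightarrow> ds = []"
  using digit_val_bounds(1) by (cases ds) (auto simp: Suc_le_eq)

lemma num_val_inc: "num_val (num_inc ds) = Suc (num_val ds)"
  by (induction ds) (auto simp: digit_val_succ[simplified])

lemma num_val_dec: "num_val (num_dec ds) = num_val ds - 1"
proof (induction ds)
  case (Cons d ds)
  show ?case
  proof (cases "d = LPar \<and> ds \<noteq> []")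
    case True
    then obtain k where "num_val ds = Suc k"
      using num_val_eq_0_iff not0_implies_Suc by blast
    with True Cons.IH show ?thesis by simp
  next
    case False
    then show ?thesis
      using digit_val_bounds(1)[of d] by (auto simp: digit_val_pred[simplified])
  qed
qed simp

lemma num_val_inject: "num_val xs = num_val ys \<longleftrightarrow> xs = ys"
proof
  show "num_val xs = num_val ys \<Longrightarrow> xs = ys"
  proof (induction xs arbitrary: ys)
    case Nil
    then show ?case using num_val_eq_0_iff[of ys] by simp
  next
    case (Cons d ds)
    then obtain d' ds' where ys: "ys = d' # ds'"
      using num_val_eq_0_iff[of "d # ds"] by (cases ys) auto
    have "digit_val d + 9 * num_val ds = digit_val d' + 9 * num_val ds'"
      using Cons.prems ys by simp
    moreover have "1 \<le> digit_val d" "digit_val d \<le> 9" "1 \<le> digit_val d'" "digit_val d' \<le> 9"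
      by (rule digit_val_bounds)+
    ultimately have "digit_val d = digit_val d'" "num_val ds = num_val ds'"
      by presburger+
    then show ?case
      using Cons.IH ys digit_val_inject by blast
  qed
qed simp

definition numeral_of :: "nat \<Rightarrow> letter list" where
  "numeral_of k = (num_inc ^^ k) []"

lemma num_val_numeral_of [simp]: "num_val (numeral_of k) = k"
  by (induction k) (simp_all add: numeral_of_def num_val_inc)

lemma numeral_of_num_val [simp]: "numeral_of (num_val ds) = ds"
  using num_val_inject num_val_numeral_of by blast

lemma num_inc_numeral_of: "num_inc (numeral_of k) = numeral_of (Suc k)"
  by (simp add: numeral_of_def)

lemma num_dec_numeral_of: "num_dec (numeral_of k) = numeral_of (k - 1)"
  by (metis num_val_dec num_val_numeral_of numeral_of_num_val)

lemma numeral_of_eq_Nil_iff: "numeral_of k = [] \<longleftrightarrow> k = 0"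
  by (metis num_val_eq_0_iff num_val_numeral_of)

lemma power_length_le_num_val: "2 ^ length ds \<le> num_val ds + 1"
proof (induction ds)
  case (Cons d ds)
  then show ?case using digit_val_bounds(1)[of d] by simp
qed simp

lemma length_le_num_val: "length ds \<le> num_val ds"
  using power_length_le_num_val[of ds] less_exp[of "length ds"] by linarith

lemma num_val_less: "num_val ds < 2 ^ (4 * length ds)"
proof (induction ds)
  case (Cons d ds)
  then show ?case using digit_val_bounds(2)[of d] by (simp add: power_add)
qed simp

lemma length_numeral_of_le:
  assumes "k < 2 ^ H"
  shows "length (numeral_of k) \<le> H"
proof -
  have "2 ^ length (numeral_of k) \<le> k + 1"
    using power_length_le_num_val[of "numeral_of k"] by simp
  also have "\<dots> \<le> 2 ^ H" using assms by simp
  finally show ?thesis by simp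
qed

section \<open>Counter programs\<close>

datatype prog = Skip | Inc nat | Dec nat | Seq prog prog | While nat prog

instance prog :: countable by countable_datatype

inductive exec :: "nat \<Rightarrow> prog \<Rightarrow> (nat \<Rightarrow> nat) \<Rightarrow> (nat \<Rightarrow> nat) \<Rightarrow> bool" for B where
  Skip: "exec B Skip s s"
| Inc: "s r < B \<Longrightarrow> exec B (Inc r) s (s(r := Suc (s r)))"
| Dec: "exec B (Dec r) s (s(r := s r - 1))"
| Seq: "exec B a s s' \<Longrightarrow> exec B b s' s'' \<Longrightarrow> exec B (Seq a b) s s''"
| While_zero: "s r = 0 \<Longrightarrow> exec B (While r a) s s"
| While_nonzero:
    "s r \<noteq> 0 \<Longrightarrow> exec B a s s' \<Longrightarrow> exec B (While r a) s' s'' \<Longrightarrow> exec B (While r a) s s''"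

lemma exec_le: "exec B p s s' \<Longrightarrow> s' r \<le> max B (s r)"
  by (induction rule: exec.induct) (auto simp: le_max_iff_disj)

lemma exec_bounded: "exec B p s s' \<Longrightarrow> \<forall>i. s i \<le> B \<Longrightarrow> \<forall>i. s' i \<le> B"
  using exec_le by fastforce

lemma exec_eq: "exec B p s s' \<Longrightarrow> s' = s'' \<Longrightarrow> exec B p s s''"
  by simp

primrec regs :: "prog \<Rightarrow> nat set" where
  "regs Skip = {}"
| "regs (Inc r) = {r}"
| "regs (Dec r) = {r}"
| "regs (Seq a b) = regs a \<union> regs b"
| "regs (While r a) = insert r (regs a)"

lemma finite_regs: "finite (regs p)"
  by (induction p) auto

section \<open>The arithmetic of a single tape\<close>

definition tape_act :: "'i tape_symbol \<Rightarrow> move \<Rightarrow> 'i tape \<Rightarrow> 'i tape" where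
  "tape_act a m t = ((fst t)(snd t := a), snd t + offset m)"

abbreviation scan :: "'i tape \<Rightarrow> 'i tape_symbol" where
  "scan t \<equiv> fst t (snd t)"

datatype phase = Carry | Borrow | Erase | Rewind

instance phase :: countable by countable_datatype

text \<open>Between two increments or decrements the head rests on the least significant digit;
  \<open>Rewind\<close> finds it again as the cell to the right of the first blank on the left.\<close>

fun phase_step ::
    "phase \<Rightarrow> letter tape_symbol \<Rightarrow> phase option \<times> letter tape_symbol \<times> move" where
  "phase_step Carry (Input d) =
     (if d = OneL then (Some Carry, Input LPar, MoveR)
      else (Some Rewind, Input (digit_of (digit_val d + 1)), Stay))"
| "phase_step Carry _ = (Some Rewind, Input LPar, Stay)"
| "phase_step Borrow (Input d) =
     (if d = LPar then (Some Borrow, Input OneL, MoveR)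
      else (Some Rewind, Input (digit_of (digit_val d - 1)), Stay))"
| "phase_step Borrow _ = (Some Erase, Blank, MoveL)"
| "phase_step Erase _ = (Some Rewind, Blank, MoveL)"
| "phase_step Rewind a = (if a = Blank then (None, Blank, MoveR) else (Some Rewind, a, MoveL))"

inductive phase_run :: "int \<Rightarrow> phase \<Rightarrow> letter tape \<Rightarrow> letter tape \<Rightarrow> bool" for H where
  finish: "snd t \<in> {-1..H} \<Longrightarrow> phase_step ph (scan t) = (None, a, m) \<Longrightarrow>
    phase_run H ph t (tape_act a m t)"
| continue: "snd t \<in> {-1..H} \<Longrightarrow> phase_step ph (scan t) = (Some ph', a, m) \<Longrightarrow>
    phase_run H ph' (tape_act a m t) t' \<Longrightarrow> phase_run H ph t t'"

abbreviation digits :: "letter list \<Rightarrow> int \<Rightarrow> letter tape_symbol" where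
  "digits ds \<equiv> fst (input_tape ds)"

lemma digits_read:
  "digits (pre @ d # ds) (int (length pre)) = Input d"
  "digits pre (int (length pre)) = Blank"
  "digits ds (- 1) = Blank"
  by (auto simp: input_tape_def)

lemma digits_write:
  "(digits (pre @ d # ds))(int (length pre) := Input d') = digits (pre @ d' # ds)"
  "(digits pre)(int (length pre) := Input d') = digits (pre @ [d'])"
  "(digits (pre @ [d']))(int (length pre) := Blank) = digits pre"
  by (auto simp: input_tape_def nth_append nth_Cons' fun_eq_iff)

lemma phase_run_continue:
  assumes "phase_run H ph' (digits ds', h') t" "h \<in> {-1..H}"
    and "phase_step ph (digits ds h) = (Some ph', a, m)"
    and "(digits ds)(h := a) = digits ds'" "h + offset m = h'"
  shows "phase_run H ph (digits ds, h) t"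
  by (rule phase_run.continue) (use assms in \<open>auto simp: tape_act_def\<close>)

lemma rewind_run:
  assumes "n \<le> length ds" "int n \<le> H + 1"
  shows "phase_run H Rewind (digits ds, int n - 1) (digits ds, 0)"
  using assms
proof (induction n)
  case 0
  have "phase_run H Rewind (digits ds, - 1) (tape_act Blank MoveR (digits ds, - 1))"
    by (rule phase_run.finish) (use 0 in \<open>auto simp: digits_read\<close>)
  then show ?case by (simp add: tape_act_def digits_read fun_upd_idem)
next
  case (Suc n)
  have read: "digits ds (int n) = Input (ds ! n)"
    using Suc.prems by (simp add: input_tape_def)
  have "phase_run H Rewind (digits ds, int n - 1) (digits ds, 0)"
    by (rule Suc.IH) (use Suc.prems in auto)
  then show ?case
    by (rule phase_run_continue[where m = MoveL and a = "Input (ds ! n)"])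
      (use Suc.prems read in \<open>auto simp: fun_upd_idem\<close>)
qed

lemma carry_run:
  assumes "int (length pre + length ds) \<le> H"
  shows "phase_run H Carry (digits (pre @ ds), int (length pre)) (digits (pre @ num_inc ds), 0)"
  using assms
proof (induction ds arbitrary: pre)
  case Nil
  have "phase_run H Rewind (digits (pre @ [LPar]), int (Suc (length pre)) - 1)
      (digits (pre @ [LPar]), 0)"
    by (rule rewind_run) (use Nil in auto)
  then show ?case
    unfolding num_inc.simps
    by (rule phase_run_continue[where m = Stay and a = "Input LPar"])
      (use Nil in \<open>auto simp: digits_read digits_write\<close>)
next
  case (Cons d ds)
  show ?case
  proof (cases "d = OneL")
    case True
    have "phase_run H Carry (digits ((pre @ [LPar]) @ ds), int (length (pre @ [LPar])))
        (digits ((pre @ [LPar]) @ num_inc ds), 0)"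
      by (rule Cons.IH) (use Cons.prems in auto)
    then have "phase_run H Carry (digits ((pre @ [LPar]) @ ds), int (length (pre @ [LPar])))
        (digits (pre @ num_inc (d # ds)), 0)"
      using True by simp
    then show ?thesis
      by (rule phase_run_continue[where m = MoveR and a = "Input LPar"])
        (use True Cons.prems in \<open>auto simp: digits_read digits_write\<close>)
  next
    case False
    have "phase_run H Rewind (digits (pre @ num_inc (d # ds)), int (Suc (length pre)) - 1)
        (digits (pre @ num_inc (d # ds)), 0)"
      by (rule rewind_run) (use Cons.prems False in auto)
    then show ?thesis
      by (rule phase_run_continue[where m = Stay and a = "Input (digit_of (digit_val d + 1))"])
        (use False Cons.prems in \<open>auto simp: digits_read digits_write\<close>)
  qed
qed

lemma erase_run:
  assumes "int (length pre) \<le> H"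
  shows "phase_run H Erase (digits (pre @ [d]), int (length pre)) (digits pre, 0)"
proof (rule phase_run_continue[where m = MoveL and a = Blank])
  show "phase_run H Rewind (digits pre, int (length pre) - 1) (digits pre, 0)"
    by (rule rewind_run) (use assms in auto)
qed (use assms in \<open>auto simp: digits_write\<close>)

lemma borrow_past_end:
  assumes "int (Suc (length pre)) \<le> H"
  shows "phase_run H Borrow (digits (pre @ [OneL]), int (Suc (length pre))) (digits pre, 0)"
proof -
  have read: "digits (pre @ [OneL]) (int (Suc (length pre))) = Blank"
    using digits_read(2)[of "pre @ [OneL]"] by simp
  have "phase_run H Erase (digits (pre @ [OneL]), int (length pre)) (digits pre, 0)"
    by (rule erase_run) (use assms in simp)
  then show ?thesis
    by (rule phase_run_continue[where m = MoveL and a = Blank])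
      (use assms read in \<open>auto simp: fun_upd_idem\<close>)
qed

lemma borrow_run:
  assumes "int (length pre + length ds) \<le> H" "ds \<noteq> []"
  shows "phase_run H Borrow (digits (pre @ ds), int (length pre)) (digits (pre @ num_dec ds), 0)"
  using assms
proof (induction ds arbitrary: pre)
  case (Cons d ds)
  show ?case
  proof (cases "d = LPar")
    case False
    have "phase_run H Rewind (digits (pre @ num_dec (d # ds)), int (Suc (length pre)) - 1)
        (digits (pre @ num_dec (d # ds)), 0)"
      by (rule rewind_run) (use Cons.prems False in auto)
    then show ?thesis
      by (rule phase_run_continue[where m = Stay and a = "Input (digit_of (digit_val d - 1))"])
        (use False Cons.prems in \<open>auto simp: digits_read digits_write\<close>)
  next
    case True
    have "phase_run H Borrow (digits ((pre @ [OneL]) @ ds), int (length (pre @ [OneL])))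
        (digits (pre @ num_dec (d # ds)), 0)"
    proof (cases "ds = []")
      case False
      have "phase_run H Borrow (digits ((pre @ [OneL]) @ ds), int (length (pre @ [OneL])))
          (digits ((pre @ [OneL]) @ num_dec ds), 0)"
        by (rule Cons.IH) (use Cons.prems False in auto)
      then show ?thesis using True False by simp
    next
      case last: True
      then show ?thesis using True borrow_past_end[of pre H] Cons.prems by simp
    qed
    then show ?thesis
      by (rule phase_run_continue[where m = MoveR and a = "Input OneL"])
        (use True Cons.prems in \<open>auto simp: digits_read digits_write\<close>)
  qed
qed simp

section \<open>Turing machines for counter programs\<close>

datatype ctrl = Run "prog list" | Work phase nat "prog list" | Yes | No

instance ctrl :: countable by countable_datatype

text \<open>The program runs with the continuation kept in the finite control, and the verdict is the test
  of register \<open>1\<close>. The argument \<open>z\<close> says which registers are zero.\<close>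

fun next_ctrl :: "prog list \<Rightarrow> (nat \<Rightarrow> bool) \<Rightarrow> ctrl" where
  "next_ctrl [] z = (if z 1 then No else Yes)"
| "next_ctrl (Skip # ks) z = Run ks"
| "next_ctrl (Inc r # ks) z = Work Carry r ks"
| "next_ctrl (Dec r # ks) z = (if z r then Run ks else Work Borrow r ks)"
| "next_ctrl (Seq a b # ks) z = Run (a # b # ks)"
| "next_ctrl (While r a # ks) z = (if z r then Run ks else Run (a # While r a # ks))"

fun resume :: "nat \<Rightarrow> prog list \<Rightarrow> phase option \<Rightarrow> ctrl" where
  "resume r ks None = Run ks"
| "resume r ks (Some ph) = Work ph r ks"

primrec conts :: "prog \<Rightarrow> prog list \<Rightarrow> prog list set" where
  "conts Skip ks = {Skip # ks}"
| "conts (Inc r) ks = {Inc r # ks}"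
| "conts (Dec r) ks = {Dec r # ks}"
| "conts (Seq a b) ks = insert (Seq a b # ks) (conts a (b # ks) \<union> conts b ks)"
| "conts (While r a) ks = insert (While r a # ks) (conts a (While r a # ks))"

lemma finite_conts: "finite (conts p ks)"
  by (induction p arbitrary: ks) auto

lemma conts_start: "p # ks \<in> conts p ks"
  by (cases p) auto

definition ctrls_of :: "prog list set \<Rightarrow> nat set \<Rightarrow> ctrl set" where
  "ctrls_of C R = {Yes, No} \<union> Run ` C \<union> (\<Union>ph. \<Union>r\<in>R. Work ph r ` C)"

lemma in_ctrls_of [simp]:
  "Yes \<in> ctrls_of C R" "No \<in> ctrls_of C R" "Run ks \<in> ctrls_of C R \<longleftrightarrow> ks \<in> C"
  "Work ph r ks \<in> ctrls_of C R \<longleftrightarrow> r \<in> R \<and> ks \<in> C"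
  by (auto simp: ctrls_of_def)

lemma ctrls_of_mono: "C \<subseteq> C' \<Longrightarrow> R \<subseteq> R' \<Longrightarrow> ctrls_of C R \<subseteq> ctrls_of C' R'"
  unfolding ctrls_of_def by blast

lemma finite_ctrls_of:
  assumes "finite C" "finite R"
  shows "finite (ctrls_of C R)"
proof -
  have "(UNIV :: phase set) = {Carry, Borrow, Erase, Rewind}"
    using phase.exhaust by auto
  then have "finite (UNIV :: phase set)" by (metis finite.emptyI finite_insert)
  then show ?thesis using assms by (simp add: ctrls_of_def)
qed

lemma next_ctrl_conts:
  "ls \<in> conts p ks \<Longrightarrow> next_ctrl ls z \<in> ctrls_of (insert ks (conts p ks)) (regs p)"
proof (induction p arbitrary: ks)
  case (Seq a b)
  let ?C = "insert ks (conts (Seq a b) ks)"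
  have "insert (b # ks) (conts a (b # ks)) \<subseteq> ?C" "insert ks (conts b ks) \<subseteq> ?C"
    using conts_start[of b ks] by auto
  then have "ctrls_of (insert (b # ks) (conts a (b # ks))) (regs a) \<subseteq> ctrls_of ?C (regs (Seq a b))"
    "ctrls_of (insert ks (conts b ks)) (regs b) \<subseteq> ctrls_of ?C (regs (Seq a b))"
    by (simp_all add: ctrls_of_mono)
  moreover have "a # b # ks \<in> ?C" using conts_start[of a "b # ks"] by simp
  ultimately show ?case using Seq by auto
next
  case (While r a)
  let ?C = "insert ks (conts (While r a) ks)"
  have "ctrls_of (insert (While r a # ks) (conts a (While r a # ks))) (regs a)
      \<subseteq> ctrls_of ?C (regs (While r a))"
    by (intro ctrls_of_mono) auto
  moreover have "a # While r a # ks \<in> ?C" using conts_start[of a "While r a # ks"] by simp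
  ultimately show ?case using While by auto
qed auto

definition ctrls :: "nat \<Rightarrow> prog \<Rightarrow> ctrl set" where
  "ctrls N p = ctrls_of (insert [] (conts p [])) {..<N}"

definition counter_delta ::
    "nat \<Rightarrow> letter tape_symbol list \<Rightarrow> nat \<times> (letter tape_symbol \<times> move) list" where
  "counter_delta q ss = (let keep = map (\<lambda>a. (a, Stay)) ss in
     case from_nat q of
       Run ks \<Rightarrow> (to_nat (next_ctrl ks (\<lambda>r. ss ! r = Blank)), keep)
     | Work ph r ks \<Rightarrow> (case phase_step ph (ss ! r) of (ph', act) \<Rightarrow>
         (to_nat (resume r ks ph'), keep[r := act]))
     | _ \<Rightarrow> (q, keep))"

definition counter_tm :: "nat \<Rightarrow> prog \<Rightarrow> letter tm" where
  "counter_tm N p = \<lparr>tm_tapes = N, tm_states = to_nat ` ctrls N p,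
     tm_alphabet = insert Blank (range Input), tm_start = to_nat (Run [p]),
     tm_accept = to_nat Yes, tm_reject = to_nat No, tm_delta = counter_delta\<rparr>"

lemma counter_tm_sel:
  "tm_tapes (counter_tm N p) = N" "tm_accept (counter_tm N p) = to_nat Yes"
  "tm_reject (counter_tm N p) = to_nat No"
  by (simp_all add: counter_tm_def)

lemma next_ctrl_in_ctrls:
  assumes "Run ks \<in> ctrls N p" "regs p \<subseteq> {..<N}"
  shows "next_ctrl ks z \<in> ctrls N p"
proof (cases "ks = []")
  case False
  then have "ks \<in> conts p []" using assms(1) by (simp add: ctrls_def)
  then have "next_ctrl ks z \<in> ctrls_of (insert [] (conts p [])) (regs p)"
    by (rule next_ctrl_conts)
  also have "\<dots> \<subseteq> ctrls N p" unfolding ctrls_def by (rule ctrls_of_mono[OF order_refl assms(2)])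
  finally show ?thesis .
qed (simp add: ctrls_def)

lemma phase_step_alphabet:
  "a \<in> insert Blank (range Input) \<Longrightarrow> fst (snd (phase_step ph a)) \<in> insert Blank (range Input)"
  by (cases ph; cases a) auto

lemma counter_delta_ctrl:
  assumes "regs p \<subseteq> {..<N}" "q \<in> ctrls N p" "counter_delta (to_nat q) ss = (q', acts)"
  shows "q' \<in> to_nat ` ctrls N p"
proof (cases q)
  case (Run ks)
  then show ?thesis
    using assms next_ctrl_in_ctrls[OF _ assms(1)] by (auto simp: counter_delta_def)
next
  case (Work ph r ks)
  then have "resume r ks ph' \<in> ctrls N p" for ph'
    using assms(2) by (cases ph') (auto simp: ctrls_def)
  then show ?thesis
    using Work assms(3) by (auto simp: counter_delta_def Let_def split: prod.splits)
qed (use assms in \<open>auto simp: counter_delta_def\<close>)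

lemma counter_delta_actions:
  assumes q: "q \<in> ctrls N p" and letters: "set ss \<subseteq> insert Blank (range Input)" "length ss = N"
    and delta: "counter_delta (to_nat q) ss = (q', acts)"
  shows "length acts = N \<and> fst ` set acts \<subseteq> insert Blank (range Input)"
proof -
  let ?keep = "map (\<lambda>a. (a, Stay)) ss"
  consider (keep) "acts = ?keep"
    | (update) ph r where "r < N" "acts = ?keep[r := snd (phase_step ph (ss ! r))]"
  proof (cases q)
    case (Work ph r ks)
    then show ?thesis
      using that(2)[of r ph] delta q
      by (auto simp: counter_delta_def ctrls_def split: prod.splits)
  qed (use that(1) delta in \<open>auto simp: counter_delta_def Let_def\<close>)
  then show ?thesis
  proof cases
    case keep
    then show ?thesis using letters by (auto simp: image_image)
  next
    case (update ph r)
    have "ss ! r \<in> insert Blank (range Input)" using update(1) letters nth_mem by blast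
    then have "fst (snd (phase_step ph (ss ! r))) \<in> insert Blank (range Input)"
      by (rule phase_step_alphabet)
    moreover have "set acts \<subseteq> insert (snd (phase_step ph (ss ! r))) (set ?keep)"
      unfolding update(2) by (rule set_update_subset_insert)
    then have "fst ` set acts \<subseteq> insert (fst (snd (phase_step ph (ss ! r)))) (fst ` set ?keep)"
      by blast
    moreover have "fst ` set ?keep = set ss" by (simp add: image_image)
    ultimately show ?thesis using letters update(2) by auto
  qed
qed

lemma finite_letter: "finite (UNIV :: letter set)"
proof -
  have "inj digit_val" by (simp add: inj_def digit_val_inject)
  moreover have "range digit_val \<subseteq> {1..9}" using digit_val_bounds by auto
  ultimately show ?thesis by (meson finite_atLeastAtMost finite_imageD finite_subset)
qed

lemma turing_machine_counter_tm:
  assumes "1 \<le> N" "regs p \<subseteq> {..<N}"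
  shows "turing_machine (counter_tm N p)"
proof -
  have "Run [p] \<in> ctrls N p"
    using conts_start[of p "[]"] by (simp add: ctrls_def)
  moreover have "finite (ctrls N p)"
    by (simp add: ctrls_def finite_ctrls_of finite_conts)
  moreover have "Yes \<in> ctrls N p" "No \<in> ctrls N p" by (simp_all add: ctrls_def)
  moreover have "case counter_delta (to_nat q) ss of (q', acts) \<Rightarrow>
      q' \<in> to_nat ` ctrls N p \<and> length acts = N \<and> fst ` set acts \<subseteq> insert Blank (range Input)"
    if "q \<in> ctrls N p" "ss \<in> lists (insert Blank (range Input))" "length ss = N" for q ss
    using counter_delta_ctrl[OF assms(2) that(1)] counter_delta_actions[OF that(1) _ that(3)] that(2)
    by (auto simp: lists_eq_set simp del: image_insert split: prod.split)
  ultimately show ?thesis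
    using assms(1)
    by (auto simp: turing_machine_def counter_tm_def finite_letter simp del: image_insert)
qed

definition tm_config :: "nat \<Rightarrow> ctrl \<Rightarrow> (nat \<Rightarrow> letter tape) \<Rightarrow> letter config" where
  "tm_config N q T = (to_nat q, map T [0..<N])"

lemma next_ctrl_cong:
  assumes "\<And>r. r \<in> insert 1 (\<Union>(regs ` set ks)) \<Longrightarrow> z r = z' r"
  shows "next_ctrl ks z = next_ctrl ks z'"
  using assms by (cases "(ks, z)" rule: next_ctrl.cases) auto

lemma tm_step_not_halted:
  assumes "q \<noteq> Yes" "q \<noteq> No"
  shows "tm_step (counter_tm N p) (tm_config N q T) =
    (case counter_delta (to_nat q) (map (scan \<circ> T) [0..<N]) of (q', acts) \<Rightarrow>
      (q', map2 (\<lambda>t (a, m). tape_act a m t) (map T [0..<N]) acts))"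
  using assms
  by (auto simp: tm_step_def tm_halted_def tm_config_def counter_tm_def tape_act_def comp_def
      case_prod_beta intro!: map_cong)

lemma tm_step_Run:
  assumes "insert 1 (\<Union>(regs ` set ks)) \<subseteq> {..<N}"
  shows "tm_step (counter_tm N p) (tm_config N (Run ks) T) =
    tm_config N (next_ctrl ks (\<lambda>r. scan (T r) = Blank)) T"
proof -
  have "next_ctrl ks (\<lambda>r. map (scan \<circ> T) [0..<N] ! r = Blank) =
      next_ctrl ks (\<lambda>r. scan (T r) = Blank)"
    by (rule next_ctrl_cong) (use assms in auto)
  then show ?thesis
    by (subst tm_step_not_halted)
      (auto simp: counter_delta_def tm_config_def tape_act_def intro!: nth_equalityI)
qed

lemma tm_step_Work:
  assumes "r < N" "phase_step ph (scan (T r)) = (ph', a, m)"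
  shows "tm_step (counter_tm N p) (tm_config N (Work ph r ks) T) =
    tm_config N (resume r ks ph') (T(r := tape_act a m (T r)))"
  using assms
  by (subst tm_step_not_halted)
    (auto simp: counter_delta_def tm_config_def tape_act_def nth_list_update intro!: nth_equalityI)

definition heads_within :: "nat \<Rightarrow> int \<Rightarrow> letter config \<Rightarrow> bool" where
  "heads_within N H c \<longleftrightarrow> (\<forall>i<N. snd (snd c ! i) \<in> {-1..H})"

lemma heads_within_tm_config: "heads_within N H (tm_config N q T) \<longleftrightarrow> (\<forall>i<N. snd (T i) \<in> {-1..H})"
  by (simp add: heads_within_def tm_config_def)

inductive reaches :: "letter tm \<Rightarrow> nat \<Rightarrow> int \<Rightarrow> letter config \<Rightarrow> letter config \<Rightarrow> bool" for M N H where
  here: "heads_within N H c \<Longrightarrow> reaches M N H c c"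
| there: "heads_within N H c \<Longrightarrow> reaches M N H (tm_step M c) c' \<Longrightarrow> reaches M N H c c'"

lemma reaches_trans: "reaches M N H a b \<Longrightarrow> reaches M N H b c \<Longrightarrow> reaches M N H a c"
  by (induction rule: reaches.induct) (auto intro: reaches.there)

lemma reaches_iterate:
  "reaches M N H c c' \<Longrightarrow> \<exists>t. (tm_step M ^^ t) c = c' \<and> (\<forall>j\<le>t. heads_within N H ((tm_step M ^^ j) c))"
proof (induction rule: reaches.induct)
  case (here c)
  then show ?case by (intro exI[of _ 0]) auto
next
  case (there c c')
  then obtain t where t: "(tm_step M ^^ t) (tm_step M c) = c'"
    "\<forall>j\<le>t. heads_within N H ((tm_step M ^^ j) (tm_step M c))" by blast
  have "heads_within N H ((tm_step M ^^ j) c)" if "j \<le> Suc t" for j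
    using that t(2) there(1) by (cases j) (auto simp: funpow_swap1)
  then show ?case using t(1) by (intro exI[of _ "Suc t"]) (auto simp: funpow_swap1)
qed

lemma phase_run_reaches:
  assumes "phase_run H ph t t'" "r < N" "\<forall>i<N. snd (T i) \<in> {-1..H}" "snd t' \<in> {-1..H}"
  shows "reaches (counter_tm N p) N H (tm_config N (Work ph r ks) (T(r := t)))
    (tm_config N (Run ks) (T(r := t')))"
  using assms(1,4)
proof (induction rule: phase_run.induct)
  case (finish t ph a m)
  let ?c = "tm_config N (Work ph r ks) (T(r := t))"
  have "tm_step (counter_tm N p) ?c = tm_config N (Run ks) (T(r := tape_act a m t))"
    using finish assms(2) by (simp add: tm_step_Work)
  moreover have "heads_within N H ?c"
      "heads_within N H (tm_config N (Run ks) (T(r := tape_act a m t)))"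
    using finish assms(3) by (simp_all add: heads_within_tm_config)
  ultimately show ?case by (metis reaches.here reaches.there)
next
  case (continue t ph ph' a m t')
  let ?c = "tm_config N (Work ph r ks) (T(r := t))"
  have "tm_step (counter_tm N p) ?c = tm_config N (Work ph' r ks) (T(r := tape_act a m t))"
    using continue assms(2) by (simp add: tm_step_Work)
  moreover have "heads_within N H ?c"
    using continue assms(3) by (simp add: heads_within_tm_config)
  ultimately show ?case using continue.IH continue.prems by (metis reaches.there)
qed

definition reg_tapes :: "(nat \<Rightarrow> nat) \<Rightarrow> nat \<Rightarrow> letter tape" where
  "reg_tapes s r = input_tape (numeral_of (s r))"

lemma digits_at_0: "(digits ds, 0) = input_tape ds"
  by (simp add: input_tape_def)

lemma reg_tapes_upd: "reg_tapes (s(r := k)) = (reg_tapes s)(r := input_tape (numeral_of k))"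
  by (auto simp: reg_tapes_def)

lemma heads_within_reg_tapes: "heads_within N (int H) (tm_config N q (reg_tapes s))"
  by (simp add: heads_within_tm_config reg_tapes_def input_tape_def)

lemma scan_reg_tapes: "scan (reg_tapes s r) = Blank \<longleftrightarrow> s r = 0"
  by (simp add: reg_tapes_def input_tape_def numeral_of_eq_Nil_iff)

lemma Work_reaches:
  assumes "phase_run (int H) ph (reg_tapes s r) (input_tape (numeral_of k))" "r < N"
  shows "reaches (counter_tm N p) N (int H) (tm_config N (Work ph r ks) (reg_tapes s))
    (tm_config N (Run ks) (reg_tapes (s(r := k))))"
  using phase_run_reaches[OF assms, of "reg_tapes s"]
  by (simp add: reg_tapes_upd) (simp add: reg_tapes_def input_tape_def)

lemma Carry_reaches:
  assumes "s r < 2 ^ H" "r < N"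
  shows "reaches (counter_tm N p) N (int H) (tm_config N (Work Carry r ks) (reg_tapes s))
    (tm_config N (Run ks) (reg_tapes (s(r := Suc (s r)))))"
proof (rule Work_reaches[OF _ assms(2)])
  show "phase_run (int H) Carry (reg_tapes s r) (input_tape (numeral_of (Suc (s r))))"
    using carry_run[of "[]" "numeral_of (s r)"] length_numeral_of_le[OF assms(1)]
    by (simp add: reg_tapes_def digits_at_0 num_inc_numeral_of)
qed

lemma Borrow_reaches:
  assumes "s r < 2 ^ H" "r < N" "s r \<noteq> 0"
  shows "reaches (counter_tm N p) N (int H) (tm_config N (Work Borrow r ks) (reg_tapes s))
    (tm_config N (Run ks) (reg_tapes (s(r := s r - 1))))"
proof (rule Work_reaches[OF _ assms(2)])
  show "phase_run (int H) Borrow (reg_tapes s r) (input_tape (numeral_of (s r - 1)))"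
    using borrow_run[of "[]" "numeral_of (s r)"] length_numeral_of_le[OF assms(1)] assms(3)
    by (simp add: reg_tapes_def digits_at_0 num_dec_numeral_of numeral_of_eq_Nil_iff)
qed

lemma reaches_Run:
  assumes "insert 1 (\<Union>(regs ` set ks)) \<subseteq> {..<N}"
    and "reaches (counter_tm N p) N (int H) (tm_config N (next_ctrl ks (\<lambda>r. s r = 0)) (reg_tapes s)) c"
  shows "reaches (counter_tm N p) N (int H) (tm_config N (Run ks) (reg_tapes s)) c"
proof (rule reaches.there[OF heads_within_reg_tapes])
  show "reaches (counter_tm N p) N (int H)
      (tm_step (counter_tm N p) (tm_config N (Run ks) (reg_tapes s))) c"
    using assms by (simp add: tm_step_Run scan_reg_tapes)
qed

lemma Inc_reaches:
  assumes "s r < 2 ^ H" "insert 1 (\<Union>(regs ` set (Inc r # ks))) \<subseteq> {..<N}"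
  shows "reaches (counter_tm N p) N (int H) (tm_config N (Run (Inc r # ks)) (reg_tapes s))
    (tm_config N (Run ks) (reg_tapes (s(r := Suc (s r)))))"
proof (rule reaches_Run[OF assms(2)])
  have "r < N" using assms(2) by simp
  with assms(1) show "reaches (counter_tm N p) N (int H)
      (tm_config N (next_ctrl (Inc r # ks) (\<lambda>r. s r = 0)) (reg_tapes s))
      (tm_config N (Run ks) (reg_tapes (s(r := Suc (s r)))))"
    unfolding next_ctrl.simps by (rule Carry_reaches)
qed

lemma Dec_reaches:
  assumes "s r < 2 ^ H" "insert 1 (\<Union>(regs ` set (Dec r # ks))) \<subseteq> {..<N}"
  shows "reaches (counter_tm N p) N (int H) (tm_config N (Run (Dec r # ks)) (reg_tapes s))
    (tm_config N (Run ks) (reg_tapes (s(r := s r - 1))))"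
proof (rule reaches_Run[OF assms(2)], cases "s r = 0")
  case True
  then have "s(r := s r - 1) = s" by auto
  with True show "reaches (counter_tm N p) N (int H)
      (tm_config N (next_ctrl (Dec r # ks) (\<lambda>r. s r = 0)) (reg_tapes s))
      (tm_config N (Run ks) (reg_tapes (s(r := s r - 1))))"
    by (simp only: next_ctrl.simps) (simp add: reaches.here heads_within_reg_tapes)
next
  case False
  moreover have "r < N" using assms(2) by simp
  ultimately show "reaches (counter_tm N p) N (int H)
      (tm_config N (next_ctrl (Dec r # ks) (\<lambda>r. s r = 0)) (reg_tapes s))
      (tm_config N (Run ks) (reg_tapes (s(r := s r - 1))))"
    using Borrow_reaches[of s r H N] assms(1) by (simp only: next_ctrl.simps) simp
qed

lemma exec_reaches:
  assumes "exec B b s s'" "\<forall>i. s i \<le> B" "B < 2 ^ H" "insert 1 (\<Union>(regs ` set (b # ks))) \<subseteq> {..<N}"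
  shows "reaches (counter_tm N p) N (int H) (tm_config N (Run (b # ks)) (reg_tapes s))
      (tm_config N (Run ks) (reg_tapes s'))"
  using assms
proof (induction arbitrary: ks rule: exec.induct)
  case (Skip s)
  show ?case
    by (rule reaches_Run[OF Skip.prems(3)]) (simp add: reaches.here heads_within_reg_tapes)
next
  case (Inc s r)
  then show ?case by (intro Inc_reaches) auto
next
  case (Dec r s)
  then show ?case by (intro Dec_reaches) (auto intro: le_less_trans)
next
  case (Seq a s s' b s'')
  have "\<forall>i. s' i \<le> B" using exec_bounded[OF Seq.hyps(1) Seq.prems(1)] .
  then have "reaches (counter_tm N p) N (int H) (tm_config N (Run (a # b # ks)) (reg_tapes s))
      (tm_config N (Run ks) (reg_tapes s''))"
    using Seq.prems by (intro reaches_trans[OF Seq.IH(1) Seq.IH(2)]) auto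
  then show ?case by (intro reaches_Run[OF Seq.prems(3)]) simp
next
  case (While_zero s r a)
  show ?case
    by (rule reaches_Run[OF While_zero.prems(3)])
      (simp add: While_zero.hyps reaches.here heads_within_reg_tapes)
next
  case (While_nonzero s r a s' s'')
  have "\<forall>i. s' i \<le> B" using exec_bounded[OF While_nonzero.hyps(2) While_nonzero.prems(1)] .
  then have "reaches (counter_tm N p) N (int H)
      (tm_config N (Run (a # While r a # ks)) (reg_tapes s)) (tm_config N (Run ks) (reg_tapes s''))"
    using While_nonzero.prems
    by (intro reaches_trans[OF While_nonzero.IH(1) While_nonzero.IH(2)]) auto
  then show ?case
    by (intro reaches_Run[OF While_nonzero.prems(3)]) (simp add: While_nonzero.hyps)
qed

abbreviation input_regs :: "letter list \<Rightarrow> nat \<Rightarrow> nat" where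
  "input_regs w \<equiv> (\<lambda>_. 0)(0 := num_val w)"

lemma tm_init_counter_tm:
  assumes "1 \<le> N"
  shows "tm_init (counter_tm N p) w = tm_config N (Run [p]) (reg_tapes (input_regs w))"
proof -
  have blank: "input_tape [] = (\<lambda>_. Blank, 0)"
    by (simp add: input_tape_def fun_eq_iff)
  have empty: "numeral_of 0 = []" by (simp add: numeral_of_eq_Nil_iff)
  have "input_tape w # replicate (N - 1) (\<lambda>_. Blank, 0) = map (reg_tapes (input_regs w)) [0..<N]"
    using assms by (intro nth_equalityI) (auto simp: nth_Cons' reg_tapes_def empty blank)
  then show ?thesis
    by (simp add: tm_init_def tm_config_def) (simp add: counter_tm_def)
qed

lemma tm_step_halted:
  "tm_step (counter_tm N p) (tm_config N (if accept then Yes else No) T) =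
     tm_config N (if accept then Yes else No) T"
  by (simp add: tm_step_def tm_halted_def tm_config_def counter_tm_def)

lemma counter_tm_run:
  assumes regs: "insert 1 (regs p) \<subseteq> {..<N}"
    and exec: "exec B p (input_regs w) s" "num_val w \<le> B" "B < 2 ^ H"
  shows "\<exists>t. fst (tm_run (counter_tm N p) w t) = to_nat (if s 1 = 0 then No else Yes)"
    and "heads_within N (int H) (tm_run (counter_tm N p) w j)"
proof -
  let ?M = "counter_tm N p" and ?c = "tm_config N (if s 1 \<noteq> 0 then Yes else No) (reg_tapes s)"
  have "reaches ?M N (int H) (tm_config N (Run [p]) (reg_tapes (input_regs w)))
      (tm_config N (Run []) (reg_tapes s))"
    by (rule exec_reaches[OF exec(1)]) (use regs exec in auto)
  moreover have "reaches ?M N (int H) (tm_config N (Run []) (reg_tapes s)) ?c"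
    by (rule reaches_Run) (use regs in \<open>auto simp: reaches.here heads_within_reg_tapes\<close>)
  ultimately have "reaches ?M N (int H) (tm_init ?M w) ?c"
    using regs by (subst tm_init_counter_tm) (auto intro: reaches_trans)
  from reaches_iterate[OF this] obtain t where t: "tm_run ?M w t = ?c"
      "\<forall>j\<le>t. heads_within N (int H) (tm_run ?M w j)"
    unfolding tm_run_def by blast
  then show "\<exists>t. fst (tm_run ?M w t) = to_nat (if s 1 = 0 then No else Yes)"
    by (intro exI[of _ t]) (simp add: tm_config_def)
  have "tm_run ?M w (t + i) = ?c" for i
    using t(1) tm_step_halted[of N p "s 1 \<noteq> 0"] by (induction i) (simp_all add: tm_run_def)
  then show "heads_within N (int H) (tm_run ?M w j)"
    using t(2) heads_within_reg_tapes by (metis le_iff_add linorder_le_cases)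
qed

lemma tm_space_le:
  assumes "\<And>t. heads_within (tm_tapes M) (int H) (tm_run M w t)"
  shows "tm_space M w \<le> tm_tapes M * (H + 2)"
proof -
  have "card (range (\<lambda>t. snd (snd (tm_run M w t) ! i))) \<le> H + 2" if "i < tm_tapes M" for i
  proof -
    have "range (\<lambda>t. snd (snd (tm_run M w t) ! i)) \<subseteq> {-1..int H}"
      using assms that by (auto simp: heads_within_def)
    from card_mono[OF _ this] show ?thesis by simp
  qed
  then have "tm_space M w \<le> (\<Sum>i<tm_tapes M. H + 2)"
    unfolding tm_space_def by (intro sum_mono) auto
  then show ?thesis by simp
qed

theorem counter_tm_decides:
  fixes H :: "nat \<Rightarrow> nat"
  assumes regs: "insert 1 (regs p) \<subseteq> {..<N}"
    and exec: "\<And>w. \<exists>B s. exec B p (input_regs w) s \<and> num_val w \<le> B \<and> B < 2 ^ H (length w) \<and>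
      (s 1 \<noteq> 0 \<longleftrightarrow> w \<in> L)"
  shows "tm_decides (counter_tm N p) L"
    and "tm_space (counter_tm N p) w \<le> N * (H (length w) + 2)"
proof -
  have verdict: "\<exists>t. fst (tm_run (counter_tm N p) w t) = to_nat (if w \<in> L then Yes else No)"
    and heads: "heads_within N (int (H (length w))) (tm_run (counter_tm N p) w j)" for w j
  proof -
    obtain B s where "exec B p (input_regs w) s" "num_val w \<le> B" "B < 2 ^ H (length w)"
      and s: "s 1 \<noteq> 0 \<longleftrightarrow> w \<in> L" using exec[of w] by blast
    note run = counter_tm_run[OF regs this(1-3)]
    show "\<exists>t. fst (tm_run (counter_tm N p) w t) = to_nat (if w \<in> L then Yes else No)"
      using run(1) s by (auto split: if_splits)
    show "heads_within N (int (H (length w))) (tm_run (counter_tm N p) w j)" by (rule run(2))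
  qed
  show "tm_decides (counter_tm N p) L"
    using verdict unfolding tm_decides_def counter_tm_sel by (simp add: if_distrib[of to_nat])
  have "tm_space (counter_tm N p) w \<le> tm_tapes (counter_tm N p) * (H (length w) + 2)"
    by (rule tm_space_le) (simp only: counter_tm_sel heads)
  then show "tm_space (counter_tm N p) w \<le> N * (H (length w) + 2)"
    by (simp only: counter_tm_sel)
qed

section \<open>Loops in counter programs\<close>

definition clear :: "nat \<Rightarrow> prog" where
  "clear r = While r (Dec r)"

definition transfer :: "nat \<Rightarrow> nat \<Rightarrow> prog" where
  "transfer r d = While r (Seq (Dec r) (Inc d))"

definition copy :: "nat \<Rightarrow> nat \<Rightarrow> nat \<Rightarrow> prog" where
  "copy r d t = Seq (While r (Seq (Dec r) (Seq (Inc d) (Inc t)))) (transfer t r)"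

lemma exec_While_iterate:
  assumes "\<And>j. j < k \<Longrightarrow> S j r \<noteq> 0 \<and> exec B a (S j) (S (Suc j))" "S k r = (0 :: nat)"
  shows "exec B (While r a) (S 0) (S k)"
  using assms
proof (induction k arbitrary: S)
  case 0
  then show ?case by (simp add: exec.While_zero)
next
  case (Suc k)
  have "exec B (While r a) ((\<lambda>j. S (Suc j)) 0) ((\<lambda>j. S (Suc j)) k)"
    by (rule Suc.IH) (use Suc.prems in auto)
  moreover have "S 0 r \<noteq> 0" "exec B a (S 0) (S (Suc 0))" using Suc.prems(1)[of 0] by auto
  ultimately show ?case by (metis exec.While_nonzero)
qed

lemma exec_clear: "exec B (clear r) s (s(r := 0))"
proof -
  have "exec B (While r (Dec r)) ((\<lambda>j. s(r := s r - j)) 0) ((\<lambda>j. s(r := s r - j)) (s r))"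
  proof (rule exec_While_iterate)
    fix j assume j: "j < s r"
    have "exec B (Dec r) (s(r := s r - j)) (s(r := s r - Suc j))"
      by (rule exec_eq[OF exec.Dec]) auto
    then show "(s(r := s r - j)) r \<noteq> 0 \<and> exec B (Dec r) (s(r := s r - j)) (s(r := s r - Suc j))"
      using j by simp
  qed simp
  then show ?thesis by (simp add: clear_def)
qed

lemma exec_transfer:
  assumes "r \<noteq> d" "s d + s r \<le> B"
  shows "exec B (transfer r d) s (s(r := 0, d := s d + s r))"
proof -
  let ?S = "\<lambda>j. s(r := s r - j, d := s d + j)"
  have "exec B (While r (Seq (Dec r) (Inc d))) (?S 0) (?S (s r))"
  proof (rule exec_While_iterate)
    fix j assume j: "j < s r"
    have "exec B (Seq (Dec r) (Inc d)) (?S j) (?S (Suc j))"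
      by (rule exec_eq[OF exec.Seq[OF exec.Dec exec.Inc]]) (use j assms in \<open>auto simp: fun_eq_iff\<close>)
    then show "?S j r \<noteq> 0 \<and> exec B (Seq (Dec r) (Inc d)) (?S j) (?S (Suc j))"
      using j assms by simp
  qed (use assms in auto)
  then show ?thesis by (simp add: transfer_def)
qed

lemma exec_copy:
  assumes "distinct [r, d, t]" "s d = 0" "s t = 0" "s r \<le> B"
  shows "exec B (copy r d t) s (s(d := s r))"
proof -
  let ?S = "\<lambda>j. s(r := s r - j, d := j, t := j)"
  have "exec B (While r (Seq (Dec r) (Seq (Inc d) (Inc t)))) (?S 0) (?S (s r))"
  proof (rule exec_While_iterate)
    fix j assume j: "j < s r"
    have "exec B (Seq (Dec r) (Seq (Inc d) (Inc t))) (?S j) (?S (Suc j))"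
      by (rule exec_eq[OF exec.Seq[OF exec.Dec exec.Seq[OF exec.Inc exec.Inc]]])
        (use j assms in \<open>auto simp: fun_eq_iff\<close>)
    then show "?S j r \<noteq> 0 \<and> exec B (Seq (Dec r) (Seq (Inc d) (Inc t))) (?S j) (?S (Suc j))"
      using j assms by simp
  qed (use assms in auto)
  moreover have "?S 0 = s" using assms by auto
  moreover have "exec B (transfer t r) (?S (s r)) (s(d := s r))"
    by (rule exec_eq[OF exec_transfer]) (use assms in \<open>auto simp: fun_eq_iff\<close>)
  ultimately show ?thesis unfolding copy_def by (auto intro: exec.Seq)
qed

text \<open>The loop counter is in register \<open>m\<close>, the current value in \<open>m + 1\<close> and its index in \<open>m + 2\<close>;
  the body \<open>h\<close> leaves the next value in \<open>m + 3\<close>.\<close>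

definition rec_body :: "prog \<Rightarrow> nat \<Rightarrow> prog" where
  "rec_body h m =
     Seq (Dec m) (Seq h (Seq (clear (m + 1)) (Seq (transfer (m + 3) (m + 1)) (Inc (m + 2)))))"

definition rec_prog :: "prog \<Rightarrow> nat \<Rightarrow> prog" where
  "rec_prog h m = Seq (While m (rec_body h m)) (Seq (clear (m + 2)) (transfer (m + 1) m))"

lemma exec_rec_body:
  assumes zero: "\<forall>r\<ge>m. s r = 0" and less: "i < k" "k \<le> B" "x' \<le> B"
    and h: "exec B h (s(m := k - Suc i, m + 1 := x, m + 2 := i))
      (s(m := k - Suc i, m + 1 := x, m + 2 := i, m + 3 := x'))"
  shows "exec B (rec_body h m) (s(m := k - i, m + 1 := x, m + 2 := i))
    (s(m := k - Suc i, m + 1 := x', m + 2 := Suc i))"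
proof -
  let ?s = "s(m := k - Suc i, m + 1 := x, m + 2 := i)"
    and ?s' = "s(m := k - Suc i, m + 1 := x', m + 2 := i)"
  have "exec B (Dec m) (s(m := k - i, m + 1 := x, m + 2 := i)) ?s"
    by (rule exec_eq[OF exec.Dec]) (auto simp: fun_eq_iff)
  moreover have "exec B (clear (m + 1)) (?s(m + 3 := x')) (?s(m + 3 := x', m + 1 := 0))"
    by (rule exec_clear)
  moreover have "exec B (transfer (m + 3) (m + 1)) (?s(m + 3 := x', m + 1 := 0)) ?s'"
    by (rule exec_eq[OF exec_transfer]) (use less zero in \<open>auto simp: fun_eq_iff\<close>)
  moreover have "exec B (Inc (m + 2)) ?s' (s(m := k - Suc i, m + 1 := x', m + 2 := Suc i))"
    by (rule exec_eq[OF exec.Inc]) (use less in \<open>auto simp: fun_eq_iff\<close>)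
  ultimately show ?thesis unfolding rec_body_def using h by (blast intro: exec.Seq)
qed

lemma exec_rec_prog:
  assumes zero: "\<forall>r\<ge>m. s r = 0"
    and h: "\<And>i. i < k \<Longrightarrow> exec B h (s(m := k - Suc i, m + 1 := x i, m + 2 := i))
      (s(m := k - Suc i, m + 1 := x i, m + 2 := i, m + 3 := x (Suc i)))"
    and bound: "\<And>i. i \<le> k \<Longrightarrow> x i \<le> B" "k \<le> B"
  shows "exec B (rec_prog h m) (s(m := k, m + 1 := x 0)) (s(m := x k))"
proof -
  let ?S = "\<lambda>i. s(m := k - i, m + 1 := x i, m + 2 := i)"
  have loop: "exec B (While m (rec_body h m)) (?S 0) (?S k)"
  proof (rule exec_While_iterate)
    fix i assume i: "i < k"
    then have "exec B (rec_body h m) (?S i) (?S (Suc i))"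
      using bound by (intro exec_rec_body[OF zero i _ _ h]) auto
    then show "?S i m \<noteq> 0 \<and> exec B (rec_body h m) (?S i) (?S (Suc i))" using i by simp
  qed auto
  have start: "?S 0 = s(m := k, m + 1 := x 0)" using zero by (auto simp: fun_eq_iff)
  have clear: "exec B (clear (m + 2)) (?S k) (s(m + 1 := x k))"
    by (rule exec_eq[OF exec_clear]) (use zero in \<open>auto simp: fun_eq_iff\<close>)
  have transfer: "exec B (transfer (m + 1) m) (s(m + 1 := x k)) (s(m := x k))"
    by (rule exec_eq[OF exec_transfer]) (use bound(1)[of k] zero in \<open>auto simp: fun_eq_iff\<close>)
  show ?thesis
    unfolding rec_prog_def by (rule exec.Seq[OF loop[unfolded start] exec.Seq[OF clear transfer]])
qed

section \<open>Functions computable in linear space\<close>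

text \<open>
  A scope consists of a bounding function and of the functions whose values are available as
  arguments. \<open>computes \<Gamma> f c P\<close> says that the program \<open>P rs m\<close> puts \<open>f e\<close> into the register \<open>m\<close>, given
  the arguments in the registers \<open>rs\<close> below \<open>m\<close> and scratch registers from \<open>m\<close> on, while all values
  stay polynomial in the bounding function and the arguments. The numerals therefore have linear
  length. The bounding function itself need not be available as a value.
\<close>

type_synonym 'e scope = "('e \<Rightarrow> nat) \<times> ('e \<Rightarrow> nat) list"

definition add_arg :: "'e scope \<Rightarrow> ('e \<times> nat) scope" where
  "add_arg \<Gamma> = (\<lambda>x. fst \<Gamma> (fst x), snd # map (\<lambda>g x. g (fst x)) (snd \<Gamma>))"

definition arguments_in :: "'e scope \<Rightarrow> 'e \<Rightarrow> nat list \<Rightarrow> nat \<Rightarrow> (nat \<Rightarrow> nat) \<Rightarrow> nat \<Rightarrow> bool" where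
  "arguments_in \<Gamma> e rs m s b \<longleftrightarrow> map s rs = map (\<lambda>g. g e) (snd \<Gamma>) \<and> fst \<Gamma> e \<le> b \<and>
     (\<forall>r\<in>set rs. r < m \<and> s r \<le> b) \<and> (\<forall>r\<ge>m. s r = 0)"

definition computes :: "'e scope \<Rightarrow> ('e \<Rightarrow> nat) \<Rightarrow> nat \<Rightarrow> (nat list \<Rightarrow> nat \<Rightarrow> prog) \<Rightarrow> bool" where
  "computes \<Gamma> f c P \<longleftrightarrow> (\<forall>e rs m s b B. arguments_in \<Gamma> e rs m s b \<and> (b + 2) ^ c \<le> B \<longrightarrow>
     exec B (P rs m) s (s(m := f e)))"

definition linspace :: "'e scope \<Rightarrow> ('e \<Rightarrow> nat) \<Rightarrow> bool" where
  "linspace \<Gamma> f \<longleftrightarrow> (\<exists>c P. computes \<Gamma> f c P)"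

definition linspace_pred :: "'e scope \<Rightarrow> ('e \<Rightarrow> bool) \<Rightarrow> bool" where
  "linspace_pred \<Gamma> P \<longleftrightarrow> linspace \<Gamma> (\<lambda>e. of_bool (P e))"

definition polybounded :: "'e scope \<Rightarrow> ('e \<Rightarrow> nat) \<Rightarrow> bool" where
  "polybounded \<Gamma> f \<longleftrightarrow> (\<exists>c. \<forall>e b. fst \<Gamma> e \<le> b \<and> (\<forall>g\<in>set (snd \<Gamma>). g e \<le> b) \<longrightarrow> f e \<le> (b + 2) ^ c)"

lemma computesI:
  "(\<And>e rs m s b B. arguments_in \<Gamma> e rs m s b \<Longrightarrow> (b + 2) ^ c \<le> B \<Longrightarrow> exec B (P rs m) s (s(m := f e))) \<Longrightarrow>
     computes \<Gamma> f c P"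
  unfolding computes_def by blast

lemma computesD:
  "computes \<Gamma> f c P \<Longrightarrow> arguments_in \<Gamma> e rs m s b \<Longrightarrow> (b + 2) ^ c \<le> B \<Longrightarrow>
     exec B (P rs m) s (s(m := f e))"
  unfolding computes_def by blast

lemma linspaceI: "computes \<Gamma> f c P \<Longrightarrow> linspace \<Gamma> f"
  unfolding linspace_def by blast

lemma arguments_in_le:
  assumes "arguments_in \<Gamma> e rs m s b" "g \<in> set (snd \<Gamma>)"
  shows "g e \<le> b"
proof -
  have "g e \<in> set (map s rs)" using assms by (auto simp: arguments_in_def)
  then show "g e \<le> b" using assms(1) by (auto simp: arguments_in_def)
qed

lemma arguments_in_skip:
  assumes "arguments_in \<Gamma> e rs m s b" "b \<le> b'" "m \<le> m'" "\<forall>i<m. s' i = s i" "\<forall>i\<ge>m'. s' i = 0"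
  shows "arguments_in \<Gamma> e rs m' s' b'"
proof -
  have same_args: "\<forall>r\<in>set rs. s' r = s r" using assms(1,4) by (simp add: arguments_in_def)
  then have "map s' rs = map s rs" by simp
  also have "\<dots> = map (\<lambda>g. g e) (snd \<Gamma>)" using assms(1) by (simp add: arguments_in_def)
  finally have "map s' rs = map (\<lambda>g. g e) (snd \<Gamma>)" .
  moreover have "\<forall>r\<in>set rs. s' r \<le> b" using assms(1) same_args by (simp add: arguments_in_def)
  ultimately show ?thesis using assms by (auto simp: arguments_in_def)
qed

lemma arguments_in_add_arg:
  "arguments_in \<Gamma> e rs m s b \<Longrightarrow> r < m \<Longrightarrow> s r \<le> b \<Longrightarrow> arguments_in (add_arg \<Gamma>) (e, s r) (r # rs) m s b"
  by (auto simp: arguments_in_def add_arg_def)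

lemma power_add_2_le: "(b + 2 :: nat) ^ c + 2 \<le> (b + 2) ^ (c + 2)"
proof -
  have "(b + 2) ^ c * 4 \<le> (b + 2) ^ c * (b + 2) ^ 2"
    by (intro mult_left_mono) (auto simp: power2_eq_square)
  moreover have "(b + 2) ^ c \<ge> 1" by simp
  ultimately show ?thesis unfolding power_add by linarith
qed

lemma power_power_add_2_le: "((b + 2 :: nat) ^ c + 2) ^ c' \<le> (b + 2) ^ ((c + 2) * c')"
  unfolding power_mult by (intro power_mono power_add_2_le) auto

lemma power_add_2_mono: "c \<le> c' \<Longrightarrow> (b + 2 :: nat) ^ c \<le> (b + 2) ^ c'"
  by (intro power_increasing) auto

lemma le_power_Suc: "b \<le> (b + 2 :: nat) ^ Suc c"
proof -
  have "(b + 2) * 1 \<le> (b + 2) * (b + 2) ^ c" by (intro mult_left_mono) auto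
  then show ?thesis by simp
qed

subsection \<open>Polynomial bounds\<close>

lemma polyboundedE:
  assumes "polybounded \<Gamma> f"
  obtains c where "\<And>e b. fst \<Gamma> e \<le> b \<Longrightarrow> (\<And>g. g \<in> set (snd \<Gamma>) \<Longrightarrow> g e \<le> b) \<Longrightarrow> f e \<le> (b + 2) ^ c"
  using assms unfolding polybounded_def by blast

lemma polybounded_at:
  assumes "polybounded \<Gamma> f"
  obtains c where "\<And>e rs m s b. arguments_in \<Gamma> e rs m s b \<Longrightarrow> f e \<le> (b + 2) ^ c"
proof -
  obtain c where "\<And>e b. fst \<Gamma> e \<le> b \<Longrightarrow> (\<And>g. g \<in> set (snd \<Gamma>) \<Longrightarrow> g e \<le> b) \<Longrightarrow> f e \<le> (b + 2) ^ c"
    using polyboundedE[OF assms] by blast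
  then have "f e \<le> (b + 2) ^ c" if "arguments_in \<Gamma> e rs m s b" for e rs m s b
    using arguments_in_le[OF that] that by (simp add: arguments_in_def)
  then show ?thesis using that by blast
qed

lemma polybounded_linspace:
  assumes "linspace \<Gamma> f"
  shows "polybounded \<Gamma> f"
proof -
  obtain c P where P: "computes \<Gamma> f c P" using assms by (auto simp: linspace_def)
  have "f e \<le> (b + 2) ^ c" if b: "fst \<Gamma> e \<le> b" "\<forall>g\<in>set (snd \<Gamma>). g e \<le> b" for e b
  proof -
    let ?n = "length (snd \<Gamma>)"
    define s where "s i = (if i < ?n then (snd \<Gamma> ! i) e else 0)" for i
    have "arguments_in \<Gamma> e [0..<?n] ?n s b"
      using b by (auto simp: arguments_in_def s_def intro!: nth_equalityI)
    from exec_le[OF computesD[OF P this order_refl], of ?n] show ?thesis by (simp add: s_def)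
  qed
  then show ?thesis unfolding polybounded_def by blast
qed

lemma polybounded_const: "polybounded \<Gamma> (\<lambda>_. k)"
proof -
  have "k \<le> (b + 2) ^ k" for b :: nat
    by (rule order_trans[OF less_imp_le[OF less_exp] power_mono]) auto
  then show ?thesis unfolding polybounded_def by blast
qed

lemma polybounded_bound: "polybounded \<Gamma> (fst \<Gamma>)"
  unfolding polybounded_def by (intro exI[of _ 1]) auto

lemma polybounded_mono: "polybounded \<Gamma> g \<Longrightarrow> (\<And>e. f e \<le> g e) \<Longrightarrow> polybounded \<Gamma> f"
  unfolding polybounded_def by (meson order_trans)

lemma polybounded_mult:
  assumes "polybounded \<Gamma> f" "polybounded \<Gamma> g"
  shows "polybounded \<Gamma> (\<lambda>e. f e * g e)"
proof -
  obtain c where "\<And>e b. fst \<Gamma> e \<le> b \<Longrightarrow> (\<And>g. g \<in> set (snd \<Gamma>) \<Longrightarrow> g e \<le> b) \<Longrightarrow> f e \<le> (b + 2) ^ c"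
    using polyboundedE[OF assms(1)] by blast
  moreover obtain c' where
      "\<And>e b. fst \<Gamma> e \<le> b \<Longrightarrow> (\<And>g. g \<in> set (snd \<Gamma>) \<Longrightarrow> g e \<le> b) \<Longrightarrow> g e \<le> (b + 2) ^ c'"
    using polyboundedE[OF assms(2)] by blast
  ultimately have "\<forall>e b. fst \<Gamma> e \<le> b \<and> (\<forall>g\<in>set (snd \<Gamma>). g e \<le> b) \<longrightarrow> f e * g e \<le> (b + 2) ^ (c + c')"
    unfolding power_add by (intro allI impI mult_le_mono) auto
  then show ?thesis unfolding polybounded_def by blast
qed

lemma polybounded_Suc:
  assumes "polybounded \<Gamma> f"
  shows "polybounded \<Gamma> (\<lambda>e. Suc (f e))"
proof -
  obtain c where c: "\<And>e b. fst \<Gamma> e \<le> b \<Longrightarrow> (\<And>g. g \<in> set (snd \<Gamma>) \<Longrightarrow> g e \<le> b) \<Longrightarrow> f e \<le> (b + 2) ^ c"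
    using polyboundedE[OF assms] by blast
  have "Suc (f e) \<le> (b + 2) ^ (c + 2)" if "fst \<Gamma> e \<le> b" "\<forall>g\<in>set (snd \<Gamma>). g e \<le> b" for e b
    using c[of e b] that power_add_2_le[of b c] by simp
  then show ?thesis unfolding polybounded_def by blast
qed

lemma polybounded_add:
  assumes "polybounded \<Gamma> f" "polybounded \<Gamma> g"
  shows "polybounded \<Gamma> (\<lambda>e. f e + g e)"
  by (rule polybounded_mono[OF polybounded_mult[OF assms[THEN polybounded_Suc]]]) simp

lemma polybounded_power: "polybounded \<Gamma> f \<Longrightarrow> polybounded \<Gamma> (\<lambda>e. f e ^ k)"
  by (induction k) (auto intro: polybounded_const polybounded_mult)

lemma polybounded_weaken: "polybounded \<Gamma> f \<Longrightarrow> polybounded (add_arg \<Gamma>) (\<lambda>x. f (fst x))"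
  unfolding polybounded_def add_arg_def by auto

subsection \<open>Structural rules\<close>

lemma linspace_reindex:
  assumes f: "linspace \<Gamma> f" and ub: "\<And>e. fst \<Gamma> (\<phi> e) \<le> fst \<Delta> e"
    and args: "\<And>g. g \<in> set (snd \<Gamma>) \<Longrightarrow> (\<lambda>e. g (\<phi> e)) \<in> set (snd \<Delta>)"
  shows "linspace \<Delta> (\<lambda>e. f (\<phi> e))"
proof -
  obtain c P where P: "computes \<Gamma> f c P" using f by (auto simp: linspace_def)
  obtain ix where ix: "\<And>g. g \<in> set (snd \<Gamma>) \<Longrightarrow> ix g < length (snd \<Delta>) \<and> snd \<Delta> ! ix g = (\<lambda>e. g (\<phi> e))"
    using args unfolding in_set_conv_nth by metis
  have "computes \<Delta> (\<lambda>e. f (\<phi> e)) c (\<lambda>rs m. P (map (\<lambda>g. rs ! ix g) (snd \<Gamma>)) m)"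
  proof (rule computesI)
    fix e rs m s b B
    assume in_regs: "arguments_in \<Delta> e rs m s b" and B: "(b + 2) ^ c \<le> B"
    then have len: "length rs = length (snd \<Delta>)" unfolding arguments_in_def by (metis length_map)
    have "s (rs ! i) = (snd \<Delta> ! i) e" if "i < length rs" for i
      using in_regs that len unfolding arguments_in_def by (metis nth_map)
    then have "s (rs ! ix g) = g (\<phi> e) \<and> rs ! ix g \<in> set rs" if "g \<in> set (snd \<Gamma>)" for g
      using ix[OF that] len by simp
    then have "arguments_in \<Gamma> (\<phi> e) (map (\<lambda>g. rs ! ix g) (snd \<Gamma>)) m s b"
      using in_regs ub[of e] unfolding arguments_in_def by (auto; metis)
    then show "exec B (P (map (\<lambda>g. rs ! ix g) (snd \<Gamma>)) m) s (s(m := f (\<phi> e)))"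
      by (rule computesD[OF P _ B])
  qed
  then show ?thesis by (rule linspaceI)
qed

lemma linspace_weaken: "linspace \<Gamma> f \<Longrightarrow> linspace (add_arg \<Gamma>) (\<lambda>x. f (fst x))"
  by (rule linspace_reindex) (auto simp: add_arg_def)

lemma linspace_weaken_under:
  assumes "linspace (add_arg \<Gamma>) (\<lambda>x. f (fst x) (snd x))"
  shows "linspace (add_arg (add_arg \<Gamma>)) (\<lambda>x. f (fst (fst x)) (snd x))"
proof -
  have "linspace (add_arg (add_arg \<Gamma>)) (\<lambda>x. (\<lambda>x. f (fst x) (snd x)) (fst (fst x), snd x))"
    by (rule linspace_reindex[OF assms]) (auto simp: add_arg_def)
  then show ?thesis by simp
qed

lemma linspace_arg:
  assumes "g \<in> set (snd \<Gamma>)"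
  shows "linspace \<Gamma> g"
proof -
  obtain i where i: "i < length (snd \<Gamma>)" "snd \<Gamma> ! i = g" using assms by (metis in_set_conv_nth)
  have "computes \<Gamma> g 1 (\<lambda>rs m. copy (rs ! i) m (Suc m))"
  proof (rule computesI)
    fix e rs m s b B
    assume in_regs: "arguments_in \<Gamma> e rs m s b" and B: "(b + 2) ^ 1 \<le> B"
    then have len: "i < length rs" using i(1) unfolding arguments_in_def by (metis length_map)
    then have "s (rs ! i) = g e" using in_regs i unfolding arguments_in_def by (metis nth_map)
    moreover have "rs ! i < m" "s (rs ! i) \<le> b" using in_regs len by (auto simp: arguments_in_def)
    ultimately show "exec B (copy (rs ! i) m (Suc m)) s (s(m := g e))"
      using in_regs B by (intro exec_eq[OF exec_copy]) (auto simp: arguments_in_def)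
  qed
  then show ?thesis by (rule linspaceI)
qed

lemma linspace_snd: "linspace (add_arg \<Gamma>) (\<lambda>x. snd x)"
  by (rule linspace_arg) (simp add: add_arg_def)

lemma linspace_Let:
  assumes a: "linspace \<Gamma> a" and F: "linspace (add_arg \<Gamma>) (\<lambda>x. F (fst x) (snd x))"
  shows "linspace \<Gamma> (\<lambda>e. F e (a e))"
proof -
  obtain ca Pa where Pa: "computes \<Gamma> a ca Pa" using a by (auto simp: linspace_def)
  obtain cF PF where PF: "computes (add_arg \<Gamma>) (\<lambda>x. F (fst x) (snd x)) cF PF"
    using F by (auto simp: linspace_def)
  obtain cb where cb: "\<And>e rs m s b. arguments_in \<Gamma> e rs m s b \<Longrightarrow> a e \<le> (b + 2) ^ cb"
    using polybounded_at[OF polybounded_linspace[OF a]] by blast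
  let ?c = "ca + (Suc cb + 2) * cF"
  let ?P = "\<lambda>rs m. Seq (Pa rs m) (Seq (PF (m # rs) (Suc m)) (Seq (clear m) (transfer (Suc m) m)))"
  have "computes \<Gamma> (\<lambda>e. F e (a e)) ?c ?P"
  proof (rule computesI)
    fix e rs m s b B
    assume args: "arguments_in \<Gamma> e rs m s b" and B: "(b + 2) ^ ?c \<le> B"
    let ?s = "s(m := a e)" and ?b = "(b + 2) ^ Suc cb"
    have zero: "\<forall>r\<ge>m. s r = 0" using args by (simp add: arguments_in_def)
    have "exec B (Pa rs m) s ?s"
      by (rule computesD[OF Pa args]) (rule order_trans[OF power_add_2_mono B], simp)
    moreover have "arguments_in (add_arg \<Gamma>) (e, ?s m) (m # rs) (Suc m) ?s ?b"
    proof (rule arguments_in_add_arg)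
      show "arguments_in \<Gamma> e rs (Suc m) ?s ?b"
        by (rule arguments_in_skip[OF args le_power_Suc]) (use zero in auto)
      show "?s m \<le> ?b" using cb[OF args] power_add_2_mono[of cb "Suc cb" b] by simp
    qed simp
    then have "exec B (PF (m # rs) (Suc m)) ?s (?s(Suc m := F (fst (e, ?s m)) (snd (e, ?s m))))"
      by (rule computesD[OF PF])
        (rule order_trans[OF power_power_add_2_le order_trans[OF power_add_2_mono B]], simp)
    then have body: "exec B (PF (m # rs) (Suc m)) ?s (?s(Suc m := F e (a e)))" by simp
    moreover have "exec B (clear m) (?s(Suc m := F e (a e))) (s(Suc m := F e (a e)))"
      by (rule exec_eq[OF exec_clear]) (use zero in \<open>auto simp: fun_eq_iff\<close>)
    moreover have "F e (a e) \<le> B" using exec_le[OF body, of "Suc m"] zero by simp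
    then have "exec B (transfer (Suc m) m) (s(Suc m := F e (a e))) (s(m := F e (a e)))"
      by (intro exec_eq[OF exec_transfer]) (use zero in \<open>auto simp: fun_eq_iff\<close>)
    ultimately show "exec B (?P rs m) s (s(m := F e (a e)))" by (blast intro: exec.Seq)
  qed
  then show ?thesis by (rule linspaceI)
qed

lemma exec_computes_two_args:
  assumes h: "computes (add_arg (add_arg \<Gamma>)) (\<lambda>x. h (fst (fst x)) (snd (fst x)) (snd x)) ch P"
    and args: "arguments_in \<Gamma> e rs m s b"
    and bounds: "i \<le> (b + 2) ^ Suc c" "x \<le> (b + 2) ^ Suc c" "(b + 2) ^ ((Suc c + 2) * ch) \<le> B"
  shows "exec B (P ((m + 1) # (m + 2) # rs) (m + 3)) (s(m := k, m + 1 := x, m + 2 := i))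
    (s(m := k, m + 1 := x, m + 2 := i, m + 3 := h e i x))"
proof -
  let ?s = "s(m := k, m + 1 := x, m + 2 := i)" and ?b = "(b + 2) ^ Suc c"
  have "arguments_in \<Gamma> e rs (m + 3) ?s ?b"
    by (rule arguments_in_skip[OF args le_power_Suc]) (use args in \<open>auto simp: arguments_in_def\<close>)
  then have "arguments_in (add_arg \<Gamma>) (e, ?s (m + 2)) ((m + 2) # rs) (m + 3) ?s ?b"
    by (rule arguments_in_add_arg) (use bounds in auto)
  then have "arguments_in (add_arg (add_arg \<Gamma>)) ((e, ?s (m + 2)), ?s (m + 1))
      ((m + 1) # (m + 2) # rs) (m + 3) ?s ?b"
    by (rule arguments_in_add_arg) (use bounds in auto)
  from computesD[OF h this order_trans[OF power_power_add_2_le bounds(3)]] show ?thesis by simp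
qed

lemma linspace_rec:
  assumes k: "linspace \<Gamma> k" and g: "linspace \<Gamma> g"
    and h: "linspace (add_arg (add_arg \<Gamma>)) (\<lambda>x. h (fst (fst x)) (snd (fst x)) (snd x))"
    and bd: "polybounded \<Gamma> bd" "\<And>e i. i \<le> k e \<Longrightarrow> rec_nat (g e) (h e) i \<le> bd e"
  shows "linspace \<Gamma> (\<lambda>e. rec_nat (g e) (h e) (k e))"
proof -
  obtain ck Pk where Pk: "computes \<Gamma> k ck Pk" using k by (auto simp: linspace_def)
  obtain cg Pg where Pg: "computes \<Gamma> g cg Pg" using g by (auto simp: linspace_def)
  obtain ch Ph where Ph:
      "computes (add_arg (add_arg \<Gamma>)) (\<lambda>x. h (fst (fst x)) (snd (fst x)) (snd x)) ch Ph"
    using h by (auto simp: linspace_def)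
  obtain cb where cb: "\<And>e rs m s b. arguments_in \<Gamma> e rs m s b \<Longrightarrow> k e + bd e \<le> (b + 2) ^ cb"
    using polybounded_at[OF polybounded_add[OF polybounded_linspace[OF k] bd(1)]] by blast
  let ?c = "ck + cg + Suc cb + (Suc cb + 2) * ch"
  let ?loop = "\<lambda>rs m. rec_prog (Ph ((m + 1) # (m + 2) # rs) (m + 3)) m"
  have "computes \<Gamma> (\<lambda>e. rec_nat (g e) (h e) (k e)) ?c
      (\<lambda>rs m. Seq (Pk rs m) (Seq (Pg rs (m + 1)) (?loop rs m)))"
  proof (rule computesI)
    fix e rs m s b B
    assume args: "arguments_in \<Gamma> e rs m s b" and B: "(b + 2) ^ ?c \<le> B"
    let ?x = "rec_nat (g e) (h e)"
    have zero: "\<forall>r\<ge>m. s r = 0" using args by (simp add: arguments_in_def)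
    have le_B: "(b + 2) ^ c \<le> B" if "c \<le> ?c" for c
      by (rule order_trans[OF power_add_2_mono[OF that] B])
    have k_le: "k e \<le> (b + 2) ^ Suc cb" and x_le: "i \<le> k e \<Longrightarrow> ?x i \<le> (b + 2) ^ Suc cb" for i
      using cb[OF args] bd(2)[of i e] power_add_2_mono[of cb "Suc cb" b] by simp_all
    have "exec B (Pk rs m) s (s(m := k e))" by (rule computesD[OF Pk args le_B]) simp
    moreover have "arguments_in \<Gamma> e rs (m + 1) (s(m := k e)) b"
      by (rule arguments_in_skip[OF args order_refl]) (use zero in auto)
    then have "exec B (Pg rs (m + 1)) (s(m := k e)) (s(m := k e, m + 1 := ?x 0))"
      using computesD[OF Pg _ le_B] by simp
    moreover have "exec B (?loop rs m) (s(m := k e, m + 1 := ?x 0)) (s(m := ?x (k e)))"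
    proof (rule exec_rec_prog[OF zero])
      fix i assume i: "i < k e"
      show "exec B (Ph ((m + 1) # (m + 2) # rs) (m + 3))
          (s(m := k e - Suc i, m + 1 := ?x i, m + 2 := i))
          (s(m := k e - Suc i, m + 1 := ?x i, m + 2 := i, m + 3 := ?x (Suc i)))"
        unfolding nat.rec using k_le x_le[of i] i
        by (intro exec_computes_two_args[OF Ph args _ _ le_B]) auto
    qed (use k_le x_le le_B[of "Suc cb"] in \<open>auto intro: order_trans\<close>)
    ultimately show "exec B (Seq (Pk rs m) (Seq (Pg rs (m + 1)) (?loop rs m))) s (s(m := ?x (k e)))"
      by (blast intro: exec.Seq)
  qed
  then show ?thesis by (rule linspaceI)
qed

lemma linspace_funpow:
  assumes "linspace \<Gamma> k" "linspace \<Gamma> g" "linspace (add_arg \<Gamma>) (\<lambda>x. h (fst x) (snd x))"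
    and "polybounded \<Gamma> bd" "\<And>e i. i \<le> k e \<Longrightarrow> (h e ^^ i) (g e) \<le> bd e"
  shows "linspace \<Gamma> (\<lambda>e. (h e ^^ k e) (g e))"
proof -
  have funpow: "(f ^^ i) x = rec_nat x (\<lambda>_. f) i" for f :: "nat \<Rightarrow> nat" and x i
    by (induction i) auto
  show ?thesis
    unfolding funpow
    by (rule linspace_rec[OF assms(1,2) _ assms(4)])
      (use assms(5) linspace_weaken_under[OF assms(3)] in \<open>simp_all add: funpow\<close>)
qed

subsection \<open>Arithmetic and logic\<close>

lemma linspace_0: "linspace \<Gamma> (\<lambda>_. 0)"
proof -
  have "computes \<Gamma> (\<lambda>_. 0) 0 (\<lambda>_ _. Skip)"
    by (rule computesI) (auto simp: arguments_in_def intro!: exec_eq[OF exec.Skip])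
  then show ?thesis by (rule linspaceI)
qed

lemma linspace_Suc:
  assumes "linspace \<Gamma> f"
  shows "linspace \<Gamma> (\<lambda>e. Suc (f e))"
proof -
  obtain c P where P: "computes \<Gamma> f c P" using assms by (auto simp: linspace_def)
  obtain cb where cb: "\<And>e rs m s b. arguments_in \<Gamma> e rs m s b \<Longrightarrow> Suc (f e) \<le> (b + 2) ^ cb"
    using polybounded_at[OF polybounded_Suc[OF polybounded_linspace[OF assms]]] by blast
  have "computes \<Gamma> (\<lambda>e. Suc (f e)) (c + cb) (\<lambda>rs m. Seq (P rs m) (Inc m))"
  proof (rule computesI)
    fix e rs m s b B
    assume args: "arguments_in \<Gamma> e rs m s b" and B: "(b + 2) ^ (c + cb) \<le> B"
    have le_B: "(b + 2) ^ c \<le> B" "(b + 2) ^ cb \<le> B"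
      by (rule order_trans[OF power_add_2_mono B], simp)+
    have "exec B (P rs m) s (s(m := f e))" by (rule computesD[OF P args le_B(1)])
    moreover have "exec B (Inc m) (s(m := f e)) (s(m := Suc (f e)))"
      by (rule exec_eq[OF exec.Inc]) (use cb[OF args] le_B(2) in auto)
    ultimately show "exec B (Seq (P rs m) (Inc m)) s (s(m := Suc (f e)))" by (rule exec.Seq)
  qed
  then show ?thesis by (rule linspaceI)
qed

lemma linspace_const: "linspace \<Gamma> (\<lambda>_. k)"
  by (induction k) (auto intro: linspace_0 linspace_Suc)

lemma linspace_add:
  assumes a: "linspace \<Gamma> a" and b: "linspace \<Gamma> b"
  shows "linspace \<Gamma> (\<lambda>e. a e + b e)"
proof -
  have funpow_Suc: "(Suc ^^ i) x = x + i" for x i by (induction i) auto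
  have "linspace \<Gamma> (\<lambda>e. (Suc ^^ b e) (a e))"
    by (rule linspace_funpow[OF b a, where bd = "\<lambda>e. a e + b e"])
      (auto simp: funpow_Suc intro!: linspace_Suc linspace_snd
        polybounded_add[OF a[THEN polybounded_linspace] b[THEN polybounded_linspace]])
  then show ?thesis by (simp only: funpow_Suc)
qed

lemma linspace_mult:
  assumes a: "linspace \<Gamma> a" and b: "linspace \<Gamma> b"
  shows "linspace \<Gamma> (\<lambda>e. a e * b e)"
proof -
  have funpow_eq: "((\<lambda>y. y + x) ^^ i) 0 = x * i" for x i :: nat by (induction i) auto
  have "linspace \<Gamma> (\<lambda>e. ((\<lambda>y. y + a e) ^^ b e) 0)"
    by (rule linspace_funpow[OF b linspace_const, where bd = "\<lambda>e. a e * b e"])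
      (auto simp: funpow_eq intro!: linspace_add linspace_snd linspace_weaken[of _ a] a
        polybounded_mult[OF a[THEN polybounded_linspace] b[THEN polybounded_linspace]])
  then show ?thesis by (simp add: funpow_eq)
qed

lemma linspace_minus_1:
  assumes a: "linspace \<Gamma> a"
  shows "linspace \<Gamma> (\<lambda>e. a e - 1)"
proof -
  have rec_eq: "rec_nat 0 (\<lambda>i _. i) i = i - 1" for i :: nat by (cases i) auto
  have "linspace \<Gamma> (\<lambda>e. rec_nat 0 (\<lambda>i _. i) (a e))"
    by (rule linspace_rec[OF a linspace_const, where bd = a])
      (auto simp: rec_eq intro!: linspace_weaken[of _ snd] linspace_snd polybounded_linspace a)
  then show ?thesis by (simp add: rec_eq)
qed

lemma linspace_diff:
  assumes a: "linspace \<Gamma> a" and b: "linspace \<Gamma> b"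
  shows "linspace \<Gamma> (\<lambda>e. a e - b e)"
proof -
  have funpow_eq: "((\<lambda>y. y - 1) ^^ i) x = x - i" for x i :: nat by (induction i) auto
  have "linspace \<Gamma> (\<lambda>e. ((\<lambda>y. y - 1) ^^ b e) (a e))"
    by (rule linspace_funpow[OF b a, where bd = a])
      (simp_all only: funpow_eq diff_le_self linspace_minus_1 linspace_snd polybounded_linspace a)
  then show ?thesis by (simp only: funpow_eq)
qed

lemma linspace_If:
  assumes P: "linspace_pred \<Gamma> P" and a: "linspace \<Gamma> a" and b: "linspace \<Gamma> b"
  shows "linspace \<Gamma> (\<lambda>e. if P e then a e else b e)"
proof -
  have "linspace \<Gamma> (\<lambda>e. of_bool (P e) * a e + (1 - of_bool (P e)) * b e)"
    using P unfolding linspace_pred_def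
    by (intro linspace_add linspace_mult linspace_diff linspace_const a b)
  moreover have "of_bool p * x + (1 - of_bool p) * y = (if p then x else y)" for p and x y :: nat
    by simp
  ultimately show ?thesis by simp
qed

lemma linspace_pred_weaken: "linspace_pred \<Gamma> P \<Longrightarrow> linspace_pred (add_arg \<Gamma>) (\<lambda>x. P (fst x))"
  unfolding linspace_pred_def by (rule linspace_weaken)

lemma linspace_pred_weaken_under:
  "linspace_pred (add_arg \<Gamma>) (\<lambda>x. P (fst x) (snd x)) \<Longrightarrow>
     linspace_pred (add_arg (add_arg \<Gamma>)) (\<lambda>x. P (fst (fst x)) (snd x))"
  unfolding linspace_pred_def by (rule linspace_weaken_under)

lemma linspace_pred_Let:
  "linspace \<Gamma> a \<Longrightarrow> linspace_pred (add_arg \<Gamma>) (\<lambda>x. P (fst x) (snd x)) \<Longrightarrow>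
    linspace_pred \<Gamma> (\<lambda>e. P e (a e))"
  unfolding linspace_pred_def by (rule linspace_Let)

lemma linspace_pred_const: "linspace_pred \<Gamma> (\<lambda>_. p)"
  unfolding linspace_pred_def by (rule linspace_const)

lemma linspace_pred_cong: "linspace_pred \<Gamma> P \<Longrightarrow> (\<And>e. P e = Q e) \<Longrightarrow> linspace_pred \<Gamma> Q"
  by (simp add: linspace_pred_def)

lemma linspace_pred_le:
  assumes "linspace \<Gamma> a" "linspace \<Gamma> b"
  shows "linspace_pred \<Gamma> (\<lambda>e. a e \<le> b e)"
proof -
  have "linspace \<Gamma> (\<lambda>e. 1 - (a e - b e))" by (intro linspace_diff linspace_const assms)
  moreover have "(\<lambda>e. 1 - (a e - b e)) = (\<lambda>e. of_bool (a e \<le> b e))" by (auto simp: fun_eq_iff)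
  ultimately show ?thesis by (simp add: linspace_pred_def)
qed

lemma linspace_pred_not:
  assumes "linspace_pred \<Gamma> P"
  shows "linspace_pred \<Gamma> (\<lambda>e. \<not> P e)"
proof (rule linspace_pred_cong)
  show "linspace_pred \<Gamma> (\<lambda>e. of_bool (P e) \<le> (0 :: nat))"
    using assms unfolding linspace_pred_def[of _ P] by (intro linspace_pred_le linspace_const)
qed simp

lemma linspace_pred_conj:
  "linspace_pred \<Gamma> P \<Longrightarrow> linspace_pred \<Gamma> Q \<Longrightarrow> linspace_pred \<Gamma> (\<lambda>e. P e \<and> Q e)"
  unfolding linspace_pred_def of_bool_conj by (rule linspace_mult)

lemma linspace_pred_disj:
  assumes "linspace_pred \<Gamma> P" "linspace_pred \<Gamma> Q"
  shows "linspace_pred \<Gamma> (\<lambda>e. P e \<or> Q e)"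
proof (rule linspace_pred_cong)
  show "linspace_pred \<Gamma> (\<lambda>e. \<not> (\<not> P e \<and> \<not> Q e))"
    by (intro linspace_pred_not linspace_pred_conj assms)
qed auto

lemma linspace_pred_imp:
  assumes "linspace_pred \<Gamma> P" "linspace_pred \<Gamma> Q"
  shows "linspace_pred \<Gamma> (\<lambda>e. P e \<longrightarrow> Q e)"
  unfolding imp_conv_disj by (intro linspace_pred_disj linspace_pred_not assms)

lemma linspace_pred_iff:
  assumes "linspace_pred \<Gamma> P" "linspace_pred \<Gamma> Q"
  shows "linspace_pred \<Gamma> (\<lambda>e. P e = Q e)"
  unfolding iff_conv_conj_imp by (intro linspace_pred_conj linspace_pred_imp assms)

lemma linspace_pred_less:
  assumes "linspace \<Gamma> a" "linspace \<Gamma> b"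
  shows "linspace_pred \<Gamma> (\<lambda>e. a e < b e)"
  unfolding not_le[symmetric] by (intro linspace_pred_not linspace_pred_le assms)

lemma linspace_pred_eq:
  assumes "linspace \<Gamma> a" "linspace \<Gamma> b"
  shows "linspace_pred \<Gamma> (\<lambda>e. a e = b e)"
  unfolding order_eq_iff by (intro linspace_pred_conj linspace_pred_le assms)

lemma linspace_card:
  assumes y: "linspace \<Gamma> y" and P: "linspace_pred (add_arg \<Gamma>) (\<lambda>x. P (fst x) (snd x))"
  shows "linspace \<Gamma> (\<lambda>e. card {i. i < y e \<and> P e i})"
proof -
  have rec_eq: "rec_nat 0 (\<lambda>i acc. acc + of_bool (Q i)) n = card {i. i < n \<and> Q i}" for Q n
  proof (induction n)
    case (Suc n)
    have "{i. i < Suc n \<and> Q i} = (if Q n then insert n else id) {i. i < n \<and> Q i}"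
      by (auto simp: less_Suc_eq)
    with Suc show ?case by simp
  qed simp
  have card_le: "card {i. i < n \<and> Q i} \<le> n" for Q n
    using card_mono[of "{..<n}" "{i. i < n \<and> Q i}"] by auto
  have "linspace \<Gamma> (\<lambda>e. rec_nat 0 (\<lambda>i acc. acc + of_bool (P e i)) (y e))"
  proof (rule linspace_rec[OF y linspace_const _ polybounded_linspace[OF y]])
    show "linspace (add_arg (add_arg \<Gamma>)) (\<lambda>x. snd x + of_bool (P (fst (fst x)) (snd (fst x))))"
      using linspace_weaken[OF P[unfolded linspace_pred_def]] by (intro linspace_add linspace_snd)
    show "i \<le> y e \<Longrightarrow> rec_nat 0 (\<lambda>i acc. acc + of_bool (P e i)) i \<le> y e" for e i
      unfolding rec_eq using card_le[of i "P e"] by linarith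
  qed
  then show ?thesis by (simp add: rec_eq)
qed

lemma linspace_pred_ex:
  assumes y: "linspace \<Gamma> y" and P: "linspace_pred (add_arg \<Gamma>) (\<lambda>x. P (fst x) (snd x))"
  shows "linspace_pred \<Gamma> (\<lambda>e. \<exists>i<y e. P e i)"
proof (rule linspace_pred_cong)
  show "linspace_pred \<Gamma> (\<lambda>e. 0 < card {i. i < y e \<and> P e i})"
    by (intro linspace_pred_less linspace_const linspace_card y P)
  show "0 < card {i. i < y e \<and> P e i} \<longleftrightarrow> (\<exists>i<y e. P e i)" for e
    by (auto simp: card_gt_0_iff)
qed

lemma linspace_pred_all:
  assumes y: "linspace \<Gamma> y" and P: "linspace_pred (add_arg \<Gamma>) (\<lambda>x. P (fst x) (snd x))"
  shows "linspace_pred \<Gamma> (\<lambda>e. \<forall>i<y e. P e i)"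
proof (rule linspace_pred_cong)
  show "linspace_pred \<Gamma> (\<lambda>e. \<not> (\<exists>i<y e. \<not> P e i))"
    by (intro linspace_pred_not linspace_pred_ex y P)
qed auto

lemma div_eq_card:
  fixes x y :: nat
  assumes "0 < y"
  shows "x div y = card {i. i < x \<and> Suc i * y \<le> x}"
proof -
  have "{i. i < x \<and> Suc i * y \<le> x} = {..<x div y}"
  proof (intro set_eqI)
    fix i
    have "Suc i * y \<le> x \<longleftrightarrow> Suc i \<le> x div y"
      using less_eq_div_iff_mult_less_eq[OF assms] by blast
    moreover have "x div y \<le> x" by (rule div_le_dividend)
    ultimately show "i \<in> {i. i < x \<and> Suc i * y \<le> x} \<longleftrightarrow> i \<in> {..<x div y}"
      unfolding mem_Collect_eq lessThan_iff by linarith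
  qed
  then show ?thesis by simp
qed

lemma linspace_div:
  assumes a: "linspace \<Gamma> a" and b: "linspace \<Gamma> b"
  shows "linspace \<Gamma> (\<lambda>e. a e div b e)"
proof -
  have "linspace \<Gamma> (\<lambda>e. if 0 < b e then card {i. i < a e \<and> Suc i * b e \<le> a e} else 0)"
    by (intro linspace_If linspace_pred_less linspace_const linspace_card linspace_pred_le
        linspace_mult linspace_Suc linspace_snd linspace_weaken[of _ a] linspace_weaken[of _ b] a b)
  moreover have "(if 0 < b e then card {i. i < a e \<and> Suc i * b e \<le> a e} else 0) = a e div b e" for e
    using div_eq_card[of "b e" "a e"] by simp
  ultimately show ?thesis by simp
qed

lemma linspace_mod:
  assumes a: "linspace \<Gamma> a" and b: "linspace \<Gamma> b"
  shows "linspace \<Gamma> (\<lambda>e. a e mod b e)"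
  unfolding modulo_nat_def by (intro linspace_diff linspace_mult linspace_div a b)

lemma linspace_pred_bit:
  assumes a: "linspace \<Gamma> a" and i: "linspace \<Gamma> i"
  shows "linspace_pred \<Gamma> (\<lambda>e. bit (a e) (i e))"
proof (rule linspace_pred_cong)
  have funpow_eq: "((\<lambda>y. y div 2) ^^ k) x = x div 2 ^ k" for x k :: nat
    by (induction k) (auto simp: div_mult2_eq[symmetric] mult.commute)
  have "linspace \<Gamma> (\<lambda>e. ((\<lambda>y. y div 2) ^^ i e) (a e))"
    by (rule linspace_funpow[OF i a, where bd = a])
      (auto simp: funpow_eq intro!: linspace_div linspace_snd linspace_const polybounded_linspace a)
  then show "linspace_pred \<Gamma> (\<lambda>e. (a e div 2 ^ i e) mod 2 = 1)"
    unfolding funpow_eq by (intro linspace_pred_eq linspace_mod linspace_const)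
  show "((a e div 2 ^ i e) mod 2 = 1) = bit (a e) (i e)" for e
    by (simp add: bit_iff_odd odd_iff_mod_2_eq_one)
qed

lemma linspace_power2:
  assumes a: "linspace \<Gamma> a" and bd: "polybounded \<Gamma> (\<lambda>e. 2 ^ a e)"
  shows "linspace \<Gamma> (\<lambda>e. 2 ^ a e)"
proof -
  have funpow_eq: "((*) 2 ^^ i) 1 = (2 :: nat) ^ i" for i by (induction i) auto
  have "linspace \<Gamma> (\<lambda>e. ((*) 2 ^^ a e) 1)"
  proof (rule linspace_funpow[OF a linspace_const _ bd])
    show "linspace (add_arg \<Gamma>) (\<lambda>x. 2 * snd x)" by (intro linspace_mult linspace_const linspace_snd)
    show "i \<le> a e \<Longrightarrow> ((*) 2 ^^ i) 1 \<le> (2 :: nat) ^ a e" for i e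
      unfolding funpow_eq by (rule power_increasing) auto
  qed
  then show ?thesis by (simp only: funpow_eq)
qed

subsection \<open>Numbers as finite sets\<close>

definition collect_bits :: "nat \<Rightarrow> (nat \<Rightarrow> bool) \<Rightarrow> nat" where
  "collect_bits n P = horner_sum of_bool 2 (map P [0..<n])"

lemma bit_collect_bits [simp]: "bit (collect_bits n P) j \<longleftrightarrow> j < n \<and> P j"
  by (auto simp: collect_bits_def bit_horner_sum_bit_iff)

lemma collect_bits_less: "collect_bits n P < 2 ^ n"
  using horner_sum_of_bool_2_less[of "map P [0..<n]"] by (simp add: collect_bits_def)

lemma bit_less:
  assumes "x < 2 ^ n" "bit (x :: nat) j"
  shows "j < n"
  using assms by (metis bit_take_bit_iff take_bit_nat_eq_self)

lemma linspace_collect_bits: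
  assumes n: "linspace \<Gamma> n" and bd: "polybounded \<Gamma> (\<lambda>e. 2 ^ n e)"
    and P: "linspace_pred (add_arg \<Gamma>) (\<lambda>x. P (fst x) (snd x))"
  shows "linspace \<Gamma> (\<lambda>e. collect_bits (n e) (P e))"
proof -
  define h where "h e i acc = of_bool (P e (n e - Suc i)) + 2 * acc" for e and i acc :: nat
  have rec_eq: "rec_nat 0 (h e) i = horner_sum of_bool 2 (map (P e) [n e - i..<n e])"
    if "i \<le> n e" for e i
    using that
  proof (induction i)
    case (Suc i)
    then have "[n e - Suc i..<n e] = (n e - Suc i) # [n e - i..<n e]"
      by (simp add: upt_conv_Cons Suc_diff_Suc)
    with Suc show ?case by (simp add: h_def)
  qed simp
  have "linspace \<Gamma> (\<lambda>e. rec_nat 0 (h e) (n e))"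
  proof (rule linspace_rec[OF n linspace_const _ bd])
    have "linspace_pred (add_arg (add_arg \<Gamma>))
        (\<lambda>x. P (fst (fst x)) (n (fst (fst x)) - Suc (snd (fst x))))"
      by (rule linspace_pred_Let[where P = "\<lambda>x. P (fst (fst x))"])
        (intro linspace_diff linspace_Suc linspace_weaken[of _ snd] linspace_snd
          linspace_weaken[of _ "\<lambda>x. n (fst x)"] linspace_weaken[of _ n] n
          linspace_pred_weaken_under[where P = "\<lambda>x. P (fst x)"] linspace_pred_weaken_under P)+
    then show "linspace (add_arg (add_arg \<Gamma>)) (\<lambda>x. h (fst (fst x)) (snd (fst x)) (snd x))"
      unfolding h_def linspace_pred_def
      by (intro linspace_add linspace_mult linspace_const linspace_snd)
    show "rec_nat 0 (h e) i \<le> 2 ^ n e" if "i \<le> n e" for e i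
    proof -
      have "rec_nat 0 (h e) i < 2 ^ i"
        using horner_sum_of_bool_2_less[of "map (P e) [n e - i..<n e]"] that by (simp add: rec_eq)
      also have "\<dots> \<le> 2 ^ n e" using that by (simp add: power_increasing)
      finally show ?thesis by simp
    qed
  qed
  then show ?thesis by (simp add: rec_eq collect_bits_def)
qed

lemmas linspace_intros =
  linspace_const linspace_snd linspace_Suc linspace_add linspace_mult linspace_diff linspace_If
  linspace_div linspace_mod
  linspace_pred_const linspace_pred_not linspace_pred_conj linspace_pred_disj linspace_pred_imp
  linspace_pred_iff linspace_pred_le linspace_pred_less linspace_pred_eq linspace_pred_ex
  linspace_pred_all linspace_pred_bit linspace_weaken linspace_pred_weaken

subsection \<open>Linear space and the space of Turing machines\<close>

lemma exec_of_computes: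
  assumes Q: "computes (ub, [num_val]) (\<lambda>w. of_bool (w \<in> L)) c Q"
    and b: "ub w \<le> 2 ^ k" "num_val w \<le> 2 ^ k"
  shows "\<exists>B s. exec B (Q [0] 1) (input_regs w) s \<and> num_val w \<le> B \<and> B < 2 ^ ((k + 2) * Suc c + 1) \<and>
    (s 1 \<noteq> 0 \<longleftrightarrow> w \<in> L)"
proof (intro exI conjI)
  let ?B = "(2 ^ k + 2 :: nat) ^ Suc c"
  have "arguments_in (ub, [num_val]) w [0] 1 (input_regs w) (2 ^ k)"
    using b by (auto simp: arguments_in_def)
  then show "exec ?B (Q [0] 1) (input_regs w) ((input_regs w)(1 := of_bool (w \<in> L)))"
    by (rule computesD[OF Q]) (rule power_add_2_mono, simp)
  show "num_val w \<le> ?B" using b(2) le_power_Suc[of "2 ^ k" c] by linarith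
  have "(1 :: nat) \<le> 2 ^ k" by simp
  then have "(2 :: nat) ^ k + 2 \<le> 2 ^ (k + 2)" unfolding power_add power2_eq_square by linarith
  then have "?B \<le> (2 ^ (k + 2)) ^ Suc c" by (rule power_mono) simp
  also have "\<dots> = 2 ^ ((k + 2) * Suc c)" by (simp only: power_mult)
  also have "\<dots> < 2 ^ ((k + 2) * Suc c + 1)" by (rule power_strict_increasing) auto
  finally show "?B < 2 ^ ((k + 2) * Suc c + 1)" .
qed simp

theorem linspace_pred_DSPACE:
  assumes P: "linspace_pred (ub, [num_val]) (\<lambda>w. w \<in> L)"
    and ub: "\<And>w. ub w \<le> 2 ^ h (length w)" and h: "\<And>n. 4 * n \<le> h n"
    and f: "(\<lambda>n. real (h n)) \<in> O(f)" "(\<lambda>_. 1) \<in> O(f)"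
  shows "L \<in> DSPACE f"
proof -
  obtain c Q where Q: "computes (ub, [num_val]) (\<lambda>w. of_bool (w \<in> L)) c Q"
    using P by (auto simp: linspace_pred_def linspace_def)
  define N where "N = Suc (Max (insert 1 (regs (Q [0] 1))))"
  have N: "insert 1 (regs (Q [0] 1)) \<subseteq> {..<N}"
    unfolding N_def using finite_regs by (auto simp: less_Suc_eq_le intro!: Max_ge)
  define H where "H n = (h n + 2) * Suc c + 1" for n
  have "num_val w \<le> 2 ^ h (length w)" for w
    using num_val_less[of w] power_increasing[OF h[of "length w"], of "2::nat"] by linarith
  then have ex: "\<exists>B s. exec B (Q [0] 1) (input_regs w) s \<and> num_val w \<le> B \<and> B < 2 ^ H (length w) \<and>
      (s 1 \<noteq> 0 \<longleftrightarrow> w \<in> L)" for w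
    unfolding H_def by (rule exec_of_computes[OF Q ub])
  have "(\<lambda>n. real (N * (H n + 2))) =
      (\<lambda>n. real (N * Suc c) * real (h n) + real (N * (2 * Suc c + 3)) * 1)"
    by (auto simp: H_def algebra_simps)
  also have "\<dots> \<in> O(f)"
    by (intro sum_in_bigo(1) landau_o.big.cmult_in_iff[THEN iffD2] f)
      (use N in \<open>auto simp del: of_nat_mult\<close>)
  finally have "(\<lambda>n. real (N * (H n + 2))) \<in> O(f)" .
  moreover have "turing_machine (counter_tm N (Q [0] 1))"
    by (rule turing_machine_counter_tm) (use N in auto)
  ultimately show ?thesis
    using counter_tm_decides[OF N ex] unfolding DSPACE_def
    by (intro CollectI exI[of _ "counter_tm N (Q [0] 1)"] exI[of _ "\<lambda>n. N * (H n + 2)"] conjI allI)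
qed

section \<open>Recursion with a stack that is a number\<close>

lemma funpow_fixpoint_bounded:
  fixes f :: "nat \<Rightarrow> nat"
  assumes reach: "(f ^^ n) x = y" and fixpoint: "f y = y" and bound: "\<And>j. (f ^^ j) x < b"
  shows "(f ^^ b) x = y"
proof -
  define m where "m = (LEAST m. (f ^^ m) x = y)"
  have m: "(f ^^ m) x = y"
    unfolding m_def using reach by (rule LeastI[where P = "\<lambda>m. (f ^^ m) x = y"])
  have "inj_on (\<lambda>j. (f ^^ j) x) {..<m}"
  proof (rule linorder_inj_onI)
    fix i j assume ij: "i < j" "j \<in> {..<m}"
    show "(f ^^ i) x \<noteq> (f ^^ j) x"
    proof
      assume cycle: "(f ^^ i) x = (f ^^ j) x"
      have "(f ^^ (m - j + i)) x = (f ^^ (m - j)) ((f ^^ i) x)" by (simp add: funpow_add)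
      also have "\<dots> = (f ^^ (m - j + j)) x" unfolding cycle by (simp add: funpow_add)
      also have "\<dots> = y" using ij m by simp
      finally have "m \<le> m - j + i" unfolding m_def by (rule Least_le)
      then show False using ij by simp
    qed
  qed auto
  moreover have "(\<lambda>j. (f ^^ j) x) ` {..<m} \<subseteq> {..<b}" using bound by auto
  ultimately have "m \<le> b" using card_inj_on_le[of _ "{..<m}" "{..<b}"] by simp
  moreover have "(f ^^ k) y = y" for k using fixpoint by (induction k) auto
  ultimately show ?thesis
    using m funpow_add[of "b - m" m f] by simp
qed

lemma digit_div_mod:
  fixes x y A :: nat
  assumes "y < A"
  shows "(x * A + y) div A = x" "(x * A + y) mod A = y"
  using assms by auto

lemma mult_add_less:
  fixes x y z A :: nat
  assumes "x < z" "y < A"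
  shows "x * A + y < z * A"
proof -
  have "x * A + y < Suc x * A" using assms(2) by simp
  also have "\<dots> \<le> z * A" using assms(1) by (intro mult_right_mono) auto
  finally show ?thesis .
qed

type_synonym frame = "nat \<times> nat \<times> nat"
type_synonym stack_state = "nat option \<times> frame list"

text \<open>The recursive function with \<open>result k = finish k acc\<close>, where \<open>acc\<close> accumulates the results of
  the keys of all \<open>c < Y\<close> with \<open>child k c\<close>. A stack frame consists of the argument \<open>k\<close>, the loop
  counter \<open>c\<close> and the accumulator; a state contains moreover the value that has just been returned,
  if any.\<close>

locale stack_machine =
  fixes Y :: nat and child :: "nat \<Rightarrow> nat \<Rightarrow> bool" and key :: "nat \<Rightarrow> nat"
    and upd :: "nat \<Rightarrow> nat \<Rightarrow> nat \<Rightarrow> nat \<Rightarrow> nat" and finish :: "nat \<Rightarrow> nat \<Rightarrow> nat"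
begin

fun step :: "stack_state \<Rightarrow> stack_state" where
  "step (ret, []) = (ret, [])"
| "step (Some v, (k, c, acc) # fs) = (None, (k, Suc c, upd k c acc v) # fs)"
| "step (None, (k, c, acc) # fs) =
     (if c < Y then
        if child k c then (None, (key c, 0, 0) # (k, c, acc) # fs) else (None, (k, Suc c, acc) # fs)
      else (Some (finish k acc), fs))"

text \<open>The base-\<open>A\<close> digit of an argument is increased by one, so that only the empty stack is \<open>0\<close>. The
  digit for the returned value is \<open>0\<close> if there is none, and otherwise increased by one as well.\<close>

definition push_frame :: "nat \<Rightarrow> nat \<Rightarrow> nat \<Rightarrow> nat \<Rightarrow> nat \<Rightarrow> nat" where
  "push_frame A k c acc st = ((st * A + Suc k) * A + c) * A + acc"

fun code_frames :: "nat \<Rightarrow> frame list \<Rightarrow> nat" where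
  "code_frames A [] = 0"
| "code_frames A ((k, c, acc) # fs) = push_frame A k c acc (code_frames A fs)"

fun code_state :: "nat \<Rightarrow> stack_state \<Rightarrow> nat" where
  "code_state A (None, fs) = code_frames A fs * A"
| "code_state A (Some v, fs) = code_frames A fs * A + Suc v"

definition num_step :: "nat \<Rightarrow> nat \<Rightarrow> nat" where
  "num_step A x = (let ret = x mod A; fs = x div A; acc = fs mod A; c = fs div A mod A;
       k = fs div A div A mod A - 1; rest = fs div A div A div A in
     if fs = 0 then x
     else if ret \<noteq> 0 then push_frame A k (Suc c) (upd k c acc (ret - 1)) rest * A
     else if c < Y then
       if child k c then push_frame A (key c) 0 0 fs * A else push_frame A k (Suc c) acc rest * A
     else rest * A + Suc (finish k acc))"

definition num_run :: "nat \<Rightarrow> nat \<Rightarrow> nat \<Rightarrow> nat" where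
  "num_run A t k = (num_step A ^^ t) (push_frame A k 0 0 0 * A)"

end

locale stack_recursion = stack_machine +
  fixes A :: nat and rank :: "nat \<Rightarrow> nat"
  assumes Y_less: "Y < A"
    and key_less: "\<And>c. Suc (key c) < A"
    and upd_less: "\<And>k c acc v. upd k c acc v < A"
    and finish_less: "\<And>k acc. Suc (finish k acc) < A"
    and rank_less: "\<And>k c. child k c \<Longrightarrow> rank (key c) < rank k"
begin

function result :: "nat \<Rightarrow> nat" where
  "result k =
     finish k (fold (\<lambda>c acc. if child k c then upd k c acc (result (key c)) else acc) [0..<Y] 0)"
  by auto
termination by (relation "measure rank") (auto simp: rank_less)

declare result.simps [simp del]

definition accum :: "nat \<Rightarrow> nat \<Rightarrow> nat" where
  "accum k j = fold (\<lambda>c acc. if child k c then upd k c acc (result (key c)) else acc) [0..<j] 0"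

lemma accum_0: "accum k 0 = 0"
  by (simp add: accum_def)

lemma accum_Suc:
  "accum k (Suc j) = (if child k j then upd k j (accum k j) (result (key j)) else accum k j)"
  by (simp add: accum_def)

lemma result_eq: "result k = finish k (accum k Y)"
  unfolding accum_def by (rule result.simps)

abbreviation steps :: "stack_state \<Rightarrow> stack_state \<Rightarrow> bool" where
  "steps \<sigma> \<tau> \<equiv> \<exists>n. (step ^^ n) \<sigma> = \<tau>"

lemma steps_trans: "steps \<sigma> \<sigma>' \<Longrightarrow> steps \<sigma>' \<sigma>'' \<Longrightarrow> steps \<sigma> \<sigma>''"
  by (metis comp_apply funpow_add)

lemma steps_Suc: "steps (step \<sigma>) \<tau> \<Longrightarrow> steps \<sigma> \<tau>"
  by (metis comp_apply funpow_Suc_right)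

lemma steps_loop:
  assumes "\<And>c fs. child k c \<Longrightarrow> steps (None, (key c, 0, 0) # fs) (Some (result (key c)), fs)" "c \<le> Y"
  shows "steps (None, (k, 0, 0) # fs) (None, (k, c, accum k c) # fs)"
  using assms(2)
proof (induction c)
  case 0
  show ?case by (rule exI[of _ 0]) (simp add: accum_0)
next
  case (Suc c)
  let ?\<sigma> = "(None, (k, c, accum k c) # fs)" and ?\<tau> = "(None, (k, Suc c, accum k (Suc c)) # fs)"
  have "steps ?\<sigma> ?\<tau>"
  proof (cases "child k c")
    case True
    have "steps (Some (result (key c)), (k, c, accum k c) # fs) ?\<tau>"
      by (rule exI[of _ 1]) (simp add: accum_Suc True)
    then have "steps (None, (key c, 0, 0) # (k, c, accum k c) # fs) ?\<tau>"
      by (rule steps_trans[OF assms(1)[OF True]])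
    then show ?thesis using Suc.prems True by (intro steps_Suc[of ?\<sigma>]) simp
  next
    case False
    then show ?thesis using Suc.prems by (intro exI[of _ 1]) (simp add: accum_Suc)
  qed
  then show ?case using Suc.IH Suc.prems steps_trans by (meson Suc_leD)
qed

lemma steps_call: "steps (None, (k, 0, 0) # fs) (Some (result k), fs)"
proof (induction "rank k" arbitrary: k fs rule: less_induct)
  case less
  have "steps (None, (k, 0, 0) # fs) (None, (k, Y, accum k Y) # fs)"
    by (rule steps_loop[OF less order_refl]) (rule rank_less)
  moreover have "steps (None, (k, Y, accum k Y) # fs) (Some (result k), fs)"
    by (rule exI[of _ 1]) (simp add: result_eq)
  ultimately show ?case by (rule steps_trans)
qed

text \<open>Ranks decrease along the stack, which bounds its height.\<close>

fun frames_ok :: "nat \<Rightarrow> frame list \<Rightarrow> bool" where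
  "frames_ok D [] \<longleftrightarrow> True"
| "frames_ok D ((k, c, acc) # fs) \<longleftrightarrow>
     Suc k < A \<and> c < Y \<and> acc < A \<and> length fs + rank k \<le> D \<and> frames_ok D fs"

fun state_ok :: "nat \<Rightarrow> stack_state \<Rightarrow> bool" where
  "state_ok D (Some v, fs) \<longleftrightarrow> Suc v < A \<and> frames_ok D fs"
| "state_ok D (None, []) \<longleftrightarrow> True"
| "state_ok D (None, (k, c, acc) # fs) \<longleftrightarrow>
     Suc k < A \<and> c \<le> Y \<and> acc < A \<and> length fs + rank k \<le> D \<and> frames_ok D fs"

lemma state_ok_step: "state_ok D \<sigma> \<Longrightarrow> state_ok D (step \<sigma>)"
proof (cases \<sigma> rule: step.cases)
  case (3 k c acc fs)
  assume "state_ok D \<sigma>"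
  moreover have "child k c \<Longrightarrow> Suc (length fs) + rank (key c) \<le> length fs + rank k"
    using rank_less by (simp add: Suc_le_eq)
  ultimately show ?thesis using 3 key_less finish_less Y_less by fastforce
qed (auto simp: upd_less)

lemma state_ok_iterate: "state_ok D \<sigma> \<Longrightarrow> state_ok D ((step ^^ n) \<sigma>)"
  by (induction n) (simp_all add: state_ok_step)

lemma push_frame_fields:
  assumes "Suc k < A" "c < A" "acc < A"
  shows "push_frame A k c acc st mod A = acc" "push_frame A k c acc st div A mod A = c"
    "push_frame A k c acc st div A div A mod A = Suc k"
    "push_frame A k c acc st div A div A div A = st"
    "push_frame A k c acc st \<noteq> 0"
proof -
  show "push_frame A k c acc st mod A = acc" "push_frame A k c acc st div A mod A = c"
    "push_frame A k c acc st div A div A mod A = Suc k"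
    "push_frame A k c acc st div A div A div A = st"
    unfolding push_frame_def assms[THEN digit_div_mod(1)] assms[THEN digit_div_mod(2)] by simp_all
  show "push_frame A k c acc st \<noteq> 0" using assms by (simp add: push_frame_def)
qed

lemma num_step_code: "state_ok D \<sigma> \<Longrightarrow> num_step A (code_state A \<sigma>) = code_state A (step \<sigma>)"
proof (cases \<sigma> rule: step.cases)
  case (1 ret)
  assume "state_ok D \<sigma>"
  then show ?thesis using 1 by (cases ret) (simp_all add: num_step_def)
next
  case (2 v k c acc fs)
  assume "state_ok D \<sigma>"
  then have "Suc v < A" "Suc k < A" "c < A" "acc < A" using 2 Y_less by auto
  note fields = push_frame_fields[OF this(2-4)]
  show ?thesis
    unfolding 2 code_state.simps num_step_def digit_div_mod[OF \<open>Suc v < A\<close>]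
    by (simp add: Let_def fields)
next
  case (3 k c acc fs)
  assume "state_ok D \<sigma>"
  then have "Suc k < A" "c < A" "acc < A" using 3 Y_less by auto
  note fields = push_frame_fields[OF this]
  have "0 < A" using Y_less by simp
  then show ?thesis unfolding 3 by (simp add: num_step_def Let_def fields)
qed

lemma num_step_iterate:
  "state_ok D \<sigma> \<Longrightarrow> (num_step A ^^ n) (code_state A \<sigma>) = code_state A ((step ^^ n) \<sigma>)"
  by (induction n) (simp_all add: num_step_code[OF state_ok_iterate])

lemma push_frame_less:
  assumes "Suc k < A" "c < A" "acc < A" "st < A ^ (3 * j)"
  shows "push_frame A k c acc st < A ^ (3 * Suc j)"
proof -
  have "push_frame A k c acc st < A ^ (3 * j) * A * A * A"
    unfolding push_frame_def by (intro mult_add_less assms)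
  then show ?thesis by (simp add: power_add power3_eq_cube ac_simps)
qed

lemma code_frames_less: "frames_ok D fs \<Longrightarrow> code_frames A fs < A ^ (3 * length fs)"
proof (induction fs)
  case (Cons f fs)
  obtain k c acc where f: "f = (k, c, acc)" by (rule prod_cases3)
  then have "push_frame A k c acc (code_frames A fs) < A ^ (3 * Suc (length fs))"
    using Cons Y_less by (intro push_frame_less) auto
  then show ?case unfolding f by simp
qed simp

lemma frames_ok_length: "frames_ok D fs \<Longrightarrow> length fs \<le> Suc D"
  by (cases fs) auto

lemma code_state_less:
  assumes "state_ok D \<sigma>"
  shows "code_state A \<sigma> < A ^ (3 * Suc D + 1)"
proof -
  obtain ret fs where \<sigma>: "\<sigma> = (ret, fs)" by fastforce
  have A: "0 < A" using Y_less by simp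
  have "code_frames A fs < A ^ (3 * length fs) \<and> length fs \<le> Suc D"
  proof (cases "(D, \<sigma>)" rule: state_ok.cases)
    case (3 D' k c acc gs)
    then have fs: "fs = (k, c, acc) # gs" and ok: "Suc k < A" "c < A" "acc < A" "frames_ok D gs"
      and len: "length fs \<le> Suc D"
      using assms \<sigma> Y_less by auto
    then show ?thesis using push_frame_less[OF ok(1-3) code_frames_less[OF ok(4)]] len by simp
  qed (use assms \<sigma> code_frames_less frames_ok_length in auto)
  then have "code_frames A fs < A ^ (3 * Suc D)"
    using power_increasing[of "3 * length fs" "3 * Suc D" A] A by simp
  moreover have "code_state A \<sigma> = code_frames A fs * A + (case ret of None \<Rightarrow> 0 | Some v \<Rightarrow> Suc v)"
    unfolding \<sigma> by (cases ret) auto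
  moreover have "(case ret of None \<Rightarrow> 0 | Some v \<Rightarrow> Suc v) < A"
    using assms A unfolding \<sigma> by (cases ret) auto
  ultimately have "code_state A \<sigma> < A ^ (3 * Suc D) * A" using mult_add_less by metis
  then show ?thesis by (simp only: power_add power_one_right)
qed

lemma num_run_eq_code:
  assumes "Suc k < A" "rank k \<le> D"
  shows "num_run A t k = code_state A ((step ^^ t) (None, [(k, 0, 0)]))"
    and "state_ok D ((step ^^ t) (None, [(k, 0, 0)]))"
proof -
  have ok: "state_ok D (None, [(k, 0, 0)])" using assms by simp
  show "state_ok D ((step ^^ t) (None, [(k, 0, 0)]))" by (rule state_ok_iterate[OF ok])
  show "num_run A t k = code_state A ((step ^^ t) (None, [(k, 0, 0)]))"
    using num_step_iterate[OF ok, of t] by (simp add: num_run_def)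
qed

lemma num_run_less:
  assumes "Suc k < A" "rank k \<le> D"
  shows "num_run A t k < A ^ (3 * Suc D + 1)"
  unfolding num_run_eq_code(1)[OF assms] by (rule code_state_less[OF num_run_eq_code(2)[OF assms]])

theorem num_run_result:
  assumes "Suc k < A" "rank k \<le> D"
  shows "num_run A (A ^ (3 * Suc D + 1)) k = Suc (result k)"
proof -
  obtain n where "(step ^^ n) (None, [(k, 0, 0)]) = (Some (result k), [])"
    using steps_call by blast
  then have "num_run A n k = Suc (result k)"
    by (simp add: num_run_eq_code(1)[OF assms])
  moreover have "num_step A (Suc (result k)) = Suc (result k)"
    using finish_less by (simp add: num_step_def result_eq)
  ultimately show ?thesis
    using num_run_less[OF assms] unfolding num_run_def by (rule funpow_fixpoint_bounded)
qed

end

section \<open>Greatest fixed points of search problems\<close>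

text \<open>
  A candidate \<open>C < Y\<close> is good if it is coherent and each of its flaws \<open>d < Q\<close> is repaired by a good
  candidate that is reachable from it. Reachability from \<open>C\<close> only depends on the bit set \<open>key C\<close>, and
  keys shrink along it. So the flaws that can be repaired from a given key are found by recursion along
  strictly shrinking keys (\<open>child\<close>, \<open>collect\<close>), followed by a greatest fixed point among the candidates
  with the same key (\<open>close\<close>).
\<close>

locale repair_system =
  fixes Y Q m :: nat and coh :: "nat \<Rightarrow> bool" and reach :: "nat \<Rightarrow> nat \<Rightarrow> bool" and key :: "nat \<Rightarrow> nat"
    and flaw repairs :: "nat \<Rightarrow> nat \<Rightarrow> bool"
begin

coinductive good :: "nat \<Rightarrow> bool" where
  "C < Y \<Longrightarrow> coh C \<Longrightarrow> (\<And>d. d < Q \<Longrightarrow> flaw C d \<Longrightarrow> \<exists>C'. good C' \<and> reach (key C) C' \<and> repairs C' d) \<Longrightarrow> good C"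

definition repairable :: "nat \<Rightarrow> nat \<Rightarrow> bool" where
  "repairable k d \<longleftrightarrow> (\<exists>C'. good C' \<and> reach k C' \<and> repairs C' d)"

lemma good_iff: "good C \<longleftrightarrow> C < Y \<and> coh C \<and> (\<forall>d<Q. flaw C d \<longrightarrow> repairable (key C) d)"
  unfolding repairable_def by (auto elim: good.cases intro: good.intros)

definition child :: "nat \<Rightarrow> nat \<Rightarrow> bool" where
  "child k c \<longleftrightarrow> coh c \<and> reach k c \<and>
     (\<forall>j<m. bit (key c) j \<longrightarrow> bit k j) \<and> (\<exists>j<m. bit k j \<and> \<not> bit (key c) j)"

definition collect :: "nat \<Rightarrow> nat \<Rightarrow> nat \<Rightarrow> nat \<Rightarrow> nat" where
  "collect k c acc v = collect_bits Q (\<lambda>d. bit acc d \<or> (\<forall>d'<Q. flaw c d' \<longrightarrow> bit v d') \<and> repairs c d)"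

lemma bit_collect:
  "bit (collect k c acc v) d \<longleftrightarrow>
    d < Q \<and> (bit acc d \<or> (\<forall>d'<Q. flaw c d' \<longrightarrow> bit v d') \<and> repairs c d)"
  by (simp add: collect_def)

definition closed :: "nat \<Rightarrow> nat \<Rightarrow> nat \<Rightarrow> bool" where
  "closed k acc S \<longleftrightarrow> (\<forall>d<Q. bit S d \<longrightarrow> bit acc d \<or>
     (\<exists>c<Y. coh c \<and> reach k c \<and> key c = k \<and> (\<forall>d'<Q. flaw c d' \<longrightarrow> bit S d') \<and> repairs c d))"

definition close :: "nat \<Rightarrow> nat \<Rightarrow> nat" where
  "close k acc = collect_bits Q (\<lambda>d. \<exists>S<2 ^ Q. bit S d \<and> closed k acc S)"

end

locale repair_search = repair_system +
  assumes key_less: "\<And>c. key c < 2 ^ m"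
    and reach_key: "\<And>c c' j. coh c \<Longrightarrow> coh c' \<Longrightarrow> reach (key c) c' \<Longrightarrow> bit (key c') j \<Longrightarrow> bit (key c) j"
begin

definition rank :: "nat \<Rightarrow> nat" where
  "rank k = card {j. j < m \<and> bit k j}"

lemma rank_le: "rank k \<le> m"
  unfolding rank_def using card_mono[of "{..<m}" "{j. j < m \<and> bit k j}"] by auto

lemma rank_less: "child k c \<Longrightarrow> rank (key c) < rank k"
  unfolding rank_def by (rule psubset_card_mono) (auto simp: child_def)

lemma closed_repairable:
  assumes acc: "\<And>d. d < Q \<Longrightarrow> bit acc d \<Longrightarrow> repairable k d"
    and S: "closed k acc S" "bit S d" "d < Q"
  shows "repairable k d"
proof -
  have repaired: "\<exists>C'. (good C' \<or> C' < Y \<and> coh C' \<and> key C' = k \<and> (\<forall>d'<Q. flaw C' d' \<longrightarrow> bit S d')) \<and>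
      reach k C' \<and> repairs C' d" if "d < Q" "bit S d" for d
    using S(1) acc that unfolding closed_def repairable_def by blast
  have "good c" if "c < Y \<and> coh c \<and> key c = k \<and> (\<forall>d'<Q. flaw c d' \<longrightarrow> bit S d')" for c
    using that
  proof (coinduction arbitrary: c)
    case good
    then show ?case using repaired by metis
  qed
  then show ?thesis using repaired[OF S(3,2)] unfolding repairable_def by blast
qed

lemma closed_collect_repairable:
  assumes C: "coh C" and acc: "\<And>d c. d < Q \<Longrightarrow> child (key C) c \<Longrightarrow> good c \<Longrightarrow> repairs c d \<Longrightarrow> bit acc d"
  shows "closed (key C) acc (collect_bits Q (repairable (key C)))"
  unfolding closed_def
proof (intro allI impI)
  fix d assume d: "d < Q" "bit (collect_bits Q (repairable (key C))) d"
  then obtain C' where C': "good C'" "reach (key C) C'" "repairs C' d"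
    by (auto simp: repairable_def)
  have good: "C' < Y" "coh C'" "\<forall>d<Q. flaw C' d \<longrightarrow> repairable (key C') d"
    using good_iff[of C'] C'(1) by auto
  have sub: "bit (key C') j \<Longrightarrow> bit (key C) j" for j using reach_key[OF C good(2) C'(2)] .
  show "bit acc d \<or> (\<exists>c<Y. coh c \<and> reach (key C) c \<and> key c = key C \<and>
      (\<forall>d'<Q. flaw c d' \<longrightarrow> bit (collect_bits Q (repairable (key C))) d') \<and> repairs c d)"
  proof (cases "child (key C) C'")
    case True
    then show ?thesis using acc C' d(1) by blast
  next
    case False
    then have "bit (key C) j \<Longrightarrow> j < m \<Longrightarrow> bit (key C') j" for j
      using good(2) C'(2) sub unfolding child_def by blast
    then have "key C' = key C" using sub bit_less[OF key_less] by (intro bit_eqI) blast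
    then show ?thesis using good C' by auto
  qed
qed

lemma bit_close:
  assumes "coh C" and acc: "\<And>d. d < Q \<Longrightarrow> bit acc d \<longleftrightarrow> (\<exists>c. child (key C) c \<and> good c \<and> repairs c d)"
  shows "bit (close (key C) acc) d \<longleftrightarrow> d < Q \<and> repairable (key C) d"
proof
  assume "bit (close (key C) acc) d"
  then obtain S where S: "closed (key C) acc S" "bit S d" "d < Q" by (auto simp: close_def)
  have "repairable (key C) d" if "d < Q" "bit acc d" for d
    using that acc unfolding repairable_def child_def by blast
  with S show "d < Q \<and> repairable (key C) d" using closed_repairable by blast
next
  assume d: "d < Q \<and> repairable (key C) d"
  let ?S = "collect_bits Q (repairable (key C))"
  have "closed (key C) acc ?S" using closed_collect_repairable[OF assms(1)] acc by blast
  then show "bit (close (key C) acc) d"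
    using d collect_bits_less[of Q "repairable (key C)"] by (auto simp: close_def)
qed

context
  fixes A :: nat
  assumes A: "Y < A" "2 ^ m < A" "2 ^ Q < A"
begin

interpretation stack: stack_recursion Y child key collect close A rank
proof
  show "Suc (key c) < A" for c using key_less[of c] A by simp
  show "collect k c acc v < A" for k c acc v
    using collect_bits_less[of Q] A unfolding collect_def by (meson less_trans)
  show "Suc (close k acc) < A" for k acc
    using collect_bits_less[of Q] A unfolding close_def by (meson Suc_leI le_less_trans)
qed (use A rank_less in auto)

lemma bit_accum:
  "bit (stack.accum k j) d \<longleftrightarrow>
    d < Q \<and> (\<exists>c<j. child k c \<and> (\<forall>d'<Q. flaw c d' \<longrightarrow> bit (stack.result (key c)) d') \<and> repairs c d)"
proof (induction j)
  case (Suc j)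
  then show ?case
    by (cases "child k j") (auto simp: stack.accum_Suc bit_collect less_Suc_eq)
qed (simp add: stack.accum_0)

lemma bit_result: "coh C \<Longrightarrow> bit (stack.result (key C)) d \<longleftrightarrow> d < Q \<and> repairable (key C) d"
proof (induction "rank (key C)" arbitrary: C d rule: less_induct)
  case less
  have "good c \<longleftrightarrow> c < Y \<and> (\<forall>d'<Q. flaw c d' \<longrightarrow> bit (stack.result (key c)) d')"
    if "child (key C) c" for c
    using less.hyps[OF rank_less[OF that]] that good_iff[of c] by (auto simp: child_def)
  then have "bit (stack.accum (key C) Y) d \<longleftrightarrow> (\<exists>c. child (key C) c \<and> good c \<and> repairs c d)"
    if "d < Q" for d
    unfolding bit_accum using that good_iff by auto
  then show ?case unfolding stack.result_eq by (rule bit_close[OF less.prems])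
qed

theorem good_iff_num_run:
  "good C \<longleftrightarrow> C < Y \<and> coh C \<and>
    (\<forall>d<Q. flaw C d \<longrightarrow> bit (stack.num_run A (A ^ (3 * Suc m + 1)) (key C) - 1) d)"
proof -
  have "Suc (key C) < A" using key_less[of C] A by simp
  then have "stack.num_run A (A ^ (3 * Suc m + 1)) (key C) = Suc (stack.result (key C))"
    by (rule stack.num_run_result[OF _ rank_le])
  then show ?thesis using good_iff[of C] bit_result[of C] by auto
qed

lemma num_run_key_less: "stack.num_run A t (key C) < A ^ (3 * Suc m + 1)"
proof (rule stack.num_run_less[OF _ rank_le])
  show "Suc (key C) < A" using key_less[of C] A by simp
qed

end

end

section \<open>Parsing\<close>

definition letter_at :: "letter list \<Rightarrow> nat \<Rightarrow> letter option" where
  "letter_at w i = (if i < length w then Some (w ! i) else None)"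

definition starts_formula :: "letter list \<Rightarrow> nat \<Rightarrow> bool" where
  "starts_formula w i \<longleftrightarrow> letter_at w i = Some LPar \<or> letter_at w i = Some NegL \<or>
     letter_at w i = Some BoxL \<or> letter_at w i = Some KL \<or> letter_at w i = Some XL"

text \<open>A parse tree is given by the lengths \<open>l i\<close> of the subformulas starting at the positions \<open>i\<close>. The
  right conjunct of the conjunction at position \<open>i\<close> starts at position \<open>right_at l i\<close>.\<close>

definition right_at :: "(nat \<Rightarrow> nat) \<Rightarrow> nat \<Rightarrow> nat" where
  "right_at l i = i + 2 + l (Suc i)"

definition parse_ok :: "letter list \<Rightarrow> (nat \<Rightarrow> nat) \<Rightarrow> nat \<Rightarrow> bool" where
  "parse_ok w l i \<longleftrightarrow>
    (letter_at w i = Some NegL \<or> letter_at w i = Some BoxL \<or> letter_at w i = Some KL \<longrightarrow>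
       starts_formula w (Suc i) \<and> l i = Suc (l (Suc i))) \<and>
    (letter_at w i = Some LPar \<longrightarrow>
       starts_formula w (Suc i) \<and> letter_at w (Suc i + l (Suc i)) = Some AndL \<and>
       starts_formula w (right_at l i) \<and> letter_at w (right_at l i + l (right_at l i)) = Some RPar \<and>
       l i = 3 + l (Suc i) + l (right_at l i)) \<and>
    (letter_at w i = Some XL \<longrightarrow>
       letter_at w (Suc i) = Some ZeroL \<and> l i = 2 \<or>
       letter_at w (Suc i) = Some OneL \<and> 2 \<le> l i \<and>
         (\<forall>j<l i. 2 \<le> j \<longrightarrow> letter_at w (i + j) = Some ZeroL \<or> letter_at w (i + j) = Some OneL))"

definition parses :: "letter list \<Rightarrow> (nat \<Rightarrow> nat) \<Rightarrow> bool" where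
  "parses w l \<longleftrightarrow> starts_formula w 0 \<and> l 0 = length w \<and> (\<forall>i<length w. parse_ok w l i)"

definition atom_at :: "letter list \<Rightarrow> (nat \<Rightarrow> nat) \<Rightarrow> nat \<Rightarrow> atom" where
  "atom_at w l i = (if letter_at w (Suc i) = Some ZeroL then X0
     else X1 (map (\<lambda>j. letter_at w (i + j) = Some OneL) [2..<l i]))"

lemma letter_at_less: "letter_at w i = Some a \<Longrightarrow> i < length w"
  by (simp add: letter_at_def split: if_splits)

lemma starts_formula_less: "starts_formula w i \<Longrightarrow> i < length w"
  unfolding starts_formula_def using letter_at_less by blast

function form_at :: "letter list \<Rightarrow> (nat \<Rightarrow> nat) \<Rightarrow> nat \<Rightarrow> form" where
  "form_at w l i =
    (if letter_at w i = Some NegL then Neg (form_at w l (Suc i))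
     else if letter_at w i = Some BoxL then Box (form_at w l (Suc i))
     else if letter_at w i = Some KL then K (form_at w l (Suc i))
     else if letter_at w i = Some LPar then Conj (form_at w l (Suc i)) (form_at w l (right_at l i))
     else Atom (atom_at w l i))"
  by auto
termination
  by (relation "measure (\<lambda>(w, l, i). length w - i)") (auto simp: right_at_def dest!: letter_at_less)

declare form_at.simps [simp del]

lemma form_at_eqs:
  "letter_at w i = Some NegL \<Longrightarrow> form_at w l i = Neg (form_at w l (Suc i))"
  "letter_at w i = Some BoxL \<Longrightarrow> form_at w l i = Box (form_at w l (Suc i))"
  "letter_at w i = Some KL \<Longrightarrow> form_at w l i = K (form_at w l (Suc i))"
  "letter_at w i = Some LPar \<Longrightarrow>
    form_at w l i = Conj (form_at w l (Suc i)) (form_at w l (right_at l i))"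
  "letter_at w i = Some XL \<Longrightarrow> form_at w l i = Atom (atom_at w l i)"
  by (simp_all add: form_at.simps[of w l i])

definition agrees :: "(nat \<Rightarrow> 'a) \<Rightarrow> nat \<Rightarrow> 'a list \<Rightarrow> bool" where
  "agrees f k xs \<longleftrightarrow> (\<forall>i<length xs. f (k + i) = xs ! i)"

lemma agrees_simps [simp]:
  "agrees f k []" "agrees f k (x # xs) \<longleftrightarrow> f k = x \<and> agrees f (Suc k) xs"
  by (auto simp: agrees_def All_less_Suc2)

lemma agrees_append [simp]: "agrees f k (xs @ ys) \<longleftrightarrow> agrees f k xs \<and> agrees f (k + length xs) ys"
  by (induction xs arbitrary: k) auto

lemma agrees_atom_at:
  assumes ok: "parse_ok w l i" and x: "letter_at w i = Some XL"
  shows "agrees (letter_at w) i (map Some (atom_string (atom_at w l i)))"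
    and "length (atom_string (atom_at w l i)) = l i"
proof -
  consider (x0) "letter_at w (Suc i) = Some ZeroL" "l i = 2"
    | (x1) "letter_at w (Suc i) = Some OneL" "2 \<le> l i"
      "\<And>j. 2 \<le> j \<Longrightarrow> j < l i \<Longrightarrow> letter_at w (i + j) \<in> {Some ZeroL, Some OneL}"
    using ok x by (auto simp: parse_ok_def)
  then have "agrees (letter_at w) i (map Some (atom_string (atom_at w l i))) \<and>
      length (atom_string (atom_at w l i)) = l i"
  proof cases
    case x0
    then show ?thesis using x by (simp add: atom_at_def)
  next
    case x1
    have "letter_at w (Suc (Suc i) + j) =
        Some (if letter_at w (i + (2 + j)) = Some OneL then OneL else ZeroL)" if "j < l i - 2" for j
      using x1(3)[of "2 + j"] that by auto
    then show ?thesis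
      using x1 x by (simp add: atom_at_def) (simp add: agrees_def)
  qed
  then show "agrees (letter_at w) i (map Some (atom_string (atom_at w l i)))"
    and "length (atom_string (atom_at w l i)) = l i" by simp_all
qed

lemma agrees_form_at:
  assumes ok: "\<And>i. i < length w \<Longrightarrow> parse_ok w l i"
  shows "starts_formula w i \<Longrightarrow> agrees (letter_at w) i (map Some (form_string (form_at w l i))) \<and>
    length (form_string (form_at w l i)) = l i"
proof (induction "length w - i" arbitrary: i rule: less_induct)
  case less
  have i: "i < length w" using starts_formula_less[OF less.prems] .
  have IH: "agrees (letter_at w) j (map Some (form_string (form_at w l j))) \<and>
      length (form_string (form_at w l j)) = l j" if "i < j" "starts_formula w j" for j
    using less.hyps[of j] that i by simp
  consider (unary) "letter_at w i \<in> {Some NegL, Some BoxL, Some KL}"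
    | (conj) "letter_at w i = Some LPar" | (atom) "letter_at w i = Some XL"
    using less.prems by (auto simp: starts_formula_def)
  then show ?case
  proof cases
    case unary
    then have "starts_formula w (Suc i)" "l i = Suc (l (Suc i))"
      using ok[OF i] by (auto simp: parse_ok_def)
    then show ?thesis using unary IH[of "Suc i"] by (auto simp: form_at_eqs)
  next
    case conj
    let ?r = "right_at l i"
    have "starts_formula w (Suc i)" "letter_at w (Suc i + l (Suc i)) = Some AndL"
      "starts_formula w ?r" "letter_at w (?r + l ?r) = Some RPar" "l i = 3 + l (Suc i) + l ?r"
      using ok[OF i] conj by (auto simp: parse_ok_def)
    moreover have "i < ?r" "?r = Suc (Suc (i + l (Suc i)))" by (simp_all add: right_at_def)
    ultimately show ?thesis
      using conj IH[of "Suc i"] IH[of ?r] by (simp add: form_at_eqs)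
  next
    case atom
    then show ?thesis using agrees_atom_at[OF ok[OF i] atom] by (simp add: form_at_eqs)
  qed
qed

definition same_atom :: "letter list \<Rightarrow> (nat \<Rightarrow> nat) \<Rightarrow> nat \<Rightarrow> nat \<Rightarrow> bool" where
  "same_atom w l i j \<longleftrightarrow> letter_at w i = Some XL \<and> letter_at w j = Some XL \<and> l i = l j \<and>
     (\<forall>k<l i. letter_at w (i + k) = letter_at w (j + k))"

lemma same_atom_iff:
  assumes ok: "\<And>i. i < length w \<Longrightarrow> parse_ok w l i"
    and x: "letter_at w i = Some XL" "letter_at w j = Some XL"
  shows "same_atom w l i j \<longleftrightarrow> form_at w l i = form_at w l j"
proof
  assume same: "same_atom w l i j"
  have "2 \<le> l i" using ok[OF letter_at_less[OF x(1)]] x(1) by (auto simp: parse_ok_def)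
  then have "letter_at w (Suc i) = letter_at w (Suc j)"
    using same by (auto simp: same_atom_def dest!: spec[of _ 1])
  then show "form_at w l i = form_at w l j"
    using same by (auto simp: x form_at_eqs atom_at_def same_atom_def)
next
  assume form_eq: "form_at w l i = form_at w l j"
  have "starts_formula w i" "starts_formula w j" using x by (simp_all add: starts_formula_def)
  then have "agrees (letter_at w) k (map Some (form_string (form_at w l j))) \<and>
      length (form_string (form_at w l j)) = l k" if "k = i \<or> k = j" for k
    using agrees_form_at[OF ok, of k] form_eq that by metis
  from this[of i] this[of j] show "same_atom w l i j" using x by (auto simp: same_atom_def agrees_def)
qed

primrec form_lengths :: "form \<Rightarrow> nat list" where
  "form_lengths (Atom a) = length (atom_string a) # replicate (length (atom_string a) - 1) 0"
| "form_lengths (Neg \<phi>) = Suc (length (form_string \<phi>)) # form_lengths \<phi>"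
| "form_lengths (K \<phi>) = Suc (length (form_string \<phi>)) # form_lengths \<phi>"
| "form_lengths (Box \<phi>) = Suc (length (form_string \<phi>)) # form_lengths \<phi>"
| "form_lengths (Conj \<phi> \<psi>) = (3 + length (form_string \<phi>) + length (form_string \<psi>)) #
     form_lengths \<phi> @ 0 # form_lengths \<psi> @ [0]"

lemma length_form_lengths [simp]: "length (form_lengths \<phi>) = length (form_string \<phi>)"
proof (induction \<phi>)
  case (Atom a)
  then show ?case by (cases a) auto
qed auto

lemma form_lengths_le: "x \<in> set (form_lengths \<phi>) \<Longrightarrow> x \<le> length (form_string \<phi>)"
  by (induction \<phi>) fastforce+

definition parsed_at :: "letter list \<Rightarrow> (nat \<Rightarrow> nat) \<Rightarrow> nat \<Rightarrow> form \<Rightarrow> bool" where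
  "parsed_at w l k \<phi> \<longleftrightarrow> starts_formula w k \<and> l k = length (form_string \<phi>) \<and> form_at w l k = \<phi> \<and>
     (\<forall>i\<in>{k..<k + length (form_string \<phi>)}. parse_ok w l i)"

lemma parse_ok_no_start: "\<not> starts_formula w i \<Longrightarrow> parse_ok w l i"
  by (auto simp: parse_ok_def starts_formula_def)

lemma parsed_at_Atom:
  assumes "agrees (letter_at w) k (map Some (atom_string a))" "l k = length (atom_string a)"
  shows "parsed_at w l k (Atom a)"
proof -
  let ?m = "length (atom_string a)"
  have letters: "letter_at w (k + j) = Some (atom_string a ! j)" if "j < ?m" for j
    using assms(1) that by (simp add: agrees_def)
  have bits: "letter_at w (k + j) \<in> {Some ZeroL, Some OneL}" if "1 \<le> j" "j < ?m" for j
    using letters[OF that(2)] that by (cases a) (auto simp: nth_Cons')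
  have k: "letter_at w k = Some XL" using letters[of 0] by (cases a) auto
  have "atom_at w l k = a"
  proof (cases a)
    case X0
    then show ?thesis using letters[of 1] by (simp add: atom_at_def)
  next
    case (X1 bs)
    then have "letter_at w (k + (2 + j)) = Some (if bs ! j then OneL else ZeroL)"
      if "j < length bs" for j
      using letters[of "2 + j"] that by simp
    then have "map (\<lambda>j. letter_at w (k + j) = Some OneL) [2..<?m] = bs"
      using X1 by (intro nth_equalityI) (auto simp del: upt_Suc)
    then show ?thesis using X1 letters[of 1] assms(2) by (simp add: atom_at_def)
  qed
  moreover have "letter_at w (Suc k) = Some (if a = X0 then ZeroL else OneL)"
    "a = X0 \<Longrightarrow> ?m = 2" "2 \<le> ?m"
    using letters[of 1] by (cases a; simp)+
  then have "parse_ok w l k" using k bits assms(2) by (auto simp: parse_ok_def)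
  moreover have "parse_ok w l i" if "i \<in> {Suc k..<k + ?m}" for i
  proof -
    have "1 \<le> i - k" "i - k < ?m" "k + (i - k) = i" using that by auto
    then have "letter_at w i \<in> {Some ZeroL, Some OneL}" using bits by metis
    then show ?thesis by (intro parse_ok_no_start) (auto simp: starts_formula_def)
  qed
  moreover have "{k..<k + ?m} \<subseteq> insert k {Suc k..<k + ?m}" by auto
  ultimately have "\<forall>i\<in>{k..<k + ?m}. parse_ok w l i" "form_at w l k = Atom a"
    using k by (auto simp: form_at_eqs)
  then show ?thesis
    using k assms(2) by (simp add: parsed_at_def starts_formula_def)
qed

lemma parsed_at_unary:
  assumes "parsed_at w l (Suc k) \<phi>" "l k = Suc (length (form_string \<phi>))"
    and "(letter_at w k, \<psi>) \<in> {(Some NegL, Neg \<phi>), (Some BoxL, Box \<phi>), (Some KL, K \<phi>)}"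
  shows "parsed_at w l k \<psi>"
proof -
  have "parse_ok w l k" using assms by (auto simp: parse_ok_def parsed_at_def)
  moreover have "{k..<k + Suc n} \<subseteq> insert k {Suc k..<Suc k + n}" for n by auto
  ultimately have "\<forall>i\<in>{k..<k + Suc (length (form_string \<phi>))}. parse_ok w l i"
    using assms(1) unfolding parsed_at_def by blast
  then show ?thesis
    using assms by (auto simp: parsed_at_def starts_formula_def form_at_eqs)
qed

lemma parsed_at_Conj:
  assumes \<phi>: "parsed_at w l (Suc k) \<phi>" and \<psi>: "parsed_at w l (k + 2 + length (form_string \<phi>)) \<psi>"
    and "letter_at w k = Some LPar" "l k = length (form_string (Conj \<phi> \<psi>))"
    and "letter_at w (Suc k + length (form_string \<phi>)) = Some AndL"
    and "letter_at w (k + 2 + length (form_string \<phi>) + length (form_string \<psi>)) = Some RPar"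
  shows "parsed_at w l k (Conj \<phi> \<psi>)"
proof -
  let ?a = "length (form_string \<phi>)" and ?b = "length (form_string \<psi>)"
  have right_at: "right_at l k = k + 2 + ?a" using \<phi> by (simp add: right_at_def parsed_at_def)
  have "parse_ok w l k" using assms right_at by (auto simp: parse_ok_def parsed_at_def)
  moreover have "parse_ok w l (Suc k + ?a)" "parse_ok w l (k + 2 + ?a + ?b)"
    using assms(5,6) by (auto simp: starts_formula_def intro!: parse_ok_no_start)
  moreover have "{k..<k + (3 + ?a + ?b)} \<subseteq>
      {k, Suc k + ?a, k + 2 + ?a + ?b} \<union> {Suc k..<Suc k + ?a} \<union> {k + 2 + ?a..<k + 2 + ?a + ?b}"
    by auto
  ultimately have "\<forall>i\<in>{k..<k + (3 + ?a + ?b)}. parse_ok w l i"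
    using \<phi> \<psi> unfolding parsed_at_def by blast
  moreover have "length (form_string (Conj \<phi> \<psi>)) = 3 + ?a + ?b" by simp
  moreover have "form_at w l k = Conj \<phi> \<psi>"
    using assms(3) right_at \<phi> \<psi> by (simp add: form_at_eqs parsed_at_def)
  ultimately show ?thesis
    using assms(3,4) by (simp only: parsed_at_def starts_formula_def) simp
qed

lemma parsed_at:
  "agrees (letter_at w) k (map Some (form_string \<phi>)) \<Longrightarrow> agrees l k (form_lengths \<phi>) \<Longrightarrow>
    parsed_at w l k \<phi>"
proof (induction \<phi> arbitrary: k)
  case (Atom a)
  then show ?case by (intro parsed_at_Atom) auto
next
  case (Neg \<phi>)
  then show ?case by (intro parsed_at_unary[of w l k \<phi>]) auto
next
  case (Conj \<phi> \<psi>)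
  then show ?case by (intro parsed_at_Conj) (auto simp: add.assoc)
next
  case (K \<phi>)
  then show ?case by (intro parsed_at_unary[of w l k \<phi>]) auto
next
  case (Box \<phi>)
  then show ?case by (intro parsed_at_unary[of w l k \<phi>]) auto
qed

text \<open>A parse tree is coded by a number whose base-\<open>Suc (length w)\<close> digits are the lengths.\<close>

definition length_table :: "letter list \<Rightarrow> nat \<Rightarrow> nat \<Rightarrow> nat" where
  "length_table w c i = c div Suc (length w) ^ i mod Suc (length w)"

lemma digits_of_horner_sum:
  fixes b :: nat
  assumes "\<forall>x\<in>set xs. x < b"
  shows "horner_sum (\<lambda>x. x) b xs < b ^ length xs"
    and "i < length xs \<Longrightarrow> horner_sum (\<lambda>x. x) b xs div b ^ i mod b = xs ! i"
proof -
  show "horner_sum (\<lambda>x. x) b xs < b ^ length xs"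
    using assms
  proof (induction xs)
    case (Cons x xs)
    then have "x + horner_sum (\<lambda>x. x) b xs * b < b ^ length xs * b"
      using mult_add_less[of "horner_sum (\<lambda>x. x) b xs" "b ^ length xs" x b] by (simp add: add.commute)
    then show ?case by (simp add: mult.commute)
  qed simp
  show "i < length xs \<Longrightarrow> horner_sum (\<lambda>x. x) b xs div b ^ i mod b = xs ! i"
    using assms
  proof (induction xs arbitrary: i)
    case (Cons x xs)
    then show ?case by (cases i) (auto simp: div_mult2_eq)
  qed simp
qed

theorem eq_form_string_iff:
  assumes y: "Suc (length w) ^ length w \<le> y"
  shows "w = form_string \<phi> \<longleftrightarrow>
    (\<exists>c<y. parses w (length_table w c) \<and> form_at w (length_table w c) 0 = \<phi>)"
proof
  assume w: "w = form_string \<phi>"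
  define c where "c = horner_sum (\<lambda>x. x) (Suc (length w)) (form_lengths \<phi>)"
  have digits: "\<forall>x\<in>set (form_lengths \<phi>). x < Suc (length w)"
    using form_lengths_le w by (auto simp: less_Suc_eq_le)
  have "agrees (length_table w c) 0 (form_lengths \<phi>)"
    unfolding agrees_def length_table_def c_def using digits_of_horner_sum(2)[OF digits] by simp
  moreover have "agrees (letter_at w) 0 (map Some (form_string \<phi>))"
    by (simp add: agrees_def letter_at_def w)
  ultimately have "parsed_at w (length_table w c) 0 \<phi>" by (intro parsed_at)
  moreover have "c < y"
    using digits_of_horner_sum(1)[OF digits] y w unfolding c_def by simp
  ultimately show "\<exists>c<y. parses w (length_table w c) \<and> form_at w (length_table w c) 0 = \<phi>"
    using w by (auto simp: parsed_at_def parses_def)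
next
  assume "\<exists>c<y. parses w (length_table w c) \<and> form_at w (length_table w c) 0 = \<phi>"
  then obtain c where "parses w (length_table w c)" "form_at w (length_table w c) 0 = \<phi>" by blast
  then have "agrees (letter_at w) 0 (map Some (form_string \<phi>))" "length (form_string \<phi>) = length w"
    using agrees_form_at[of w "length_table w c" 0] by (auto simp: parses_def)
  then show "w = form_string \<phi>"
    by (intro nth_equalityI) (auto simp: agrees_def letter_at_def)
qed

section \<open>Types and clouds\<close>

text \<open>
  The subformulas of the formula with the string \<open>w\<close> are addressed by their starting positions. A type
  is a truth assignment to the positions, coded as a number below \<open>2 ^ length w\<close>, and a cloud is a set
  of types, coded as a number below \<open>2 ^ 2 ^ length w\<close>; it stands for the types realised in an
  \<open>L\<close>-class of a model.
\<close>

datatype logic = K4_S5 | S4_S5 | SSL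

definition type_ok :: "logic \<Rightarrow> letter list \<Rightarrow> (nat \<Rightarrow> nat) \<Rightarrow> nat \<Rightarrow> bool" where
  "type_ok L w l t \<longleftrightarrow> (\<forall>i<length w.
     (letter_at w i = Some NegL \<longrightarrow> bit t i = (\<not> bit t (Suc i))) \<and>
     (letter_at w i = Some LPar \<longrightarrow> bit t i = (bit t (Suc i) \<and> bit t (right_at l i))) \<and>
     (L \<noteq> K4_S5 \<and> letter_at w i = Some BoxL \<and> bit t i \<longrightarrow> bit t (Suc i)) \<and>
     (\<forall>j<length w. same_atom w l i j \<longrightarrow> bit t i = bit t j))"

definition type_le :: "logic \<Rightarrow> letter list \<Rightarrow> nat \<Rightarrow> nat \<Rightarrow> bool" where
  "type_le L w t u \<longleftrightarrow> (\<forall>i<length w.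
     (letter_at w i = Some BoxL \<and> bit t i \<longrightarrow> bit u i \<and> bit u (Suc i)) \<and>
     (L = SSL \<and> letter_at w i = Some XL \<longrightarrow> bit t i = bit u i))"

definition cloud_ok :: "logic \<Rightarrow> letter list \<Rightarrow> (nat \<Rightarrow> nat) \<Rightarrow> nat \<Rightarrow> bool" where
  "cloud_ok L w l C \<longleftrightarrow> (\<forall>t<2 ^ length w. bit C t \<longrightarrow> type_ok L w l t \<and>
     (\<forall>i<length w. letter_at w i = Some KL \<longrightarrow>
        bit t i = (\<forall>u<2 ^ length w. bit C u \<longrightarrow> bit u (Suc i))))"

text \<open>The first half of the key is the up-closure of the cloud, the second half the complement of its
  down-closure. Both shrink when one passes to a successor cloud.\<close>

definition cloud_key :: "logic \<Rightarrow> letter list \<Rightarrow> nat \<Rightarrow> nat" where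
  "cloud_key L w C = collect_bits (2 * 2 ^ length w) (\<lambda>j.
     j < 2 ^ length w \<and> (\<exists>t<2 ^ length w. bit C t \<and> type_le L w t j) \<or>
     2 ^ length w \<le> j \<and> L \<noteq> SSL \<and> \<not> (\<exists>t<2 ^ length w. bit C t \<and>
       (\<forall>u<2 ^ length w. type_le L w t u \<longrightarrow> type_le L w (j - 2 ^ length w) u)))"

definition cloud_reach :: "logic \<Rightarrow> letter list \<Rightarrow> nat \<Rightarrow> nat \<Rightarrow> bool" where
  "cloud_reach L w k C \<longleftrightarrow> (\<forall>t<2 ^ length w. bit C t \<longrightarrow> bit k t) \<and>
     (L \<noteq> SSL \<longrightarrow> (\<forall>s<2 ^ length w. \<not> bit k (2 ^ length w + s) \<longrightarrow>
        (\<exists>t<2 ^ length w. bit C t \<and> type_le L w s t)))"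

text \<open>The flaw number \<open>t * length w + i\<close> asks for a witness against the box at position \<open>i\<close> above the
  type \<open>t\<close>.\<close>

definition cloud_flaw :: "letter list \<Rightarrow> nat \<Rightarrow> nat \<Rightarrow> bool" where
  "cloud_flaw w C d \<longleftrightarrow> bit C (d div length w) \<and> letter_at w (d mod length w) = Some BoxL \<and>
     \<not> bit (d div length w) (d mod length w)"

definition cloud_repairs :: "logic \<Rightarrow> letter list \<Rightarrow> nat \<Rightarrow> nat \<Rightarrow> bool" where
  "cloud_repairs L w C d \<longleftrightarrow>
     (\<exists>u<2 ^ length w. bit C u \<and> type_le L w (d div length w) u \<and> \<not> bit u (Suc (d mod length w)))"

definition succ_cloud :: "logic \<Rightarrow> letter list \<Rightarrow> nat \<Rightarrow> nat \<Rightarrow> bool" where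
  "succ_cloud L w C C' \<longleftrightarrow>
     (\<forall>u<2 ^ length w. bit C' u \<longrightarrow> (\<exists>t<2 ^ length w. bit C t \<and> type_le L w t u)) \<and>
     (L \<noteq> SSL \<longrightarrow> (\<forall>t<2 ^ length w. bit C t \<longrightarrow> (\<exists>u<2 ^ length w. bit C' u \<and> type_le L w t u)))"

lemma type_le_trans: "type_le L w t u \<Longrightarrow> type_le L w u v \<Longrightarrow> type_le L w t v"
  unfolding type_le_def by blast

lemma type_le_refl: "L \<noteq> K4_S5 \<Longrightarrow> type_ok L w l t \<Longrightarrow> type_le L w t t"
  unfolding type_le_def type_ok_def by blast

lemma succ_cloud_trans: "succ_cloud L w C C' \<Longrightarrow> succ_cloud L w C' C'' \<Longrightarrow> succ_cloud L w C C''"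
  unfolding succ_cloud_def by (meson type_le_trans)

lemma bit_cloud_key_up:
  "j < 2 ^ length w \<Longrightarrow> bit (cloud_key L w C) j \<longleftrightarrow> (\<exists>t<2 ^ length w. bit C t \<and> type_le L w t j)"
  by (auto simp: cloud_key_def)

lemma bit_cloud_key_down:
  "s < 2 ^ length w \<Longrightarrow> bit (cloud_key L w C) (2 ^ length w + s) \<longleftrightarrow> L \<noteq> SSL \<and>
     \<not> (\<exists>t<2 ^ length w. bit C t \<and> (\<forall>u<2 ^ length w. type_le L w t u \<longrightarrow> type_le L w s u))"
  by (auto simp: cloud_key_def)

lemma cloud_key_less: "cloud_key L w C < 2 ^ (2 * 2 ^ length w)"
  unfolding cloud_key_def by (rule collect_bits_less)

lemma cloud_reach_key_iff: "cloud_reach L w (cloud_key L w C) C' \<longleftrightarrow> succ_cloud L w C C'"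
proof -
  have "(\<forall>s<2 ^ length w. \<not> bit (cloud_key L w C) (2 ^ length w + s) \<longrightarrow>
        (\<exists>u<2 ^ length w. bit C' u \<and> type_le L w s u)) \<longleftrightarrow>
      (\<forall>t<2 ^ length w. bit C t \<longrightarrow> (\<exists>u<2 ^ length w. bit C' u \<and> type_le L w t u))" if "L \<noteq> SSL"
    using that bit_cloud_key_down[of _ w L C] by (auto; blast)
  moreover have "(\<forall>u<2 ^ length w. bit C' u \<longrightarrow> bit (cloud_key L w C) u) \<longleftrightarrow>
      (\<forall>u<2 ^ length w. bit C' u \<longrightarrow> (\<exists>t<2 ^ length w. bit C t \<and> type_le L w t u))"
    using bit_cloud_key_up[of _ w L C] by auto
  ultimately show ?thesis unfolding cloud_reach_def succ_cloud_def by blast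
qed

lemma succ_cloud_down_closure:
  assumes "succ_cloud L w C C'" "L \<noteq> SSL"
    and "\<exists>t<2 ^ length w. bit C t \<and> (\<forall>u<2 ^ length w. type_le L w t u \<longrightarrow> type_le L w s u)"
  shows "\<exists>t<2 ^ length w. bit C' t \<and> (\<forall>u<2 ^ length w. type_le L w t u \<longrightarrow> type_le L w s u)"
proof -
  obtain t where t: "t < 2 ^ length w" "bit C t"
      "\<forall>u<2 ^ length w. type_le L w t u \<longrightarrow> type_le L w s u"
    using assms(3) by blast
  then obtain t' where "t' < 2 ^ length w" "bit C' t'" "type_le L w t t'"
    using assms(1,2) unfolding succ_cloud_def by blast
  then show ?thesis using t(3) type_le_trans by blast
qed

lemma cloud_key_decreasing:
  assumes succ: "succ_cloud L w C C'" and j: "bit (cloud_key L w C') j"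
  shows "bit (cloud_key L w C) j"
proof -
  consider (up) "j < 2 ^ length w" | (down) s where "j = 2 ^ length w + s" "s < 2 ^ length w"
  proof (cases "j < 2 ^ length w")
    case False
    moreover have "j < 2 * 2 ^ length w" using bit_less[OF cloud_key_less j] .
    ultimately show ?thesis using that(2)[of "j - 2 ^ length w"] by simp
  qed (use that in blast)
  then show ?thesis
  proof cases
    case up
    then show ?thesis using succ j bit_cloud_key_up type_le_trans unfolding succ_cloud_def by meson
  next
    case (down s)
    then show ?thesis
      using succ_cloud_down_closure[OF succ, of s] j
      unfolding down(1) bit_cloud_key_down[OF down(2)] by blast
  qed
qed

global_interpretation clouds: repair_search "2 ^ 2 ^ length w" "2 ^ length w * length w"
    "2 * 2 ^ length w" "cloud_ok L w l" "cloud_reach L w" "cloud_key L w" "cloud_flaw w"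
    "cloud_repairs L w"
  for L w l
  defines good_cloud = clouds.good
proof
  show "cloud_key L w c < 2 ^ (2 * 2 ^ length w)" for c by (rule cloud_key_less)
  show "bit (cloud_key L w c) j"
    if "cloud_reach L w (cloud_key L w c) c'" "bit (cloud_key L w c') j" for c c' j
    using that unfolding cloud_reach_key_iff by (rule cloud_key_decreasing)
qed

definition in_good_cloud :: "logic \<Rightarrow> letter list \<Rightarrow> (nat \<Rightarrow> nat) \<Rightarrow> bool" where
  "in_good_cloud L w l \<longleftrightarrow> (\<exists>C t. good_cloud L w l C \<and> bit C t \<and> bit t 0)"

lemma good_cloud_less: "good_cloud L w l C \<Longrightarrow> C < 2 ^ 2 ^ length w"
  and good_cloud_ok: "good_cloud L w l C \<Longrightarrow> cloud_ok L w l C"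
  by (auto elim: clouds.good.cases)

lemma good_cloud_type_less: "good_cloud L w l C \<Longrightarrow> bit C t \<Longrightarrow> t < 2 ^ length w"
  using bit_less good_cloud_less by blast

lemma good_cloud_type_ok: "good_cloud L w l C \<Longrightarrow> bit C t \<Longrightarrow> type_ok L w l t"
  using good_cloud_type_less good_cloud_ok unfolding cloud_ok_def by blast

lemma good_cloud_K:
  assumes "good_cloud L w l C" "bit C t" "letter_at w i = Some KL"
  shows "bit t i \<longleftrightarrow> (\<forall>u. bit C u \<longrightarrow> bit u (Suc i))"
proof -
  have "u < 2 ^ length w" if "bit C u" for u using good_cloud_type_less[OF assms(1) that] .
  then show ?thesis
    using good_cloud_ok[OF assms(1)] assms(2,3) letter_at_less unfolding cloud_ok_def by blast
qed

lemma good_cloud_Box: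
  assumes good: "good_cloud L w l C" "bit C t" and box: "letter_at w i = Some BoxL" "\<not> bit t i"
  obtains C' u where "good_cloud L w l C'" "succ_cloud L w C C'" "bit C' u" "type_le L w t u"
    "\<not> bit u (Suc i)"
proof -
  let ?d = "t * length w + i"
  have less: "i < length w" using letter_at_less[OF box(1)] .
  have "?d < 2 ^ length w * length w" by (rule mult_add_less[OF good_cloud_type_less[OF good] less])
  moreover have "cloud_flaw w C ?d"
    using good box less by (simp add: cloud_flaw_def digit_div_mod[OF less])
  ultimately have "clouds.repairable w L l (cloud_key L w C) ?d"
    using good(1) clouds.good_iff[of L w l C] by blast
  then obtain C' where "good_cloud L w l C'" "succ_cloud L w C C'" "cloud_repairs L w C' ?d"
    unfolding clouds.repairable_def cloud_reach_key_iff by blast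
  then show ?thesis using that less by (auto simp: cloud_repairs_def digit_div_mod[OF less])
qed

section \<open>Types of worlds\<close>

locale parsed =
  fixes w :: "letter list" and l :: "nat \<Rightarrow> nat"
  assumes parses: "parses w l"
begin

abbreviation "subform \<equiv> form_at w l"

lemma parse_ok: "i < length w \<Longrightarrow> parse_ok w l i"
  using parses by (simp add: parses_def)

lemma starts_0: "starts_formula w 0"
  using parses by (simp add: parses_def)

lemma starts_unary:
  assumes "letter_at w i = Some NegL \<or> letter_at w i = Some BoxL \<or> letter_at w i = Some KL"
  shows "starts_formula w (Suc i)"
  using assms parse_ok[of i] letter_at_less[of w i] by (auto simp: parse_ok_def)

lemma starts_Conj:
  assumes "letter_at w i = Some LPar"
  shows "starts_formula w (Suc i)" "starts_formula w (right_at l i)" "i < right_at l i"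
  using assms parse_ok[of i] letter_at_less[of w i] by (auto simp: parse_ok_def right_at_def)

end

locale labelled_model = parsed +
  fixes L :: logic and M :: "'w model" and \<tau> :: "'w \<Rightarrow> nat"
  assumes is_model: "is_model M"
    and type: "\<And>x. x \<in> worlds M \<Longrightarrow> type_ok L w l (\<tau> x)"
    and val: "\<And>x A. x \<in> worlds M \<Longrightarrow>
      x \<in> val M A \<longleftrightarrow> (\<exists>i. letter_at w i = Some XL \<and> subform i = Atom A \<and> bit (\<tau> x) i)"
    and dia: "\<And>x y. (x, y) \<in> dia M \<Longrightarrow> type_le L w (\<tau> x) (\<tau> y)"
    and dia_witness: "\<And>x i. x \<in> worlds M \<Longrightarrow> letter_at w i = Some BoxL \<Longrightarrow> \<not> bit (\<tau> x) i \<Longrightarrow>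
      \<exists>y. (x, y) \<in> dia M \<and> \<not> bit (\<tau> y) (Suc i)"
    and lrel: "\<And>x i. x \<in> worlds M \<Longrightarrow> letter_at w i = Some KL \<Longrightarrow>
      bit (\<tau> x) i \<longleftrightarrow> (\<forall>y. (x, y) \<in> lrel M \<longrightarrow> bit (\<tau> y) (Suc i))"
begin

lemma dia_label_iff:
  assumes "x \<in> worlds M" "letter_at w i = Some BoxL"
  shows "bit (\<tau> x) i \<longleftrightarrow> (\<forall>y. (x, y) \<in> dia M \<longrightarrow> bit (\<tau> y) (Suc i))"
  using dia dia_witness[OF assms] letter_at_less[OF assms(2)] assms(2) unfolding type_le_def by blast

lemma sat_atom_iff:
  assumes x: "x \<in> worlds M" and i: "letter_at w i = Some XL"
  shows "sat M x (subform i) \<longleftrightarrow> bit (\<tau> x) i"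
proof -
  have "bit (\<tau> x) j = bit (\<tau> x) i" if j: "letter_at w j = Some XL" "subform j = subform i" for j
  proof -
    have "same_atom w l i j" using same_atom_iff[OF parse_ok i j(1)] j(2) by simp
    then show ?thesis
      using type[OF x] letter_at_less[OF i] letter_at_less[OF j(1)] unfolding type_ok_def by blast
  qed
  then have "(\<exists>j. letter_at w j = Some XL \<and> subform j = subform i \<and> bit (\<tau> x) j) \<longleftrightarrow> bit (\<tau> x) i"
    using i by blast
  then show ?thesis using val[OF x, of "atom_at w l i"] i by (simp add: form_at_eqs(5))
qed

theorem sat_iff_label:
  "starts_formula w i \<Longrightarrow> x \<in> worlds M \<Longrightarrow> sat M x (subform i) \<longleftrightarrow> bit (\<tau> x) i"
proof (induction "length w - i" arbitrary: i x rule: less_induct)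
  case less
  have i: "i < length w" using starts_formula_less less.prems(1) .
  have IH: "sat M y (subform j) \<longleftrightarrow> bit (\<tau> y) j" if "i < j" "starts_formula w j" "y \<in> worlds M" for j y
    by (rule less.hyps) (use that i in auto)
  have in_worlds: "(x, y) \<in> dia M \<Longrightarrow> y \<in> worlds M" "(x, y) \<in> lrel M \<Longrightarrow> y \<in> worlds M" for y
    using is_model by (auto simp: is_model_def)
  note type_x = type[OF less.prems(2), unfolded type_ok_def, rule_format, OF i]
  consider (conj) "letter_at w i = Some LPar" | (neg) "letter_at w i = Some NegL"
    | (box) "letter_at w i = Some BoxL" | (know) "letter_at w i = Some KL"
    | (atom) "letter_at w i = Some XL"
    using less.prems(1) by (auto simp: starts_formula_def)
  then show ?case
  proof cases
    case conj
    then show ?thesis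
      using IH[of "Suc i" x] IH[of "right_at l i" x] starts_Conj[OF conj] type_x less.prems(2)
      by (simp add: form_at_eqs)
  next
    case neg
    then show ?thesis
      using IH[of "Suc i" x] starts_unary[of i] type_x less.prems(2) by (simp add: form_at_eqs)
  next
    case box
    then show ?thesis
      using dia_label_iff[OF less.prems(2) box] IH[of "Suc i"] starts_unary[of i] in_worlds
      by (simp add: form_at_eqs)
  next
    case know
    then show ?thesis
      using lrel[OF less.prems(2) know] IH[of "Suc i"] starts_unary[of i] in_worlds
      by (simp add: form_at_eqs)
  next
    case atom
    then show ?thesis by (rule sat_atom_iff[OF less.prems(2)])
  qed
qed

end

section \<open>From models to good clouds\<close>

definition logic_model :: "logic \<Rightarrow> 'w model \<Rightarrow> bool" where
  "logic_model L M \<longleftrightarrow> is_model M \<and> trans (dia M) \<and> equiv (worlds M) (lrel M) \<and>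
     dia M O lrel M \<subseteq> lrel M O dia M \<and>
     (L \<noteq> SSL \<longrightarrow> (dia M)\<inverse> O lrel M \<subseteq> lrel M O (dia M)\<inverse>) \<and>
     (L \<noteq> K4_S5 \<longrightarrow> refl_on (worlds M) (dia M)) \<and>
     (L = SSL \<longrightarrow> (\<forall>x y A. (x, y) \<in> dia M \<longrightarrow> (x \<in> val M A \<longleftrightarrow> y \<in> val M A)))"

locale parsed_model = parsed +
  fixes L :: logic and M :: "'w model"
  assumes logic_model: "logic_model L M"
begin

lemma dia_worlds: "(x, y) \<in> dia M \<Longrightarrow> x \<in> worlds M \<and> y \<in> worlds M"
  and lrel_worlds: "(x, y) \<in> lrel M \<Longrightarrow> x \<in> worlds M \<and> y \<in> worlds M"
  using logic_model by (auto simp: logic_model_def is_model_def)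

lemma dia_trans: "(x, y) \<in> dia M \<Longrightarrow> (y, z) \<in> dia M \<Longrightarrow> (x, z) \<in> dia M"
  using logic_model by (auto simp: logic_model_def dest: transD)

lemma equiv_lrel: "equiv (worlds M) (lrel M)"
  using logic_model by (simp add: logic_model_def)

lemma lrel_image_cong: "(x, y) \<in> lrel M \<Longrightarrow> (x, z) \<in> lrel M \<longleftrightarrow> (y, z) \<in> lrel M"
  using equiv_class_eq[OF equiv_lrel] by blast

definition world_type :: "'w \<Rightarrow> nat" where
  "world_type x = collect_bits (length w) (\<lambda>i. sat M x (subform i))"

definition world_cloud :: "'w \<Rightarrow> nat" where
  "world_cloud x = collect_bits (2 ^ length w) (\<lambda>t. \<exists>y. (x, y) \<in> lrel M \<and> t = world_type y)"

lemma bit_world_type: "starts_formula w i \<Longrightarrow> bit (world_type x) i \<longleftrightarrow> sat M x (subform i)"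
  using starts_formula_less by (auto simp: world_type_def)

lemma world_type_less: "world_type x < 2 ^ length w"
  unfolding world_type_def by (rule collect_bits_less)

lemma bit_world_cloud: "bit (world_cloud x) t \<longleftrightarrow> (\<exists>y. (x, y) \<in> lrel M \<and> t = world_type y)"
  using world_type_less by (auto simp: world_cloud_def)

lemma world_cloud_cong:
  assumes "(x, y) \<in> lrel M"
  shows "world_cloud x = world_cloud y"
  by (intro bit_eqI) (simp add: bit_world_cloud lrel_image_cong[OF assms])

lemma starts_letter:
  "letter_at w i \<in> {Some LPar, Some NegL, Some BoxL, Some KL, Some XL} \<Longrightarrow> starts_formula w i"
  by (auto simp: starts_formula_def)

lemma type_ok_world_type:
  assumes x: "x \<in> worlds M"
  shows "type_ok L w l (world_type x)"
  unfolding type_ok_def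
proof (intro allI impI conjI)
  fix i
  show "bit (world_type x) i = (\<not> bit (world_type x) (Suc i))" if "letter_at w i = Some NegL"
    using that starts_unary by (simp add: bit_world_type starts_letter form_at_eqs)
  show "bit (world_type x) i = (bit (world_type x) (Suc i) \<and> bit (world_type x) (right_at l i))"
    if "letter_at w i = Some LPar"
    using that starts_Conj by (simp add: bit_world_type starts_letter form_at_eqs)
  show "bit (world_type x) (Suc i)" if "L \<noteq> K4_S5 \<and> letter_at w i = Some BoxL \<and> bit (world_type x) i"
  proof -
    have "(x, x) \<in> dia M" using logic_model that x unfolding logic_model_def refl_on_def by blast
    then show ?thesis
      using that starts_unary[of i] by (auto simp: bit_world_type starts_letter form_at_eqs)
  qed
  show "bit (world_type x) i = bit (world_type x) j" if "same_atom w l i j" for j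
  proof -
    have "letter_at w i = Some XL" "letter_at w j = Some XL"
      using that by (simp_all add: same_atom_def)
    moreover from this have "subform i = subform j" using that same_atom_iff[OF parse_ok] by blast
    ultimately show ?thesis by (simp add: bit_world_type starts_letter)
  qed
qed

lemma type_le_world_type:
  assumes xy: "(x, y) \<in> dia M"
  shows "type_le L w (world_type x) (world_type y)"
  unfolding type_le_def
proof (intro allI impI conjI)
  fix i
  assume "letter_at w i = Some BoxL \<and> bit (world_type x) i"
  then have i: "letter_at w i = Some BoxL" "sat M x (Box (subform (Suc i)))"
    by (auto simp: bit_world_type starts_letter form_at_eqs)
  then show "bit (world_type y) i" "bit (world_type y) (Suc i)"
    using dia_trans[OF xy] xy starts_unary by (auto simp: bit_world_type starts_letter form_at_eqs)
next
  fix i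
  assume i: "L = SSL \<and> letter_at w i = Some XL"
  then have "x \<in> val M A \<longleftrightarrow> y \<in> val M A" for A
    using logic_model xy unfolding logic_model_def by blast
  then show "bit (world_type x) i = bit (world_type y) i"
    using i by (simp add: bit_world_type starts_letter form_at_eqs)
qed

lemma cloud_ok_world_cloud: "cloud_ok L w l (world_cloud x)"
  unfolding cloud_ok_def
proof (intro allI impI conjI)
  fix t assume "bit (world_cloud x) t"
  then obtain y where y: "(x, y) \<in> lrel M" "t = world_type y" unfolding bit_world_cloud by blast
  show "type_ok L w l t" using y lrel_worlds by (simp add: type_ok_world_type)
  fix i assume i: "letter_at w i = Some KL"
  have "bit t i \<longleftrightarrow> (\<forall>z. (x, z) \<in> lrel M \<longrightarrow> bit (world_type z) (Suc i))"
    using i y starts_unary[of i]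
    by (simp add: bit_world_type starts_letter form_at_eqs lrel_image_cong[OF y(1)])
  then show "bit t i = (\<forall>u<2 ^ length w. bit (world_cloud x) u \<longrightarrow> bit u (Suc i))"
    using world_type_less by (auto simp: bit_world_cloud)
qed

lemma succ_cloud_world_cloud:
  assumes xy: "(x, y) \<in> dia M"
  shows "succ_cloud L w (world_cloud x) (world_cloud y)"
  unfolding succ_cloud_def
proof (intro conjI allI impI)
  fix u assume "bit (world_cloud y) u"
  then obtain y' where y': "(y, y') \<in> lrel M" "u = world_type y'" unfolding bit_world_cloud by blast
  then have "(x, y') \<in> dia M O lrel M" using xy by blast
  then obtain x' where "(x, x') \<in> lrel M" "(x', y') \<in> dia M"
    using logic_model unfolding logic_model_def by blast
  then show "\<exists>t<2 ^ length w. bit (world_cloud x) t \<and> type_le L w t u"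
    using y' type_le_world_type world_type_less bit_world_cloud by blast
next
  fix t assume not_SSL: "L \<noteq> SSL" and "bit (world_cloud x) t"
  then obtain x' where x': "(x, x') \<in> lrel M" "t = world_type x'" unfolding bit_world_cloud by blast
  then have "(y, x') \<in> (dia M)\<inverse> O lrel M" using xy by blast
  then obtain y' where "(y, y') \<in> lrel M" "(x', y') \<in> dia M"
    using logic_model not_SSL unfolding logic_model_def by blast
  then show "\<exists>u<2 ^ length w. bit (world_cloud y) u \<and> type_le L w t u"
    using x' type_le_world_type world_type_less bit_world_cloud by blast
qed

lemma bit_world_cloud_self: "x \<in> worlds M \<Longrightarrow> bit (world_cloud x) (world_type x)"
  using equiv_lrel by (auto simp: bit_world_cloud equiv_def refl_on_def)

lemma world_cloud_repaired:
  assumes "cloud_flaw w (world_cloud x) d"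
  shows "\<exists>y\<in>worlds M. cloud_reach L w (cloud_key L w (world_cloud x)) (world_cloud y) \<and>
    cloud_repairs L w (world_cloud y) d"
proof -
  let ?t = "d div length w" and ?i = "d mod length w"
  have i: "letter_at w ?i = Some BoxL" "\<not> bit ?t ?i" using assms by (auto simp: cloud_flaw_def)
  obtain x' where x': "(x, x') \<in> lrel M" "?t = world_type x'"
    using assms by (auto simp: cloud_flaw_def bit_world_cloud)
  obtain y where y: "(x', y) \<in> dia M" "\<not> sat M y (subform (Suc ?i))"
    using i x'(2) by (auto simp: bit_world_type starts_letter form_at_eqs)
  then have "cloud_reach L w (cloud_key L w (world_cloud x)) (world_cloud y)"
    unfolding cloud_reach_key_iff world_cloud_cong[OF x'(1)] by (intro succ_cloud_world_cloud)
  moreover have "cloud_repairs L w (world_cloud y) d"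
    unfolding cloud_repairs_def x'(2)
    using y i dia_worlds bit_world_cloud_self type_le_world_type[OF y(1)] world_type_less starts_unary
    by (intro exI[of _ "world_type y"]) (auto simp: bit_world_type)
  ultimately show ?thesis using dia_worlds y(1) by blast
qed

lemma good_world_cloud:
  assumes "x \<in> worlds M"
  shows "good_cloud L w l (world_cloud x)"
  using assms
proof (coinduction arbitrary: x rule: clouds.good.coinduct)
  case (good x)
  show ?case
  proof (rule exI[of _ "world_cloud x"], intro conjI refl allI impI)
    show "world_cloud x < 2 ^ 2 ^ length w" unfolding world_cloud_def by (rule collect_bits_less)
    show "cloud_ok L w l (world_cloud x)" by (rule cloud_ok_world_cloud)
    fix d assume "cloud_flaw w (world_cloud x) d"
    then obtain y where "y \<in> worlds M"
        "cloud_reach L w (cloud_key L w (world_cloud x)) (world_cloud y)"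
        "cloud_repairs L w (world_cloud y) d"
      using world_cloud_repaired by blast
    then show "\<exists>C'. ((\<exists>x. C' = world_cloud x \<and> x \<in> worlds M) \<or> good_cloud L w l C') \<and>
        cloud_reach L w (cloud_key L w (world_cloud x)) C' \<and> cloud_repairs L w C' d"
      by (intro exI[of _ "world_cloud y"]) auto
  qed
qed

lemma in_good_cloud:
  assumes "x \<in> worlds M" "sat M x (subform 0)"
  shows "in_good_cloud L w l"
  unfolding in_good_cloud_def
  using good_world_cloud bit_world_cloud_self assms bit_world_type[OF starts_0] by blast

end

definition frame_of :: "logic \<Rightarrow> 'a set \<Rightarrow> 'a rel \<Rightarrow> bool" where
  "frame_of L W R \<longleftrightarrow> R \<subseteq> W \<times> W \<and> trans R \<and> (L \<noteq> K4_S5 \<longrightarrow> refl_on W R)"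

lemma frame_of_K4: "frame_of K4_S5 = K4_frame"
  by (simp add: fun_eq_iff frame_of_def K4_frame_def)

lemma frame_of_S4: "frame_of S4_S5 = S4_frame"
  by (auto simp: fun_eq_iff frame_of_def S4_frame_def preorder_on_def)

lemma pullback_frame_of: "frame_of L W R \<Longrightarrow> g ` V \<subseteq> W \<Longrightarrow> frame_of L V (pullback g V R)"
  unfolding frame_of_def pullback_def trans_on_def refl_on_def by blast

lemma logic_model_product:
  assumes L: "L \<noteq> SSL" and M: "is_model (product_model W1 R W2 E \<sigma>)"
    and R: "frame_of L W1 R" and E: "equiv W2 E"
  shows "logic_model L (product_model W1 R W2 E \<sigma>)" (is "logic_model L ?M")
proof -
  have sel: "worlds ?M = W1 \<times> W2"
    "((a, b), (a', b')) \<in> dia ?M \<longleftrightarrow> (a, a') \<in> R \<and> b = b' \<and> b \<in> W2"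
    "((a, b), (a', b')) \<in> lrel ?M \<longleftrightarrow> (b, b') \<in> E \<and> a = a' \<and> a \<in> W1" for a b a' b'
    by (auto simp: product_model_def)
  have sub: "R \<subseteq> W1 \<times> W1" "E \<subseteq> W2 \<times> W2" using R E by (auto simp: frame_of_def equiv_def)
  have "trans (dia ?M)" using R by (auto simp: trans_def sel frame_of_def)
  moreover have "equiv (worlds ?M) (lrel ?M)"
  proof (rule equivI)
    show "lrel ?M \<subseteq> worlds ?M \<times> worlds ?M" using M by (simp add: is_model_def)
    show "refl_on (worlds ?M) (lrel ?M)" using E by (auto simp: refl_on_def sel equiv_def)
    show "sym (lrel ?M)" using E by (auto simp: sym_def sel equiv_def)
    show "trans (lrel ?M)" using E by (auto simp: trans_def sel equiv_def)
  qed
  moreover have "dia ?M O lrel ?M \<subseteq> lrel ?M O dia ?M"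
    using sub by (auto simp: relcomp_unfold sel)
  moreover have "(dia ?M)\<inverse> O lrel ?M \<subseteq> lrel ?M O (dia ?M)\<inverse>"
    using sub by (auto simp: relcomp_unfold sel)
  moreover have "L \<noteq> K4_S5 \<longrightarrow> refl_on (worlds ?M) (dia ?M)"
    using R by (auto simp: refl_on_def sel frame_of_def)
  ultimately show ?thesis using L M by (simp add: logic_model_def)
qed

lemma logic_model_cross_axiom:
  assumes "cross_axiom_model M"
  shows "logic_model SSL M"
  using assms unfolding cross_axiom_model_def logic_model_def preorder_on_def relcomp_unfold by blast

section \<open>From good clouds to models\<close>

context parsed
begin

definition labelled_val :: "'w set \<Rightarrow> ('w \<Rightarrow> nat) \<Rightarrow> atom \<Rightarrow> 'w set" where
  "labelled_val X \<tau> A = {x \<in> X. \<exists>i. letter_at w i = Some XL \<and> subform i = Atom A \<and> bit (\<tau> x) i}"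

definition cloud_worlds :: "(nat \<times> nat) set" where
  "cloud_worlds = {x. good_cloud SSL w l (fst x) \<and> bit (fst x) (snd x)}"

definition cloud_model :: "(nat \<times> nat) model" where
  "cloud_model = \<lparr>worlds = cloud_worlds,
     dia = {(x, y) \<in> cloud_worlds \<times> cloud_worlds.
       type_le SSL w (snd x) (snd y) \<and> succ_cloud SSL w (fst x) (fst y)},
     lrel = {(x, y) \<in> cloud_worlds \<times> cloud_worlds. fst x = fst y},
     val = labelled_val cloud_worlds snd\<rparr>"

lemma cloud_model_sel:
  "worlds cloud_model = cloud_worlds"
  "(x, y) \<in> dia cloud_model \<longleftrightarrow> x \<in> cloud_worlds \<and> y \<in> cloud_worlds \<and>
     type_le SSL w (snd x) (snd y) \<and> succ_cloud SSL w (fst x) (fst y)"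
  "(x, y) \<in> lrel cloud_model \<longleftrightarrow> x \<in> cloud_worlds \<and> y \<in> cloud_worlds \<and> fst x = fst y"
  "val cloud_model = labelled_val cloud_worlds snd"
  by (auto simp: cloud_model_def)

lemma cloud_worlds_type_ok: "x \<in> cloud_worlds \<Longrightarrow> type_ok SSL w l (snd x)"
  by (auto simp: cloud_worlds_def good_cloud_type_ok)

lemma succ_cloud_refl: "x \<in> cloud_worlds \<Longrightarrow> succ_cloud SSL w (fst x) (fst x)"
  unfolding succ_cloud_def cloud_worlds_def
  using good_cloud_type_ok type_le_refl[of SSL w l] by blast

lemma is_model_cloud_model: "x \<in> cloud_worlds \<Longrightarrow> is_model cloud_model"
  by (auto simp: is_model_def cloud_model_sel labelled_val_def)

lemma cross_axiom_cloud_model: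
  assumes "x \<in> cloud_worlds"
  shows "cross_axiom_model cloud_model"
  unfolding cross_axiom_model_def
proof (intro conjI allI impI)
  show "is_model cloud_model" by (rule is_model_cloud_model[OF assms])
  show "preorder_on (worlds cloud_model) (dia cloud_model)"
    unfolding preorder_on_def refl_on_def trans_def
    using cloud_worlds_type_ok succ_cloud_refl
    by (auto simp: cloud_model_sel intro: type_le_refl type_le_trans succ_cloud_trans)
  show "equiv (worlds cloud_model) (lrel cloud_model)"
    by (rule equivI) (auto simp: cloud_model_sel refl_on_def sym_def trans_def)
next
  fix x u u' assume "(x, u) \<in> dia cloud_model \<and> (u, u') \<in> lrel cloud_model"
  then have x: "x \<in> cloud_worlds" "u' \<in> cloud_worlds" "succ_cloud SSL w (fst x) (fst u')"
    by (auto simp: cloud_model_sel)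
  then have "snd u' < 2 ^ length w" "bit (fst u') (snd u')"
    using good_cloud_type_less by (auto simp: cloud_worlds_def)
  then obtain t where "bit (fst x) t" "type_le SSL w t (snd u')"
    using x(3) unfolding succ_cloud_def by blast
  then show "\<exists>x'. (x, x') \<in> lrel cloud_model \<and> (x', u') \<in> dia cloud_model"
    using x by (intro exI[of _ "(fst x, t)"]) (auto simp: cloud_model_sel cloud_worlds_def)
next
  fix x y A assume xy: "(x, y) \<in> dia cloud_model"
  then have "bit (snd x) i \<longleftrightarrow> bit (snd y) i" if "letter_at w i = Some XL" for i
    using letter_at_less[OF that] that by (auto simp: cloud_model_sel type_le_def)
  then show "x \<in> val cloud_model A \<longleftrightarrow> y \<in> val cloud_model A"
    using xy by (auto simp: cloud_model_sel labelled_val_def)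
qed

lemma labelled_cloud_model:
  assumes "x \<in> cloud_worlds"
  shows "labelled_model w l SSL cloud_model snd"
proof unfold_locales
  show "is_model cloud_model" by (rule is_model_cloud_model[OF assms])
next
  fix x i assume "x \<in> worlds cloud_model"
  then have x: "good_cloud SSL w l (fst x)" "bit (fst x) (snd x)" "x \<in> cloud_worlds"
    by (simp_all add: cloud_model_sel cloud_worlds_def)
  show "\<exists>y. (x, y) \<in> dia cloud_model \<and> \<not> bit (snd y) (Suc i)"
    if box: "letter_at w i = Some BoxL" "\<not> bit (snd x) i"
  proof -
    obtain C' u where "good_cloud SSL w l C'" "succ_cloud SSL w (fst x) C'" "bit C' u"
        "type_le SSL w (snd x) u" "\<not> bit u (Suc i)"
      using good_cloud_Box[OF x(1,2) box] .
    then show ?thesis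
      using x(3) by (intro exI[of _ "(C', u)"]) (auto simp: cloud_model_sel cloud_worlds_def)
  qed
  show "bit (snd x) i \<longleftrightarrow> (\<forall>y. (x, y) \<in> lrel cloud_model \<longrightarrow> bit (snd y) (Suc i))"
    if "letter_at w i = Some KL"
    unfolding good_cloud_K[OF x(1,2) that] using x by (auto simp: cloud_model_sel cloud_worlds_def)
qed (use cloud_worlds_type_ok in \<open>auto simp: cloud_model_sel labelled_val_def\<close>)

lemma sat_cloud_model:
  assumes "x \<in> cloud_worlds" "starts_formula w i"
  shows "sat cloud_model x (subform i) \<longleftrightarrow> bit (snd x) i"
  using labelled_model.sat_iff_label[OF labelled_cloud_model] assms by (simp add: cloud_model_sel)

lemma SSL_satisfiable_iff: "SSL_satisfiable TYPE('w::infinite) (subform 0) \<longleftrightarrow> in_good_cloud SSL w l"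
proof
  assume "SSL_satisfiable TYPE('w) (subform 0)"
  then obtain M :: "'w model" and x
    where "cross_axiom_model M" and x: "x \<in> worlds M" "sat M x (subform 0)"
    unfolding SSL_satisfiable_def by blast
  from this(1) interpret parsed_model w l SSL M
    by unfold_locales (rule logic_model_cross_axiom)
  show "in_good_cloud SSL w l" by (rule in_good_cloud[OF x])
next
  assume "in_good_cloud SSL w l"
  then obtain x where "x \<in> cloud_worlds" "bit (snd x) 0"
    by (auto simp: in_good_cloud_def cloud_worlds_def)
  then have "SSL_satisfiable TYPE(nat \<times> nat) (subform 0)"
    unfolding SSL_satisfiable_def
    using cross_axiom_cloud_model sat_cloud_model[OF _ starts_0] cloud_model_sel(1) by blast
  then show "SSL_satisfiable TYPE('w) (subform 0)" by (rule SSL_universal)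
qed

end

lemma infinite_fibres_exist:
  fixes X :: "'a set"
  assumes "infinite X" "countable S" "S \<noteq> {}"
  obtains f where "\<And>x. f x \<in> S" "\<And>s. s \<in> S \<Longrightarrow> infinite {x \<in> X. f x = s}"
proof -
  obtain P :: "nat \<Rightarrow> 'a set" where P: "pairwise (\<lambda>i j. disjnt (P i) (P j)) UNIV"
      "(\<Union>k. P k) \<subseteq> X" "\<And>k. infinite (P k)"
    using infinite_infinite_partition[OF assms(1)] by blast
  define f where "f x = from_nat_into S (THE k. x \<in> P k)" for x
  have index: "(THE k. x \<in> P k) = k" if "x \<in> P k" for x k
    using that P(1) by (intro the_equality) (auto simp: pairwise_def disjnt_iff)
  show thesis
  proof (rule that)
    show "f x \<in> S" for x unfolding f_def by (rule from_nat_into[OF assms(3)])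
    fix s assume "s \<in> S"
    then obtain k where "from_nat_into S k = s" using from_nat_into_surj[OF assms(2)] by blast
    then have "P k \<subseteq> {x \<in> X. f x = s}" using P(2) by (auto simp: f_def index)
    then show "infinite {x \<in> X. f x = s}" using P(3) infinite_super by blast
  qed
qed

text \<open>
  The first factor of the product consists of all maps \<open>F\<close> from the second factor \<open>nat\<close> to the types of
  some good cloud that take every type of this cloud infinitely often, ordered pointwise. The infinite
  fibres leave room for passing to an arbitrary successor cloud.
\<close>

locale parsed_product = parsed +
  fixes L :: logic
  assumes not_SSL: "L \<noteq> SSL"
begin

definition thread :: "(nat \<Rightarrow> nat) \<Rightarrow> nat \<Rightarrow> bool" where
  "thread F C \<longleftrightarrow> good_cloud L w l C \<and> (\<forall>x. bit C (F x)) \<and> (\<forall>t. bit C t \<longrightarrow> infinite {x. F x = t})"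

lemma thread_surj:
  assumes "thread F C" "bit C t"
  obtains x where "F x = t"
proof -
  have "{x. F x = t} \<noteq> {}" using assms unfolding thread_def by (metis finite.emptyI)
  then show ?thesis using that by blast
qed

lemma thread_exists:
  assumes C: "good_cloud L w l C" and t: "bit C t"
  obtains F x where "thread F C" "F x = t"
proof -
  have "{t. bit C t} \<noteq> {}" using t by blast
  then obtain F :: "nat \<Rightarrow> nat" where "\<And>x. F x \<in> {t. bit C t}"
      "\<And>s. s \<in> {t. bit C t} \<Longrightarrow> infinite {x \<in> UNIV. F x = s}"
    using infinite_fibres_exist[OF infinite_UNIV_nat countableI_type] by metis
  then have F: "thread F C" using C by (simp add: thread_def)
  obtain x where "F x = t" using thread_surj[OF F t] .
  with F show ?thesis by (rule that)
qed

lemma thread_succ: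
  assumes F: "thread F C" and C': "good_cloud L w l C'" "succ_cloud L w C C'"
    and u: "bit C' u" "type_le L w (F x) u"
  obtains F' where "thread F' C'" "\<And>y. type_le L w (F y) (F' y)" "F' x = u"
proof -
  define S where "S s = {t. bit C' t \<and> type_le L w s t}" for s
  have C: "good_cloud L w l C" "bit C (F y)" for y using F by (simp_all add: thread_def)
  have "\<exists>f. (\<forall>y. f y \<in> S s) \<and> (\<forall>t\<in>S s. infinite {y \<in> {y. F y = s}. f y = t})" if s: "bit C s" for s
  proof -
    have "S s \<noteq> {}"
      using C'(2) s not_SSL good_cloud_type_less[OF C(1) s] unfolding succ_cloud_def S_def by blast
    moreover have "infinite {y. F y = s}" using F s by (simp add: thread_def)
    ultimately show ?thesis using infinite_fibres_exist[OF _ countableI_type] by metis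
  qed
  then obtain f where f: "\<And>s y. bit C s \<Longrightarrow> f s y \<in> S s"
    "\<And>s t. bit C s \<Longrightarrow> t \<in> S s \<Longrightarrow> infinite {y \<in> {y. F y = s}. f s y = t}" by metis
  define F' where "F' y = (if y = x then u else f (F y) y)" for y
  have F'_in: "F' y \<in> S (F y)" for y using f(1)[OF C(2)] u by (auto simp: F'_def S_def)
  have "infinite {y. F' y = t}" if t: "bit C' t" for t
  proof -
    obtain s where s: "bit C s" "type_le L w s t"
      using C'(2) good_cloud_type_less[OF C'(1) t] t unfolding succ_cloud_def by blast
    have "infinite ({y \<in> {y. F y = s}. f s y = t} - {x})"
      using f(2)[OF s(1)] t s(2) by (simp add: S_def)
    moreover have "{y \<in> {y. F y = s}. f s y = t} - {x} \<subseteq> {y. F' y = t}" by (auto simp: F'_def)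
    ultimately show ?thesis using infinite_super by blast
  qed
  then have "thread F' C'" using C'(1) F'_in by (auto simp: thread_def S_def)
  then show ?thesis using that F'_in by (auto simp: S_def F'_def)
qed

definition threads :: "(nat \<Rightarrow> nat) set" where
  "threads = {F. \<exists>C. thread F C}"

definition thread_order :: "(nat \<Rightarrow> nat) rel" where
  "thread_order = {(F, F') \<in> threads \<times> threads. \<forall>x. type_le L w (F x) (F' x)}"

definition thread_model :: "((nat \<Rightarrow> nat) \<times> nat) model" where
  "thread_model = product_model threads thread_order UNIV UNIV
     (labelled_val (threads \<times> UNIV) (\<lambda>(F, x). F x))"

lemma thread_model_sel:
  "worlds thread_model = threads \<times> UNIV"
  "((F, x), (F', x')) \<in> dia thread_model \<longleftrightarrow> (F, F') \<in> thread_order \<and> x = x'"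
  "((F, x), (F', x')) \<in> lrel thread_model \<longleftrightarrow> F = F' \<and> F \<in> threads"
  "val thread_model = labelled_val (threads \<times> UNIV) (\<lambda>(F, x). F x)"
  by (auto simp: thread_model_def product_model_def)

lemma threads_type_ok: "F \<in> threads \<Longrightarrow> type_ok L w l (F x)"
  by (auto simp: threads_def thread_def good_cloud_type_ok)

lemma frame_of_threads: "frame_of L threads thread_order"
  unfolding frame_of_def trans_def refl_on_def thread_order_def
  using threads_type_ok type_le_refl type_le_trans by blast

lemma is_model_thread_model: "F \<in> threads \<Longrightarrow> is_model thread_model"
  by (auto simp: is_model_def thread_model_sel labelled_val_def thread_order_def)

lemma labelled_thread_model:
  assumes "F \<in> threads"
  shows "labelled_model w l L thread_model (\<lambda>(F, x). F x)"
proof unfold_locales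
  show "is_model thread_model" by (rule is_model_thread_model[OF assms])
next
  fix v i assume "v \<in> worlds thread_model"
  then obtain G y C where v: "v = (G, y)" "thread G C" "G \<in> threads"
    by (cases v) (auto simp: thread_model_sel threads_def)
  have C: "good_cloud L w l C" "bit C (G y)" using v(2) by (simp_all add: thread_def)
  show "\<exists>v'. (v, v') \<in> dia thread_model \<and> \<not> bit ((\<lambda>(F, x). F x) v') (Suc i)"
    if box: "letter_at w i = Some BoxL" "\<not> bit ((\<lambda>(F, x). F x) v) i"
  proof -
    obtain C' u where u: "good_cloud L w l C'" "succ_cloud L w C C'" "bit C' u"
        "type_le L w (G y) u" "\<not> bit u (Suc i)"
      using good_cloud_Box[OF C box(1)] box(2) v(1) by auto
    obtain G' where "thread G' C'" "\<And>z. type_le L w (G z) (G' z)" "G' y = u"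
      using thread_succ[OF v(2) u(1-4)] by blast
    then show ?thesis
      using v u(5)
      by (intro exI[of _ "(G', y)"]) (auto simp: thread_model_sel thread_order_def threads_def)
  qed
  have "bit C t \<longleftrightarrow> (\<exists>z. G z = t)" for t
    using v(2) thread_surj by (metis thread_def)
  then show "bit ((\<lambda>(F, x). F x) v) i \<longleftrightarrow>
      (\<forall>v'. (v, v') \<in> lrel thread_model \<longrightarrow> bit ((\<lambda>(F, x). F x) v') (Suc i))"
    if "letter_at w i = Some KL"
    using good_cloud_K[OF C that] v by (auto simp: thread_model_sel)
qed (use threads_type_ok in
    \<open>auto simp: thread_model_sel labelled_val_def thread_order_def split: prod.splits\<close>)

lemma sat_thread_model:
  assumes "F \<in> threads" "starts_formula w i"
  shows "sat thread_model (F, x) (subform i) \<longleftrightarrow> bit (F x) i"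
  using labelled_model.sat_iff_label[OF labelled_thread_model] assms by (simp add: thread_model_sel)

lemma product_satisfiable_iff:
  "product_satisfiable (frame_of L :: 'a::infinite set \<Rightarrow> _) TYPE('b::infinite) (subform 0) \<longleftrightarrow>
     in_good_cloud L w l"
proof
  assume "product_satisfiable (frame_of L :: 'a set \<Rightarrow> _) TYPE('b) (subform 0)"
  then obtain W1 R and W2 :: "'b set" and E \<sigma> x where
    frames: "frame_of L (W1 :: 'a set) R" "equiv W2 E" and M: "is_model (product_model W1 R W2 E \<sigma>)"
    and x: "x \<in> worlds (product_model W1 R W2 E \<sigma>)" "sat (product_model W1 R W2 E \<sigma>) x (subform 0)"
    unfolding product_satisfiable_def S5_frame_def by blast
  interpret parsed_model w l L "product_model W1 R W2 E \<sigma>"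
    by unfold_locales (rule logic_model_product[OF not_SSL M frames])
  show "in_good_cloud L w l" by (rule in_good_cloud[OF x])
next
  assume "in_good_cloud L w l"
  then obtain F C x where F: "thread F C" "bit (F x) 0"
    unfolding in_good_cloud_def using thread_exists by metis
  then have "F \<in> threads" by (auto simp: threads_def)
  then have "is_model thread_model" "(F, x) \<in> worlds thread_model"
      "sat thread_model (F, x) (subform 0)"
    using F(2) is_model_thread_model sat_thread_model[OF _ starts_0] by (simp_all add: thread_model_sel)
  moreover have "S5_frame (UNIV :: nat set) UNIV"
    by (auto simp: S5_frame_def equiv_def refl_on_def sym_def trans_def)
  ultimately have "product_satisfiable (frame_of L :: (nat \<Rightarrow> nat) set \<Rightarrow> _) TYPE(nat) (subform 0)"
    unfolding product_satisfiable_def thread_model_def using frame_of_threads by blast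
  then show "product_satisfiable (frame_of L :: 'a set \<Rightarrow> _) TYPE('b) (subform 0)"
    by (rule product_universal[rotated]) (rule pullback_frame_of)
qed

end

section \<open>The decision procedure\<close>

definition space_bound :: "letter list \<Rightarrow> nat" where
  "space_bound w = 2 ^ (length w * 4 ^ length w)"

definition string_in_scope :: "'e scope \<Rightarrow> ('e \<Rightarrow> letter list) \<Rightarrow> bool" where
  "string_in_scope \<Gamma> w \<longleftrightarrow> linspace \<Gamma> (\<lambda>e. num_val (w e)) \<and> polybounded \<Gamma> (\<lambda>e. space_bound (w e))"

lemma string_in_scope_weaken:
  "string_in_scope \<Gamma> w \<Longrightarrow> string_in_scope (add_arg \<Gamma>) (\<lambda>x. w (fst x))"
  unfolding string_in_scope_def
  by (auto intro: linspace_weaken[of _ "\<lambda>e. num_val (w e)"]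
      polybounded_weaken[of _ "\<lambda>e. space_bound (w e)"])

definition digit_at :: "nat \<Rightarrow> nat \<Rightarrow> nat" where
  "digit_at v i = (if ((\<lambda>u. (u - 1) div 9) ^^ i) v = 0 then 0
     else (((\<lambda>u. (u - 1) div 9) ^^ i) v - 1) mod 9 + 1)"

lemma num_val_Cons_div_mod:
  "(num_val (d # ds) - 1) div 9 = num_val ds"
  "(num_val (d # ds) - 1) mod 9 = digit_val d - 1"
proof -
  have "num_val (d # ds) - 1 = num_val ds * 9 + (digit_val d - 1)"
    using digit_val_bounds(1)[of d] by simp
  moreover have "digit_val d - 1 < 9" using digit_val_bounds[of d] by simp
  ultimately show "(num_val (d # ds) - 1) div 9 = num_val ds"
    "(num_val (d # ds) - 1) mod 9 = digit_val d - 1"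
    by (simp_all only: digit_div_mod)
qed

lemma funpow_drop_digit: "((\<lambda>u. (u - 1) div 9) ^^ i) (num_val w) = num_val (drop i w)"
proof (induction i)
  case (Suc i)
  have "(num_val ds - 1) div 9 = num_val (tl ds)" for ds
    by (cases ds) (simp, simp only: num_val_Cons_div_mod list.sel)
  then show ?case using Suc by (simp add: tl_drop drop_Suc)
qed simp

definition letter_code :: "letter option \<Rightarrow> nat" where
  "letter_code x = (case x of None \<Rightarrow> 0 | Some a \<Rightarrow> digit_val a)"

lemma letter_code_inject: "letter_code x = letter_code y \<longleftrightarrow> x = y"
  by (auto simp: letter_code_def digit_val_inject split: option.splits)

lemma digit_at_num_val: "digit_at (num_val w) i = letter_code (letter_at w i)"
proof (cases "i < length w")
  case True
  then have drop_eq: "drop i w = w ! i # drop (Suc i) w" by (simp add: Cons_nth_drop_Suc)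
  have "num_val (drop i w) \<noteq> 0" using True by simp
  moreover have "(num_val (drop i w) - 1) mod 9 + 1 = digit_val (w ! i)"
    unfolding drop_eq num_val_Cons_div_mod by (simp add: Suc_leI)
  ultimately show ?thesis
    using True
    by (simp only: digit_at_def funpow_drop_digit letter_at_def letter_code_def) simp
qed (simp only: digit_at_def funpow_drop_digit letter_at_def letter_code_def, simp)

lemma linspace_digit_at:
  assumes v: "linspace \<Gamma> v" and i: "linspace \<Gamma> i"
  shows "linspace \<Gamma> (\<lambda>e. digit_at (v e) (i e))"
proof -
  have funpow_le: "((\<lambda>u. (u - 1) div 9) ^^ j) x \<le> x" for x j :: nat
    by (induction j) (auto intro: order_trans[OF div_le_dividend])
  have "linspace \<Gamma> (\<lambda>e. ((\<lambda>u. (u - 1) div 9) ^^ i e) (v e))"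
    by (rule linspace_funpow[OF i v _ polybounded_linspace[OF v] funpow_le]) (intro linspace_intros)
  then show ?thesis unfolding digit_at_def by (intro linspace_intros)
qed

lemma linspace_letter_code:
  assumes "string_in_scope \<Gamma> w" "linspace \<Gamma> i"
  shows "linspace \<Gamma> (\<lambda>e. letter_code (letter_at (w e) (i e)))"
  using linspace_digit_at[of \<Gamma> "\<lambda>e. num_val (w e)" i] assms
  by (simp add: digit_at_num_val string_in_scope_def)

lemma linspace_pred_letter_at:
  assumes "string_in_scope \<Gamma> w" "linspace \<Gamma> i"
  shows "linspace_pred \<Gamma> (\<lambda>e. letter_at (w e) (i e) = Some a)"
  using linspace_pred_eq[OF linspace_letter_code[OF assms] linspace_const[of _ "letter_code (Some a)"]]
  by (simp add: letter_code_inject)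

lemma linspace_pred_letter_at_eq:
  assumes w: "string_in_scope \<Gamma> w" and "linspace \<Gamma> i" "linspace \<Gamma> j"
  shows "linspace_pred \<Gamma> (\<lambda>e. letter_at (w e) (i e) = letter_at (w e) (j e))"
  using linspace_pred_eq[OF assms(2,3)[THEN linspace_letter_code[OF w]]]
  by (simp add: letter_code_inject)

lemma linspace_length:
  assumes "string_in_scope \<Gamma> w"
  shows "linspace \<Gamma> (\<lambda>e. length (w e))"
proof -
  have v: "linspace \<Gamma> (\<lambda>e. num_val (w e))" using assms by (simp add: string_in_scope_def)
  have "linspace \<Gamma> (\<lambda>e. card {i. i < num_val (w e) \<and> digit_at (num_val (w e)) i \<noteq> 0})"
    by (intro linspace_card linspace_intros linspace_digit_at v)
  moreover have "{i. i < num_val u \<and> digit_at (num_val u) i \<noteq> 0} = {..<length u}" for u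
    using length_le_num_val[of u]
    by (auto simp: digit_at_num_val letter_at_def letter_code_def split: if_splits)
  ultimately show ?thesis by simp
qed

lemma linspace_length_table:
  assumes w: "string_in_scope \<Gamma> w" and c: "linspace \<Gamma> c" and i: "linspace \<Gamma> i"
  shows "linspace \<Gamma> (\<lambda>e. length_table (w e) (c e) (i e))"
proof -
  have funpow_eq: "((\<lambda>u. u div y) ^^ j) x = x div y ^ j" for x y j :: nat
    by (induction j) (simp_all add: div_mult2_eq[symmetric] mult.commute)
  have "linspace \<Gamma> (\<lambda>e. ((\<lambda>u. u div Suc (length (w e))) ^^ i e) (c e))"
  proof (rule linspace_funpow[OF i c _ polybounded_linspace[OF c]])
    show "linspace (add_arg \<Gamma>) (\<lambda>x. snd x div Suc (length (w (fst x))))"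
      by (intro linspace_intros linspace_length string_in_scope_weaken w)
  qed (simp add: funpow_eq)
  then have "linspace \<Gamma> (\<lambda>e. c e div Suc (length (w e)) ^ i e)" unfolding funpow_eq .
  then show ?thesis
    unfolding length_table_def by (rule linspace_mod[OF _ linspace_Suc[OF linspace_length[OF w]]])
qed

lemma polybounded_power2_length:
  assumes w: "string_in_scope \<Gamma> w" and E: "\<And>n. E n \<le> k * (n * 4 ^ n) + k"
  shows "polybounded \<Gamma> (\<lambda>e. 2 ^ E (length (w e)))"
proof (rule polybounded_mono)
  show "polybounded \<Gamma> (\<lambda>e. 2 ^ k * space_bound (w e) ^ k)"
    using w unfolding string_in_scope_def
    by (intro polybounded_mult polybounded_const polybounded_power) simp
  fix e
  have "(2 :: nat) ^ E (length (w e)) \<le> 2 ^ (k * (length (w e) * 4 ^ length (w e)) + k)"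
    by (rule power_increasing[OF E]) simp
  also have "\<dots> = 2 ^ k * space_bound (w e) ^ k"
    by (simp add: space_bound_def power_add mult.commute flip: power_mult)
  finally show "2 ^ E (length (w e)) \<le> 2 ^ k * space_bound (w e) ^ k" .
qed

definition stack_base_exponent :: "nat \<Rightarrow> nat" where
  "stack_base_exponent n = 2 ^ n * n + 2 * 2 ^ n + 1"

definition stack_bound_exponent :: "nat \<Rightarrow> nat" where
  "stack_bound_exponent n = stack_base_exponent n * (3 * Suc (2 * 2 ^ n) + 1)"

lemma exponent_bounds:
  "n \<le> 1 * (n * 4 ^ n) + 1" "2 ^ n \<le> 1 * (n * 4 ^ n) + 1" "2 ^ n * n \<le> 1 * (n * 4 ^ n) + 1"
  "2 * 2 ^ n \<le> 2 * (n * 4 ^ n) + 2" "stack_base_exponent n \<le> 4 * (n * 4 ^ n) + 4"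
  "stack_bound_exponent n \<le> 40 * (n * 4 ^ n) + 40"
proof -
  have two_le_four: "(2 :: nat) ^ n \<le> 4 ^ n" by (rule power_mono) auto
  then have "2 ^ n * n \<le> 4 ^ n * n" by (rule mult_right_mono) simp
  moreover have "n * 1 \<le> n * 4 ^ n" by (rule mult_left_mono) auto
  ultimately have small: "n \<le> n * 4 ^ n" "2 ^ n * n \<le> n * 4 ^ n" "(2 :: nat) ^ n \<le> 4 ^ n"
    using two_le_four by (simp_all only: mult.commute mult_1_right)
  have four_power: "4 ^ n \<le> n * 4 ^ n + 1" by (cases n) auto
  show "n \<le> 1 * (n * 4 ^ n) + 1" "2 ^ n \<le> 1 * (n * 4 ^ n) + 1" "2 ^ n * n \<le> 1 * (n * 4 ^ n) + 1"
    "2 * 2 ^ n \<le> 2 * (n * 4 ^ n) + 2" "stack_base_exponent n \<le> 4 * (n * 4 ^ n) + 4"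
    unfolding stack_base_exponent_def using small four_power by linarith+
  have "2 ^ n * 2 ^ n = (4 :: nat) ^ n" by (simp flip: power_mult_distrib)
  then have "stack_bound_exponent n = 6 * (n * 4 ^ n) + 12 * 4 ^ n + 14 * 2 ^ n +
      4 * (2 ^ n * n) + 4"
    by (simp add: stack_bound_exponent_def stack_base_exponent_def algebra_simps)
  also have "\<dots> \<le> 40 * (n * 4 ^ n) + 40" using small four_power by linarith
  finally show "stack_bound_exponent n \<le> 40 * (n * 4 ^ n) + 40" .
qed

context
  fixes \<Gamma> :: "'e scope" and w :: "'e \<Rightarrow> letter list"
  assumes w: "string_in_scope \<Gamma> w"
begin

lemma linspace_power2_length: "linspace \<Gamma> (\<lambda>e. 2 ^ length (w e))"
  using linspace_length[OF w] polybounded_power2_length[OF w exponent_bounds(1)]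
  by (rule linspace_power2)

lemma linspace_stack_base_exponent: "linspace \<Gamma> (\<lambda>e. stack_base_exponent (length (w e)))"
  unfolding stack_base_exponent_def
  by (intro linspace_intros linspace_power2_length linspace_length w)

lemma linspace_power2_exponents:
  "linspace \<Gamma> (\<lambda>e. 2 ^ 2 ^ length (w e))"
  "linspace \<Gamma> (\<lambda>e. 2 ^ (2 ^ length (w e) * length (w e)))"
  "linspace \<Gamma> (\<lambda>e. 2 ^ stack_base_exponent (length (w e)))"
  "linspace \<Gamma> (\<lambda>e. 2 ^ stack_bound_exponent (length (w e)))"
  unfolding stack_bound_exponent_def
  by (intro linspace_power2 linspace_intros linspace_stack_base_exponent linspace_power2_length
      linspace_length w
      exponent_bounds(2,3,5)[THEN polybounded_power2_length[OF w]]
      exponent_bounds(6)[unfolded stack_bound_exponent_def, THEN polybounded_power2_length[OF w]])+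

lemma linspace_collect_bits_length:
  assumes "linspace_pred (add_arg \<Gamma>) (\<lambda>x. P (fst x) (snd x))"
  shows "linspace \<Gamma> (\<lambda>e. collect_bits (2 ^ length (w e) * length (w e)) (P e))"
    and "linspace \<Gamma> (\<lambda>e. collect_bits (2 * 2 ^ length (w e)) (P e))"
  by (intro linspace_collect_bits linspace_intros linspace_power2_length linspace_length w assms
      exponent_bounds(3,4)[THEN polybounded_power2_length[OF w]])+

end

lemmas linspace_string_intros =
  linspace_pred_letter_at linspace_pred_letter_at_eq linspace_length_table
  linspace_power2_length linspace_length linspace_power2_exponents linspace_intros
  string_in_scope_weaken

lemma linspace_pred_parses:
  assumes "string_in_scope \<Gamma> w" "linspace \<Gamma> c"
  shows "linspace_pred \<Gamma> (\<lambda>e. parses (w e) (length_table (w e) (c e)))"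
  unfolding parses_def parse_ok_def starts_formula_def right_at_def
  by (intro linspace_string_intros assms)

lemma linspace_pred_type_le:
  assumes "string_in_scope \<Gamma> w" "linspace \<Gamma> t" "linspace \<Gamma> u"
  shows "linspace_pred \<Gamma> (\<lambda>e. type_le L (w e) (t e) (u e))"
  unfolding type_le_def by (intro linspace_string_intros assms)

lemma linspace_pred_type_ok:
  assumes "string_in_scope \<Gamma> w" "linspace \<Gamma> c" "linspace \<Gamma> t"
  shows "linspace_pred \<Gamma> (\<lambda>e. type_ok L (w e) (length_table (w e) (c e)) (t e))"
  unfolding type_ok_def right_at_def same_atom_def by (intro linspace_string_intros assms)

lemma linspace_pred_cloud_ok:
  assumes "string_in_scope \<Gamma> w" "linspace \<Gamma> c" "linspace \<Gamma> C"
  shows "linspace_pred \<Gamma> (\<lambda>e. cloud_ok L (w e) (length_table (w e) (c e)) (C e))"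
  unfolding cloud_ok_def by (intro linspace_pred_type_ok linspace_string_intros assms)

lemma linspace_cloud_key:
  assumes "string_in_scope \<Gamma> w" "linspace \<Gamma> C"
  shows "linspace \<Gamma> (\<lambda>e. cloud_key L (w e) (C e))"
  unfolding cloud_key_def
  by (intro linspace_collect_bits_length linspace_pred_type_le linspace_string_intros assms)

lemma linspace_pred_cloud_reach:
  assumes "string_in_scope \<Gamma> w" "linspace \<Gamma> k" "linspace \<Gamma> C"
  shows "linspace_pred \<Gamma> (\<lambda>e. cloud_reach L (w e) (k e) (C e))"
  unfolding cloud_reach_def by (intro linspace_pred_type_le linspace_string_intros assms)

lemma linspace_pred_cloud_flaw:
  assumes "string_in_scope \<Gamma> w" "linspace \<Gamma> C" "linspace \<Gamma> d"
  shows "linspace_pred \<Gamma> (\<lambda>e. cloud_flaw (w e) (C e) (d e))"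
  unfolding cloud_flaw_def by (intro linspace_string_intros assms)

lemma linspace_pred_cloud_repairs:
  assumes "string_in_scope \<Gamma> w" "linspace \<Gamma> C" "linspace \<Gamma> d"
  shows "linspace_pred \<Gamma> (\<lambda>e. cloud_repairs L (w e) (C e) (d e))"
  unfolding cloud_repairs_def by (intro linspace_pred_type_le linspace_string_intros assms)

lemmas linspace_cloud_intros =
  linspace_pred_cloud_ok linspace_cloud_key linspace_pred_cloud_reach linspace_pred_cloud_flaw
  linspace_pred_cloud_repairs linspace_string_intros

lemma linspace_pred_child:
  assumes "string_in_scope \<Gamma> w" "linspace \<Gamma> c" "linspace \<Gamma> k" "linspace \<Gamma> C"
  shows "linspace_pred \<Gamma> (\<lambda>e. clouds.child (w e) L (length_table (w e) (c e)) (k e) (C e))"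
  unfolding clouds.child_def by (intro linspace_cloud_intros assms)

lemma linspace_collect:
  assumes "string_in_scope \<Gamma> w" "linspace \<Gamma> C" "linspace \<Gamma> acc" "linspace \<Gamma> v"
  shows "linspace \<Gamma> (\<lambda>e. clouds.collect (w e) L (k e) (C e) (acc e) (v e))"
  unfolding clouds.collect_def by (intro linspace_collect_bits_length linspace_cloud_intros assms)

lemma linspace_close:
  assumes "string_in_scope \<Gamma> w" "linspace \<Gamma> c" "linspace \<Gamma> k" "linspace \<Gamma> acc"
  shows "linspace \<Gamma> (\<lambda>e. clouds.close (w e) L (length_table (w e) (c e)) (k e) (acc e))"
  unfolding clouds.close_def clouds.closed_def
  by (intro linspace_collect_bits_length linspace_cloud_intros assms)

definition cloud_step :: "logic \<Rightarrow> letter list \<Rightarrow> (nat \<Rightarrow> nat) \<Rightarrow> nat \<Rightarrow> nat" where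
  "cloud_step L w l = stack_machine.num_step (2 ^ 2 ^ length w) (clouds.child w L l) (cloud_key L w)
     (clouds.collect w L) (clouds.close w L l) (2 ^ stack_base_exponent (length w))"

definition cloud_start :: "logic \<Rightarrow> letter list \<Rightarrow> nat \<Rightarrow> nat" where
  "cloud_start L w C =
     (let A = 2 ^ stack_base_exponent (length w)
      in stack_machine.push_frame A (cloud_key L w C) 0 0 0 * A)"

lemma linspace_cloud_step:
  assumes "string_in_scope \<Gamma> w" "linspace \<Gamma> c" "linspace \<Gamma> x"
  shows "linspace \<Gamma> (\<lambda>e. cloud_step L (w e) (length_table (w e) (c e)) (x e))"
  unfolding cloud_step_def stack_machine.num_step_def stack_machine.push_frame_def Let_def
  by (intro linspace_pred_child linspace_collect linspace_close linspace_cloud_intros assms)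

lemma linspace_cloud_start:
  assumes "string_in_scope \<Gamma> w" "linspace \<Gamma> C"
  shows "linspace \<Gamma> (\<lambda>e. cloud_start L (w e) (C e))"
  unfolding cloud_start_def stack_machine.push_frame_def Let_def
  by (intro linspace_cloud_intros assms)

lemma stack_base_greater:
  "2 ^ 2 ^ n < (2 :: nat) ^ stack_base_exponent n"
  "2 ^ (2 * 2 ^ n) < (2 :: nat) ^ stack_base_exponent n"
  "2 ^ (2 ^ n * n) < (2 :: nat) ^ stack_base_exponent n"
  unfolding stack_base_exponent_def by (rule power_strict_increasing; simp)+

lemma power_stack_bound_exponent:
  "(2 ^ stack_base_exponent n) ^ (3 * Suc (2 * 2 ^ n) + 1) = (2 :: nat) ^ stack_bound_exponent n"
  unfolding stack_bound_exponent_def by (rule power_mult[symmetric])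

lemma funpow_cloud_step:
  "(cloud_step L w l ^^ t) (cloud_start L w C) = stack_machine.num_run (2 ^ 2 ^ length w)
     (clouds.child w L l) (cloud_key L w) (clouds.collect w L) (clouds.close w L l)
     (2 ^ stack_base_exponent (length w)) t (cloud_key L w C)"
  by (simp add: stack_machine.num_run_def cloud_step_def cloud_start_def Let_def)

lemma funpow_cloud_step_less:
  "(cloud_step L w l ^^ t) (cloud_start L w C) < 2 ^ stack_bound_exponent (length w)"
  using clouds.num_run_key_less[OF stack_base_greater]
  unfolding funpow_cloud_step power_stack_bound_exponent .

lemma good_cloud_iff_run:
  "good_cloud L w l C \<longleftrightarrow> C < 2 ^ 2 ^ length w \<and> cloud_ok L w l C \<and>
    (\<forall>d<2 ^ length w * length w. cloud_flaw w C d \<longrightarrow>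
       bit ((cloud_step L w l ^^ 2 ^ stack_bound_exponent (length w)) (cloud_start L w C) - 1) d)"
  using clouds.good_iff_num_run[OF stack_base_greater]
  unfolding funpow_cloud_step power_stack_bound_exponent .

lemma linspace_cloud_run:
  assumes w: "string_in_scope \<Gamma> w" and "linspace \<Gamma> c" "linspace \<Gamma> C"
  shows "linspace \<Gamma> (\<lambda>e. (cloud_step L (w e) (length_table (w e) (c e)) ^^
    2 ^ stack_bound_exponent (length (w e))) (cloud_start L (w e) (C e)))"
proof (rule linspace_funpow)
  show "polybounded \<Gamma> (\<lambda>e. 2 ^ stack_bound_exponent (length (w e)))"
    by (rule polybounded_power2_length[OF w exponent_bounds(6)])
qed (intro linspace_cloud_start linspace_cloud_step linspace_string_intros assms less_imp_le
    funpow_cloud_step_less)+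

lemma linspace_pred_good_cloud:
  assumes "string_in_scope \<Gamma> w" "linspace \<Gamma> c" "linspace \<Gamma> C"
  shows "linspace_pred \<Gamma> (\<lambda>e. good_cloud L (w e) (length_table (w e) (c e)) (C e))"
  unfolding good_cloud_iff_run by (intro linspace_cloud_run linspace_cloud_intros assms)

lemma in_good_cloud_iff_bounded:
  "in_good_cloud L w l \<longleftrightarrow>
    (\<exists>C<2 ^ 2 ^ length w. good_cloud L w l C \<and> (\<exists>t<2 ^ length w. bit C t \<and> bit t 0))"
  unfolding in_good_cloud_def using good_cloud_less good_cloud_type_less by blast

lemma linspace_pred_in_good_cloud:
  assumes "string_in_scope \<Gamma> w" "linspace \<Gamma> c"
  shows "linspace_pred \<Gamma> (\<lambda>e. in_good_cloud L (w e) (length_table (w e) (c e)))"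
  unfolding in_good_cloud_iff_bounded
  by (intro linspace_pred_good_cloud linspace_string_intros assms)

lemma form_strings_eq:
  assumes S: "\<And>w l. parses w l \<Longrightarrow> S (form_at w l 0) \<longleftrightarrow> in_good_cloud L w l"
  shows "w \<in> {form_string \<phi> |\<phi>. S \<phi>} \<longleftrightarrow> (\<exists>c<2 ^ (2 ^ length w * length w).
    parses w (length_table w c) \<and> in_good_cloud L w (length_table w c))"
proof -
  have "Suc (length w) \<le> 2 ^ 2 ^ length w"
    using less_exp[of "length w"] less_exp[of "2 ^ length w"] by linarith
  then have "Suc (length w) ^ length w \<le> (2 ^ 2 ^ length w) ^ length w" by (rule power_mono) simp
  then have "Suc (length w) ^ length w \<le> 2 ^ (2 ^ length w * length w)" by (simp only: power_mult)
  note parse = eq_form_string_iff[OF this]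
  have "w \<in> {form_string \<phi> |\<phi>. S \<phi>} \<longleftrightarrow> (\<exists>\<phi>. w = form_string \<phi> \<and> S \<phi>)" by blast
  also have "\<dots> \<longleftrightarrow> (\<exists>c<2 ^ (2 ^ length w * length w).
      parses w (length_table w c) \<and> S (form_at w (length_table w c) 0))"
    unfolding parse by blast
  also have "\<dots> \<longleftrightarrow> (\<exists>c<2 ^ (2 ^ length w * length w).
      parses w (length_table w c) \<and> in_good_cloud L w (length_table w c))"
    using S by blast
  finally show ?thesis .
qed

theorem DSPACE_if_in_good_cloud:
  assumes S: "\<And>w l. parses w l \<Longrightarrow> S (form_at w l 0) \<longleftrightarrow> in_good_cloud L w l"
    and f: "(\<lambda>n. real n * 2 ^ (2 * n)) \<in> O(f)"
  shows "{form_string \<phi> |\<phi>. S \<phi>} \<in> DSPACE f"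
proof (rule linspace_pred_DSPACE)
  have scope: "string_in_scope (space_bound, [num_val]) (\<lambda>w. w)"
    using polybounded_bound[of "(space_bound, [num_val])"]
    by (simp add: string_in_scope_def linspace_arg)
  have "linspace_pred (space_bound, [num_val]) (\<lambda>w. \<exists>c<2 ^ (2 ^ length w * length w).
      parses w (length_table w c) \<and> in_good_cloud L w (length_table w c))"
    by (intro linspace_pred_parses linspace_pred_in_good_cloud linspace_string_intros scope)
  then show "linspace_pred (space_bound, [num_val]) (\<lambda>w. w \<in> {form_string \<phi> |\<phi>. S \<phi>})"
    by (rule linspace_pred_cong) (rule form_strings_eq[OF S, symmetric])
  show "space_bound w \<le> 2 ^ (4 * (length w * 4 ^ length w))" for w
    unfolding space_bound_def by (rule power_increasing) auto
  have four: "real (4 * (n * 4 ^ n)) = 4 * (real n * 2 ^ (2 * n))" for n by (simp add: power_mult)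
  show "(\<lambda>n. real (4 * (n * 4 ^ n))) \<in> O(f)" unfolding four using f by simp
  have "(\<lambda>_. 1) \<in> O(\<lambda>n. real n * 2 ^ (2 * n))"
  proof (rule landau_o.big_mono)
    show "\<forall>\<^sub>F n in sequentially. norm (1::real) \<le> norm (real n * 2 ^ (2 * n))"
      using eventually_ge_at_top[of "1::nat"]
    proof eventually_elim
      case (elim n)
      have "1 * 1 \<le> real n * 2 ^ (2 * n)" by (rule mult_mono) (use elim in auto)
      then show ?case by simp
    qed
  qed
  then show "(\<lambda>_. 1) \<in> O(f)" using f by (rule landau_o.big_trans)
qed simp

theorem theorem3p1:
  shows "K4_S5_SAT TYPE('a::infinite) TYPE('b::infinite) \<in> DSPACE (\<lambda>n. real n * 2 ^ (3 * n)) \<and>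
    S4_S5_SAT TYPE('a) TYPE('b) \<in> DSPACE (\<lambda>n. real n * 2 ^ (2 * n)) \<and>
    SSL_SAT TYPE('w::infinite) \<in> DSPACE (\<lambda>n. real n * 2 ^ (2 * n))"
proof (intro conjI)
  have product:
    "product_satisfiable (frame_of L :: 'a set \<Rightarrow> _) TYPE('b) (form_at w l 0) \<longleftrightarrow> in_good_cloud L w l"
    if "L \<noteq> SSL" "parses w l" for L w l
    by (rule parsed_product.product_satisfiable_iff)
      (simp add: that parsed_product_def parsed_def parsed_product_axioms_def)
  have "(\<lambda>n. real n * 2 ^ (2 * n)) \<in> O(\<lambda>n. real n * 2 ^ (3 * n))"
    by (intro landau_o.big_mono always_eventually allI) (auto intro!: mult_left_mono power_increasing)
  then show "K4_S5_SAT TYPE('a) TYPE('b) \<in> DSPACE (\<lambda>n. real n * 2 ^ (3 * n))"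
    unfolding K4_S5_SAT_def frame_of_K4[symmetric]
    by (intro DSPACE_if_in_good_cloud[where L = K4_S5] product) simp_all
  show "S4_S5_SAT TYPE('a) TYPE('b) \<in> DSPACE (\<lambda>n. real n * 2 ^ (2 * n))"
    unfolding S4_S5_SAT_def frame_of_S4[symmetric]
    by (intro DSPACE_if_in_good_cloud[where L = S4_S5] product) simp_all
  show "SSL_SAT TYPE('w) \<in> DSPACE (\<lambda>n. real n * 2 ^ (2 * n))"
    unfolding SSL_SAT_def
    by (intro DSPACE_if_in_good_cloud[where L = SSL] parsed.SSL_satisfiable_iff)
      (simp_all add: parsed_def)
qed

end
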